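(* Let $k$ be an algebraically closed field of characteristic zero and let $R$ be a commutative Hopf $k$-algebra that is finitely generated as a $k$-algebra and is an integral domain. Let $\sigma$ be a $k$-algebra automorphism of $R$ and $\delta$ a $k$-linear $\sigma$-derivation on $R$. If the Ore extension $R[x;\sigma,\delta]$ admits a Hopf $k$-algebra structure (with coproduct $\Delta$) extending that of $R$, then, after a linear change of the variable $x$ (replacing $x$ by $\alpha x+\beta$ for some $\alpha\in k^*$, $\beta\in k$), $$\Delta(x)=a\otimes x+x\otimes b+w$$ for some $a,b\in R$, each of which is either $0$ or group-like, and some $w\in R\otimes_kR$. In particular, $R[x;\sigma,\delta]$ is a Hopf Ore extension of $R$.
   Context: A $k$-linear $\sigma$-derivation is a $k$-linear map $\delta:R\to R$ with $\delta(rs)=\sigma(r)\delta(s)+\delta(r)s$ for all $r,s\in R$. The Ore extension $R[x;\sigma,\delta]$ is the ring extension of $R$ that is a free left $R$-module with basis $\{x^n:n\ge 0\}$ and in which $xr=\sigma(r)x+\delta(r)$ for all $r\in R$. A Hopf algebra structure on $R[x;\sigma,\delta]$ extends that on $R$ if $R$ is a Hopf subalgebra. An element $a\in R$ is group-like if $a\neq 0$ and $\Delta(a)=a\otimes a$. An Ore extension $R[x;\sigma,\delta]$ with a Hopf algebra structure extending that of $R$ is called a Hopf Ore extension if, possibly after a change of the variable $x$, $\Delta(x)=a\otimes x+x\otimes b+v(x\otimes x)+w$ for some $a,b\in R$ and $v,w\in R\otimes_kR$. *)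

theory Defs
  imports "HOL-Computational_Algebra.Polynomial" "HOL-Library.Function_Algebras"
begin

section \<open>Tensor products of vector spaces\<close>

text \<open>
  A \<open>k\<close>-vector space is a type with a scalar multiplication satisfying the library locale
  \<^locale>\<open>vector_space\<close>. The tensor product of \<open>A\<close> and \<open>B\<close> is realised inside the linear dual of
  the space of bilinear forms on \<open>A \<times> B\<close>: the pure tensor \<open>a \<otimes> b\<close> is evaluation at \<open>(a, b)\<close>
  (and is set to 0 on functions that are not bilinear), and the tensor product is the span of
  the pure tensors. In this way tensors form a linear subspace of a type, and the type depends
  only on the types of \<open>A\<close>, \<open>B\<close> and \<open>k\<close>. The theorem \<open>tensor_universal_property\<close> below proves the
  universal property.
\<close>

definition fun_scale :: "'k::field \<Rightarrow> ('x \<Rightarrow> 'k) \<Rightarrow> ('x \<Rightarrow> 'k)" where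
  "fun_scale c f = (\<lambda>x. c * f x)"

definition bilinear_map ::
  "('k::field \<Rightarrow> 'a::ab_group_add \<Rightarrow> 'a) \<Rightarrow> ('k \<Rightarrow> 'b::ab_group_add \<Rightarrow> 'b) \<Rightarrow>
   ('k \<Rightarrow> 'c::ab_group_add \<Rightarrow> 'c) \<Rightarrow> ('a \<Rightarrow> 'b \<Rightarrow> 'c) \<Rightarrow> bool" where
  "bilinear_map sA sB sC \<phi> \<longleftrightarrow>
     (\<forall>b. Vector_Spaces.linear sA sC (\<lambda>a. \<phi> a b)) \<and> (\<forall>a. Vector_Spaces.linear sB sC (\<lambda>b. \<phi> a b))"

type_synonym ('a, 'b, 'k) tensor = "('a \<Rightarrow> 'b \<Rightarrow> 'k) \<Rightarrow> 'k"

definition pure_tensor ::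
  "('k::field \<Rightarrow> 'a::ab_group_add \<Rightarrow> 'a) \<Rightarrow> ('k \<Rightarrow> 'b::ab_group_add \<Rightarrow> 'b) \<Rightarrow>
   'a \<Rightarrow> 'b \<Rightarrow> ('a, 'b, 'k) tensor" where
  "pure_tensor sA sB a b = (\<lambda>\<beta>. if bilinear_map sA sB (*) \<beta> then \<beta> a b else 0)"

definition tensor_space ::
  "('k::field \<Rightarrow> 'a::ab_group_add \<Rightarrow> 'a) \<Rightarrow> ('k \<Rightarrow> 'b::ab_group_add \<Rightarrow> 'b) \<Rightarrow>
   ('a, 'b, 'k) tensor set" where
  "tensor_space sA sB = module.span fun_scale {pure_tensor sA sB a b | a b. True}"

text \<open>
  The linear map on tensors induced by a bilinear map. The Hilbert choice is harmless: the values
  on \<^const>\<open>tensor_space\<close> are uniquely determined, and only those are used.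
\<close>

definition tensor_lift ::
  "('k::field \<Rightarrow> 'a::ab_group_add \<Rightarrow> 'a) \<Rightarrow> ('k \<Rightarrow> 'b::ab_group_add \<Rightarrow> 'b) \<Rightarrow>
   ('k \<Rightarrow> 'c::ab_group_add \<Rightarrow> 'c) \<Rightarrow> ('a \<Rightarrow> 'b \<Rightarrow> 'c) \<Rightarrow> ('a, 'b, 'k) tensor \<Rightarrow> 'c" where
  "tensor_lift sA sB sC \<phi> =
     (SOME h. Vector_Spaces.linear fun_scale sC h \<and> (\<forall>a b. h (pure_tensor sA sB a b) = \<phi> a b))"

lemma vector_space_field: "vector_space ((*) :: 'k::field \<Rightarrow> 'k \<Rightarrow> 'k)"
  by unfold_locales (simp_all add: algebra_simps)

lemma vector_space_fun_scale: "vector_space (fun_scale :: 'k::field \<Rightarrow> ('x \<Rightarrow> 'k) \<Rightarrow> ('x \<Rightarrow> 'k))"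
  by unfold_locales (simp_all add: fun_scale_def fun_eq_iff algebra_simps)

lemma bilinear_map_pure_tensor:
  assumes "vector_space sA" "vector_space sB"
  shows "bilinear_map sA sB fun_scale (pure_tensor sA sB)"
  using assms vector_space_fun_scale
  by (auto simp: bilinear_map_def pure_tensor_def Vector_Spaces.linear_iff fun_scale_def fun_eq_iff)

lemma linear_functionals_separate:
  assumes "vector_space (s :: 'k::field \<Rightarrow> 'c::ab_group_add \<Rightarrow> 'c)"
    and "\<And>f. Vector_Spaces.linear s (*) f \<Longrightarrow> f v = 0"
  shows "v = 0"
proof (rule ccontr)
  interpret V: vector_space s by fact
  interpret P: vector_space_pair s "(*) :: 'k \<Rightarrow> 'k \<Rightarrow> 'k"
    by (intro vector_space_pair.intro assms(1) vector_space_field)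
  assume "v \<noteq> 0"
  then have "V.independent {v}"
    by simp
  then obtain g where "Vector_Spaces.linear s (*) g" "g v = 1"
    using P.linear_independent_extend[of "{v}" "\<lambda>_. 1"] by auto
  with assms(2)[of g] show False
    by simp
qed

lemma ex_tensor_lift:
  fixes sA :: "'k::field \<Rightarrow> 'a::ab_group_add \<Rightarrow> 'a" and sB :: "'k \<Rightarrow> 'b::ab_group_add \<Rightarrow> 'b"
    and sC :: "'k \<Rightarrow> 'c::ab_group_add \<Rightarrow> 'c"
  assumes "vector_space sA" "vector_space sB" "vector_space sC" and \<phi>: "bilinear_map sA sB sC \<phi>"
  shows "\<exists>h. Vector_Spaces.linear fun_scale sC h \<and> (\<forall>a b. h (pure_tensor sA sB a b) = \<phi> a b)"
proof -
  interpret V: vector_space "fun_scale :: 'k \<Rightarrow> ('a, 'b, 'k) tensor \<Rightarrow> ('a, 'b, 'k) tensor"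
    by (rule vector_space_fun_scale)
  interpret P: vector_space_pair "fun_scale :: 'k \<Rightarrow> ('a, 'b, 'k) tensor \<Rightarrow> ('a, 'b, 'k) tensor" sC
    by (intro vector_space_pair.intro vector_space_fun_scale assms(3))
  let ?P = "{pure_tensor sA sB a b | a b. True}"
  obtain B where B: "B \<subseteq> ?P" "V.independent B" "?P \<subseteq> V.span B"
    using V.maximal_independent_subset by blast
  have "\<exists>q. p = pure_tensor sA sB (fst q) (snd q)" if p: "p \<in> B" for p
  proof -
    from p B(1) obtain a b where "p = pure_tensor sA sB a b"
      by blast
    then have "p = pure_tensor sA sB (fst (a, b)) (snd (a, b))"
      by simp
    then show ?thesis ..
  qed
  then have "\<forall>p\<in>B. \<exists>q. p = pure_tensor sA sB (fst q) (snd q)"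
    by (intro ballI)
  from bchoice[OF this] obtain q where
    q: "\<forall>p\<in>B. p = pure_tensor sA sB (fst (q p)) (snd (q p))" ..
  from P.linear_independent_extend[OF B(2), of "\<lambda>p. \<phi> (fst (q p)) (snd (q p))"]
  obtain h where h: "Vector_Spaces.linear fun_scale sC h"
    and hq: "\<And>p. p \<in> B \<Longrightarrow> h p = \<phi> (fst (q p)) (snd (q p))"
    by blast
  have "h (pure_tensor sA sB a b) = \<phi> a b" for a b
  proof -
    have "f (h (pure_tensor sA sB a b) - \<phi> a b) = 0" if f: "Vector_Spaces.linear sC (*) f" for f
    proof -
      define \<beta> where "\<beta> = (\<lambda>a b. f (\<phi> a b))"
      have \<beta>: "bilinear_map sA sB (*) \<beta>"
        using \<phi> f by (simp add: \<beta>_def bilinear_map_def Vector_Spaces.linear_iff)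
      interpret Q: vector_space_pair "fun_scale :: 'k \<Rightarrow> ('a, 'b, 'k) tensor \<Rightarrow> _" "(*) :: 'k \<Rightarrow> 'k \<Rightarrow> 'k"
        by (intro vector_space_pair.intro vector_space_fun_scale vector_space_field)
      have "f (h t) = t \<beta>" if "t \<in> V.span B" for t
      proof (rule Q.linear_eq_on[where f = "\<lambda>t. f (h t)" and g = "\<lambda>t. t \<beta>", OF _ _ that])
        show "Vector_Spaces.linear fun_scale (*) (\<lambda>t. f (h t))"
          using h f by (simp add: Vector_Spaces.linear_iff)
        show "Vector_Spaces.linear fun_scale (*) (\<lambda>t :: ('a, 'b, 'k) tensor. t \<beta>)"
          using vector_space_fun_scale vector_space_field
          by (simp add: Vector_Spaces.linear_iff fun_scale_def)
        fix p assume p: "p \<in> B"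
        have "p \<beta> = pure_tensor sA sB (fst (q p)) (snd (q p)) \<beta>"
          by (rule fun_cong[OF bspec[OF q p]])
        also have "\<dots> = \<beta> (fst (q p)) (snd (q p))"
          by (simp only: pure_tensor_def \<beta> if_True)
        also have "\<dots> = f (h p)"
          by (simp only: hq[OF p] \<beta>_def)
        finally show "f (h p) = p \<beta>" ..
      qed
      moreover have "pure_tensor sA sB a b \<in> V.span B"
        using B(3) by blast
      ultimately have "f (h (pure_tensor sA sB a b)) = f (\<phi> a b)"
        using \<beta> by (simp add: pure_tensor_def \<beta>_def)
      with module_hom.diff[OF f[folded module_hom_iff_linear]] show ?thesis
        by simp
    qed
    then have "h (pure_tensor sA sB a b) - \<phi> a b = 0"
      by (rule linear_functionals_separate[OF assms(3)])
    then show ?thesis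
      by simp
  qed
  with h show ?thesis
    by blast
qed

theorem tensor_universal_property:
  fixes sA :: "'k::field \<Rightarrow> 'a::ab_group_add \<Rightarrow> 'a" and sB :: "'k \<Rightarrow> 'b::ab_group_add \<Rightarrow> 'b"
    and sC :: "'k \<Rightarrow> 'c::ab_group_add \<Rightarrow> 'c"
  assumes "vector_space sA" "vector_space sB" "vector_space sC" and "bilinear_map sA sB sC \<phi>"
  shows "Vector_Spaces.linear fun_scale sC (tensor_lift sA sB sC \<phi>)"
    and "tensor_lift sA sB sC \<phi> (pure_tensor sA sB a b) = \<phi> a b"
    and "\<lbrakk>Vector_Spaces.linear fun_scale sC h; \<And>a b. h (pure_tensor sA sB a b) = \<phi> a b;
          t \<in> tensor_space sA sB\<rbrakk> \<Longrightarrow> h t = tensor_lift sA sB sC \<phi> t"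
proof -
  from someI_ex[OF ex_tensor_lift[OF assms]]
  show 1: "Vector_Spaces.linear fun_scale sC (tensor_lift sA sB sC \<phi>)"
    and 2: "tensor_lift sA sB sC \<phi> (pure_tensor sA sB a b) = \<phi> a b" for a b
    by (simp_all add: tensor_lift_def)
  interpret P: vector_space_pair "fun_scale :: 'k \<Rightarrow> ('a, 'b, 'k) tensor \<Rightarrow> _" sC
    by (intro vector_space_pair.intro vector_space_fun_scale assms(3))
  show "h t = tensor_lift sA sB sC \<phi> t"
    if "Vector_Spaces.linear fun_scale sC h" "\<And>a b. h (pure_tensor sA sB a b) = \<phi> a b"
      "t \<in> tensor_space sA sB"
    by (rule P.linear_eq_on[OF that(1) 1 that(3)[unfolded tensor_space_def]]) (auto simp: that(2) 2)
qed

definition tensor_map ::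
  "('k::field \<Rightarrow> 'a::ab_group_add \<Rightarrow> 'a) \<Rightarrow> ('k \<Rightarrow> 'b::ab_group_add \<Rightarrow> 'b) \<Rightarrow>
   ('k \<Rightarrow> 'c::ab_group_add \<Rightarrow> 'c) \<Rightarrow> ('k \<Rightarrow> 'd::ab_group_add \<Rightarrow> 'd) \<Rightarrow>
   ('a \<Rightarrow> 'c) \<Rightarrow> ('b \<Rightarrow> 'd) \<Rightarrow> ('a, 'b, 'k) tensor \<Rightarrow> ('c, 'd, 'k) tensor" where
  "tensor_map sA sB sC sD f g = tensor_lift sA sB fun_scale (\<lambda>a b. pure_tensor sC sD (f a) (g b))"

text \<open>
  Note that \<open>*\<close> on the type of tensors is the pointwise product of functions; the product of the
  algebra \<open>A \<otimes> B\<close>, determined by \<open>(a \<otimes> b)(c \<otimes> d) = ac \<otimes> bd\<close>, is the following operation.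
\<close>

definition tensor_mult ::
  "('k::field \<Rightarrow> 'a::ring_1 \<Rightarrow> 'a) \<Rightarrow> ('k \<Rightarrow> 'b::ring_1 \<Rightarrow> 'b) \<Rightarrow>
   ('a, 'b, 'k) tensor \<Rightarrow> ('a, 'b, 'k) tensor \<Rightarrow> ('a, 'b, 'k) tensor" where
  "tensor_mult sA sB u v =
     tensor_lift sA sB fun_scale
       (\<lambda>a b. tensor_lift sA sB fun_scale (\<lambda>c d. pure_tensor sA sB (a * c) (b * d)) v) u"


section \<open>Algebras and Hopf algebras\<close>

locale k_algebra = vector_space scale
  for scale :: "'k::field \<Rightarrow> 'a::ring_1 \<Rightarrow> 'a" +
  assumes scale_mult_left: "scale c (x * y) = scale c x * y"
    and scale_mult_right: "scale c (x * y) = x * scale c y"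

lemma tensor_map_pure:
  assumes "Vector_Spaces.linear sA sC f" "Vector_Spaces.linear sB sD g"
  shows "tensor_map sA sB sC sD f g (pure_tensor sA sB a b) = pure_tensor sC sD (f a) (g b)"
proof -
  have V: "vector_space sA" "vector_space sB" "vector_space sC" "vector_space sD"
    using assms by (simp_all add: Vector_Spaces.linear_iff)
  have "bilinear_map sA sB fun_scale (\<lambda>a b. pure_tensor sC sD (f a) (g b))"
    using bilinear_map_pure_tensor[OF V(3,4)] assms
    by (simp add: bilinear_map_def Vector_Spaces.linear_iff)
  from tensor_universal_property(2)[OF V(1,2) vector_space_fun_scale this] show ?thesis
    by (simp add: tensor_map_def)
qed

lemma tensor_mult_pure:
  assumes "k_algebra sA" "k_algebra sB"
  shows "tensor_mult sA sB (pure_tensor sA sB a b) (pure_tensor sA sB c d) =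
           pure_tensor sA sB (a * c) (b * d)"
proof -
  have V: "vector_space sA" "vector_space sB"
    using assms by (simp_all add: k_algebra_def)
  note U = tensor_universal_property(2)[OF V vector_space_fun_scale]
  have L: "sA r (x * y) = sA r x * y" "sA r (x * y) = x * sA r y" for r x y
    by (rule k_algebra.scale_mult_left[OF assms(1)], rule k_algebra.scale_mult_right[OF assms(1)])
  have R: "sB r (x * y) = sB r x * y" "sB r (x * y) = x * sB r y" for r x y
    by (rule k_algebra.scale_mult_left[OF assms(2)], rule k_algebra.scale_mult_right[OF assms(2)])
  have 1: "bilinear_map sA sB fun_scale (\<lambda>c d. pure_tensor sA sB (a * c) (b * d))" for a b
    using bilinear_map_pure_tensor[OF V]
    by (simp add: bilinear_map_def Vector_Spaces.linear_iff distrib_left L(2)[symmetric] R(2)[symmetric])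
  have 2: "bilinear_map sA sB fun_scale (\<lambda>a b. pure_tensor sA sB (a * c) (b * d))"
    using bilinear_map_pure_tensor[OF V]
    by (simp add: bilinear_map_def Vector_Spaces.linear_iff distrib_right L(1)[symmetric] R(1)[symmetric])
  show ?thesis
    by (simp add: tensor_mult_def U[OF 1] U[OF 2])
qed

definition algebra_hom ::
  "('k::field \<Rightarrow> 'a::ring_1 \<Rightarrow> 'a) \<Rightarrow> ('k \<Rightarrow> 'b::ring_1 \<Rightarrow> 'b) \<Rightarrow> ('a \<Rightarrow> 'b) \<Rightarrow> bool" where
  "algebra_hom sA sB f \<longleftrightarrow>
     Vector_Spaces.linear sA sB f \<and> f 1 = 1 \<and> (\<forall>x y. f (x * y) = f x * f y)"

definition subalgebra :: "('k::field \<Rightarrow> 'a::ring_1 \<Rightarrow> 'a) \<Rightarrow> 'a set \<Rightarrow> bool" where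
  "subalgebra s A \<longleftrightarrow> module.subspace s A \<and> 1 \<in> A \<and> (\<forall>x\<in>A. \<forall>y\<in>A. x * y \<in> A)"

definition finitely_generated_algebra :: "('k::field \<Rightarrow> 'a::ring_1 \<Rightarrow> 'a) \<Rightarrow> bool" where
  "finitely_generated_algebra s \<longleftrightarrow> (\<exists>G. finite G \<and> subalgebra s hull G = UNIV)"

text \<open>
  In \<open>coassoc\<close> both sides are elements of \<open>A \<otimes> (A \<otimes> A)\<close>; the left-hand side is
  \<open>(\<Delta> \<otimes> id)(\<Delta> x)\<close> with the canonical identification \<open>(c \<otimes> d) \<otimes> b \<mapsto> c \<otimes> (d \<otimes> b)\<close> built in.
\<close>

locale hopf_algebra = k_algebra scale
  for scale :: "'k::field \<Rightarrow> 'a::ring_1 \<Rightarrow> 'a" +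
  fixes \<Delta> :: "'a \<Rightarrow> ('a, 'a, 'k) tensor" and \<epsilon> :: "'a \<Rightarrow> 'k" and S :: "'a \<Rightarrow> 'a"
  assumes comult_in: "\<Delta> x \<in> tensor_space scale scale"
    and comult_linear: "Vector_Spaces.linear scale fun_scale \<Delta>"
    and comult_one: "\<Delta> 1 = pure_tensor scale scale 1 1"
    and comult_mult: "\<Delta> (x * y) = tensor_mult scale scale (\<Delta> x) (\<Delta> y)"
    and counit_hom: "algebra_hom scale (*) \<epsilon>"
    and antipode_linear: "Vector_Spaces.linear scale scale S"
    and coassoc:
      "tensor_lift scale scale fun_scale
         (\<lambda>a b. tensor_lift scale scale fun_scale
            (\<lambda>c d. pure_tensor scale fun_scale c (pure_tensor scale scale d b)) (\<Delta> a)) (\<Delta> x)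
       = tensor_map scale scale scale fun_scale id \<Delta> (\<Delta> x)"
    and counit_left: "tensor_lift scale scale scale (\<lambda>a b. scale (\<epsilon> a) b) (\<Delta> x) = x"
    and counit_right: "tensor_lift scale scale scale (\<lambda>a b. scale (\<epsilon> b) a) (\<Delta> x) = x"
    and antipode_left: "tensor_lift scale scale scale (\<lambda>a b. S a * b) (\<Delta> x) = scale (\<epsilon> x) 1"
    and antipode_right: "tensor_lift scale scale scale (\<lambda>a b. a * S b) (\<Delta> x) = scale (\<epsilon> x) 1"

definition group_like ::
  "('k::field \<Rightarrow> 'a::ring_1 \<Rightarrow> 'a) \<Rightarrow> ('a \<Rightarrow> ('a, 'a, 'k) tensor) \<Rightarrow> 'a \<Rightarrow> bool" where
  "group_like s \<Delta> a \<longleftrightarrow> a \<noteq> 0 \<and> \<Delta> a = pure_tensor s s a a"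


section \<open>Ore extensions and Hopf Ore extensions\<close>

definition algebra_automorphism :: "('k::field \<Rightarrow> 'a::ring_1 \<Rightarrow> 'a) \<Rightarrow> ('a \<Rightarrow> 'a) \<Rightarrow> bool" where
  "algebra_automorphism s \<sigma> \<longleftrightarrow> algebra_hom s s \<sigma> \<and> bij \<sigma>"

definition skew_derivation ::
  "('k::field \<Rightarrow> 'a::ring_1 \<Rightarrow> 'a) \<Rightarrow> ('a \<Rightarrow> 'a) \<Rightarrow> ('a \<Rightarrow> 'a) \<Rightarrow> bool" where
  "skew_derivation s \<sigma> \<delta> \<longleftrightarrow>
     Vector_Spaces.linear s s \<delta> \<and> (\<forall>r t. \<delta> (r * t) = \<sigma> r * \<delta> t + \<delta> r * t)"

text \<open>
  \<open>ore_extension sR sT \<iota> \<sigma> \<delta> x\<close>: the algebra \<open>T\<close>, containing \<open>R\<close> through the embedding \<open>\<iota>\<close>, is the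
  Ore extension \<open>R[x; \<sigma>, \<delta>]\<close>. The type \<open>'r poly\<close> only serves as the type of finitely supported
  coefficient sequences.
\<close>

definition ore_extension ::
  "('k::field \<Rightarrow> 'r::ring_1 \<Rightarrow> 'r) \<Rightarrow> ('k \<Rightarrow> 't::ring_1 \<Rightarrow> 't) \<Rightarrow> ('r \<Rightarrow> 't) \<Rightarrow>
   ('r \<Rightarrow> 'r) \<Rightarrow> ('r \<Rightarrow> 'r) \<Rightarrow> 't \<Rightarrow> bool" where
  "ore_extension sR sT \<iota> \<sigma> \<delta> x \<longleftrightarrow>
     k_algebra sR \<and> k_algebra sT \<and> algebra_hom sR sT \<iota> \<and> inj \<iota> \<and>
     algebra_automorphism sR \<sigma> \<and> skew_derivation sR \<sigma> \<delta> \<and>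
     (\<forall>t. \<exists>!p :: 'r poly. t = (\<Sum>n\<le>degree p. \<iota> (coeff p n) * x ^ n)) \<and>
     (\<forall>r. x * \<iota> r = \<iota> (\<sigma> r) * x + \<iota> (\<delta> r))"

definition hopf_extension ::
  "('k::field \<Rightarrow> 'r::ring_1 \<Rightarrow> 'r) \<Rightarrow> ('r \<Rightarrow> ('r, 'r, 'k) tensor) \<Rightarrow> ('r \<Rightarrow> 'k) \<Rightarrow> ('r \<Rightarrow> 'r) \<Rightarrow>
   ('k \<Rightarrow> 't::ring_1 \<Rightarrow> 't) \<Rightarrow> ('t \<Rightarrow> ('t, 't, 'k) tensor) \<Rightarrow> ('t \<Rightarrow> 'k) \<Rightarrow> ('t \<Rightarrow> 't) \<Rightarrow>
   ('r \<Rightarrow> 't) \<Rightarrow> bool" where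
  "hopf_extension sR \<Delta>R \<epsilon>R SR sT \<Delta> \<epsilon> S \<iota> \<longleftrightarrow>
     hopf_algebra sR \<Delta>R \<epsilon>R SR \<and> hopf_algebra sT \<Delta> \<epsilon> S \<and> algebra_hom sR sT \<iota> \<and> inj \<iota> \<and>
     (\<forall>r. \<Delta> (\<iota> r) = tensor_map sR sR sT sT \<iota> \<iota> (\<Delta>R r)) \<and>
     (\<forall>r. \<epsilon> (\<iota> r) = \<epsilon>R r) \<and>
     (\<forall>r. S (\<iota> r) = \<iota> (SR r))"

text \<open>
  A change of the variable is the choice of some \<open>y\<close> in \<open>T\<close> that presents \<open>T\<close> as an Ore extension
  \<open>R[y; \<sigma>', \<delta>']\<close>.
\<close>

definition hopf_ore_extension ::
  "('k::field \<Rightarrow> 'r::ring_1 \<Rightarrow> 'r) \<Rightarrow> ('r \<Rightarrow> ('r, 'r, 'k) tensor) \<Rightarrow> ('r \<Rightarrow> 'k) \<Rightarrow> ('r \<Rightarrow> 'r) \<Rightarrow>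
   ('k \<Rightarrow> 't::ring_1 \<Rightarrow> 't) \<Rightarrow> ('t \<Rightarrow> ('t, 't, 'k) tensor) \<Rightarrow> ('t \<Rightarrow> 'k) \<Rightarrow> ('t \<Rightarrow> 't) \<Rightarrow>
   ('r \<Rightarrow> 't) \<Rightarrow> bool" where
  "hopf_ore_extension sR \<Delta>R \<epsilon>R SR sT \<Delta> \<epsilon> S \<iota> \<longleftrightarrow>
     hopf_extension sR \<Delta>R \<epsilon>R SR sT \<Delta> \<epsilon> S \<iota> \<and>
     (\<exists>\<sigma> \<delta> y a b. \<exists>v\<in>tensor_space sR sR. \<exists>w\<in>tensor_space sR sR.
        ore_extension sR sT \<iota> \<sigma> \<delta> y \<and>
        \<Delta> y = pure_tensor sT sT (\<iota> a) y + pure_tensor sT sT y (\<iota> b)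
               + tensor_mult sT sT (tensor_map sR sR sT sT \<iota> \<iota> v) (pure_tensor sT sT y y)
               + tensor_map sR sR sT sT \<iota> \<iota> w)"

end

theory Submission
  imports Defs
begin

text \<open>
  Write \<open>G\<close> for the set of algebra homomorphisms \<open>R \<rightarrow> k\<close>, the points of \<open>R\<close>. The proof treats elements of
  \<open>R\<close> as functions on the group \<open>G\<close>; the Nullstellensatz (\<open>points_separate\<close>) makes this faithful. An
  element of \<open>T = R[x; \<sigma>, \<delta>]\<close> is then a finitely supported sequence of functions on \<open>G\<close>, and an element
  of \<open>T \<otimes> T\<close> is a finitely supported array of functions on \<open>G \<times> G\<close>, its coefficients at \<open>x\<^sup>i \<otimes> x\<^sup>j\<close>.
  These functions are regular in each variable separately, and for such functions a product of
  nonzero ones is nonzero because \<open>R\<close> is a domain. So leading coefficients multiply, up to a twist by powers of \<open>\<sigma>\<close>.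

  The shape of \<open>\<Delta> x\<close> comes from the antipode in the form of the Galois map
  \<open>a \<otimes> b \<mapsto> \<Delta>(a)(1 \<otimes> b)\<close>, which is onto. Let \<open>(m, q)\<close> be the lexicographically largest exponent
  in \<open>\<Delta> x\<close>; the counit forces \<open>m \<ge> 1\<close>. If \<open>u\<close> has largest exponent \<open>(n, N)\<close>, then its image has
  largest exponent \<open>(m n, q n + N)\<close>. Choosing \<open>u\<close> with image \<open>x \<otimes> 1\<close> gives \<open>m n = 1\<close> and
  \<open>q n + N = 0\<close>, so \<open>(m, q) = (1, 0)\<close>: apart from the multiples of \<open>x \<otimes> 1\<close> all terms of \<open>\<Delta> x\<close> have
  first degree 0. The mirror image \<open>a \<otimes> b \<mapsto> (a \<otimes> 1)\<Delta>(b)\<close> bounds the second degree, and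
  \<open>\<Delta> x = s (1 \<otimes> x) + t (x \<otimes> 1) + w\<close> with functions \<open>s\<close>, \<open>t\<close>, \<open>w\<close> on \<open>G \<times> G\<close>
  (\<open>comult_variable_support\<close>).

  Coassociativity gives \<open>s(gh, k) = s(g, hk) s(h, k)\<close>, and the counit gives \<open>s(1, k) = 1\<close>. With
  \<open>f(g) = s(g, 1)\<close> this says \<open>s(g, h) f(h) = f(gh)\<close>, and \<open>f\<close> has the inverse \<open>h \<mapsto> s(h\<^sup>-\<^sup>1, h)\<close>. By
  Rosenlicht's theorem (\<open>unit_group_like\<close>) a unit with value 1 at the identity is a character, so
  \<open>f\<close> is group-like and \<open>s(g, h) = f(g)\<close>. In the same way \<open>t(g, h)\<close> is a character of \<open>h\<close>. This is the
  theorem for the variable \<open>x\<close> itself, with \<open>\<alpha> = 1\<close> and \<open>\<beta> = 0\<close>.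

  Rosenlicht's theorem is proved with invariant derivations \<open>D\<close>. They act locally finitely, so \<open>R\<close> is
  the sum of the generalized eigenspaces of \<open>D\<close>, a grading by the torsion-free group \<open>(k, +)\<close>. In a
  graded domain a unit is homogeneous, and on the homogeneous parts \<open>D\<close> minus its eigenvalue is a
  locally nilpotent derivation, which kills units; so \<open>D f = \<lambda> f\<close> (\<open>unit_eigenvector\<close>). For every
  point \<open>p\<close> the quotient of the translate \<open>f(p \<cdot>)\<close> by \<open>f\<close> is therefore killed by all invariant
  derivations, hence constant. The last step needs enough tangent vectors. Points and tangent vectors
  are both homomorphisms to the dual numbers \<open>k[\<epsilon>]\<close>, and both are produced by extending
  homomorphisms from a subring of \<open>R\<close> to \<open>R\<close>, one algebra generator at a time (\<open>extend_hom\<close>).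
\<close>

section \<open>Linear maps and tensors\<close>

(* Tensors are functions, so the pointwise simplification rules would rewrite a sum of tensors into
   a lambda abstraction whenever it occurs eta-expanded. *)
declare plus_fun_apply [simp del] zero_fun_apply [simp del] minus_apply [simp del] uminus_apply [simp del]

lemma linearI:
  assumes "vector_space s1" "vector_space s2" "\<And>x y. f (x + y) = f x + f y" "\<And>c x. f (s1 c x) = s2 c (f x)"
  shows "Vector_Spaces.linear s1 s2 f"
  using assms by (simp add: Vector_Spaces.linear_iff)

lemma bilinear_mapI:
  assumes "vector_space sA" "vector_space sB" "vector_space sC"
    and "\<And>a a' b. \<phi> (a + a') b = \<phi> a b + \<phi> a' b" "\<And>c a b. \<phi> (sA c a) b = sC c (\<phi> a b)"
    and "\<And>a b b'. \<phi> a (b + b') = \<phi> a b + \<phi> a b'" "\<And>c a b. \<phi> a (sB c b) = sC c (\<phi> a b)"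
  shows "bilinear_map sA sB sC \<phi>"
  using assms by (simp add: bilinear_map_def Vector_Spaces.linear_iff)

lemma linear_addD: "Vector_Spaces.linear s1 s2 f \<Longrightarrow> f (x + y) = f x + f y"
  and linear_scaleD: "Vector_Spaces.linear s1 s2 f \<Longrightarrow> f (s1 c x) = s2 c (f x)"
  by (simp_all add: Vector_Spaces.linear_iff)

lemma linear_zeroD: "Vector_Spaces.linear s1 s2 f \<Longrightarrow> f 0 = 0"
  by (simp add: module_hom_iff_linear[symmetric] module_hom.zero)

lemma linear_sumD: "Vector_Spaces.linear s1 s2 f \<Longrightarrow> f (\<Sum>i\<in>A. g i) = (\<Sum>i\<in>A. f (g i))"
  by (simp add: module_hom_iff_linear[symmetric] module_hom.sum)

lemma linear_diffD: "Vector_Spaces.linear s1 s2 f \<Longrightarrow> f (x - y) = f x - f y"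
  by (simp add: module_hom_iff_linear[symmetric] module_hom.diff)

lemma linear_minusD: "Vector_Spaces.linear s1 s2 f \<Longrightarrow> f (- y) = - f y"
  by (simp add: module_hom_iff_linear[symmetric] module_hom.neg)

locale tensor_vector_spaces = A: vector_space sA + B: vector_space sB
  for sA :: "'k::field \<Rightarrow> 'a::ab_group_add \<Rightarrow> 'a" and sB :: "'k \<Rightarrow> 'b::ab_group_add \<Rightarrow> 'b"
begin

abbreviation pt where "pt \<equiv> pure_tensor sA sB"
abbreviation TS where "TS \<equiv> tensor_space sA sB"

lemma VA: "vector_space sA" and VB: "vector_space sB"
  by unfold_locales

sublocale F: vector_space "fun_scale :: 'k \<Rightarrow> ('a, 'b, 'k) tensor \<Rightarrow> ('a, 'b, 'k) tensor"
  by (rule vector_space_fun_scale)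

lemma pt_bilinear: "bilinear_map sA sB fun_scale pt"
  by (rule bilinear_map_pure_tensor[OF VA VB])

lemma pt_add_left: "pt (a + a') b = pt a b + pt a' b"
  and pt_add_right: "pt a (b + b') = pt a b + pt a b'"
  and pt_scale_left: "pt (sA c a) b = fun_scale c (pt a b)"
  and pt_scale_right: "pt a (sB c b) = fun_scale c (pt a b)"
  using pt_bilinear by (simp_all add: bilinear_map_def Vector_Spaces.linear_iff)

lemma pt_zero_left [simp]: "pt 0 b = 0"
  using pt_add_left[of 0 0 b] by simp

lemma pt_zero_right [simp]: "pt a 0 = 0"
  using pt_add_right[of a 0 0] by simp

lemma pt_sum_left: "pt (\<Sum>i\<in>I. f i) b = (\<Sum>i\<in>I. pt (f i) b)"
  by (induction I rule: infinite_finite_induct) (simp_all add: pt_add_left)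

lemma pt_sum_right: "pt a (\<Sum>i\<in>I. f i) = (\<Sum>i\<in>I. pt a (f i))"
  by (induction I rule: infinite_finite_induct) (simp_all add: pt_add_right)

lemma TS_pt [simp, intro]: "pt a b \<in> TS"
  unfolding tensor_space_def by (rule F.span_base) blast

lemma TS_subspace: "F.subspace TS"
  unfolding tensor_space_def by (rule F.subspace_span)

lemma TS_add: "u \<in> TS \<Longrightarrow> v \<in> TS \<Longrightarrow> u + v \<in> TS"
  and TS_zero [simp]: "0 \<in> TS"
  and TS_diff: "u \<in> TS \<Longrightarrow> v \<in> TS \<Longrightarrow> u - v \<in> TS"
  using TS_subspace by (auto intro: F.subspace_add F.subspace_0 F.subspace_diff)

text \<open>Scalars can be absorbed into the first factor, so a property that holds for pure tensors and
  is stable under sums holds for all tensors.\<close>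
lemma TS_induct [consumes 1, case_names pure add]:
  assumes t: "t \<in> TS" and pure: "\<And>a b. P (pt a b)"
    and add: "\<And>u v. u \<in> TS \<Longrightarrow> v \<in> TS \<Longrightarrow> P u \<Longrightarrow> P v \<Longrightarrow> P (u + v)"
  shows "P t"
proof -
  have "t \<in> TS \<and> P t"
    using t[unfolded tensor_space_def]
  proof (induction rule: F.span_induct_alt)
    case base
    show ?case using pure[of 0 0] TS_zero by (simp only: pt_zero_left)
  next
    case (step c x y)
    then obtain a b where x: "x = pt a b" by blast
    have "fun_scale c x = pt (sA c a) b" by (simp add: x pt_scale_left)
    then show ?case using step pure[of "sA c a" b] by (auto intro: add TS_add)
  qed
  then show ?thesis ..
qed

lemma lift_pt:
  assumes "bilinear_map sA sB sC \<phi>"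
  shows "tensor_lift sA sB sC \<phi> (pt a b) = \<phi> a b"
proof -
  have "vector_space sC" using assms by (simp add: bilinear_map_def Vector_Spaces.linear_iff)
  then show ?thesis using tensor_universal_property(2)[OF VA VB _ assms] by blast
qed

lemma lift_linear:
  assumes "bilinear_map sA sB sC \<phi>"
  shows "Vector_Spaces.linear fun_scale sC (tensor_lift sA sB sC \<phi>)"
proof -
  have "vector_space sC" using assms by (simp add: bilinear_map_def Vector_Spaces.linear_iff)
  then show ?thesis using tensor_universal_property(1)[OF VA VB _ assms] by blast
qed

lemmas lift_add = linear_addD[OF lift_linear]
  and lift_zero = linear_zeroD[OF lift_linear]

text \<open>Expand all first factors in one basis of the first space and collect.\<close>
lemma tensor_independent_rep:
  assumes "t \<in> TS"
  shows "\<exists>E b. finite E \<and> A.independent E \<and> t = (\<Sum>e\<in>E. pt e (b e))"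
proof -
  obtain Bs where Bs: "A.independent Bs" "A.span Bs = UNIV"
    using A.maximal_independent_subset[of UNIV] by (metis top.extremum_uniqueI)
  have "\<exists>E b. finite E \<and> E \<subseteq> Bs \<and> (\<forall>e. e \<notin> E \<longrightarrow> b e = 0) \<and> t = (\<Sum>e\<in>E. pt e (b e))"
    using assms
  proof (induction rule: TS_induct)
    case (pure a b)
    from Bs have "a \<in> A.span Bs" by simp
    then obtain E r where E: "finite E" "E \<subseteq> Bs" "a = (\<Sum>e\<in>E. sA (r e) e)"
      unfolding A.span_explicit by auto
    show ?case
      by (rule exI[of _ E], rule exI[of _ "\<lambda>e. if e \<in> E then sB (r e) b else 0"])
         (use E in \<open>simp add: pt_sum_left pt_scale_left pt_scale_right\<close>)
  next
    case (add u v)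
    from add.IH(1) obtain E1 b1 where E1: "finite E1" "E1 \<subseteq> Bs" "\<forall>e. e \<notin> E1 \<longrightarrow> b1 e = 0"
      "u = (\<Sum>e\<in>E1. pt e (b1 e))" by blast
    from add.IH(2) obtain E2 b2 where E2: "finite E2" "E2 \<subseteq> Bs" "\<forall>e. e \<notin> E2 \<longrightarrow> b2 e = 0"
      "v = (\<Sum>e\<in>E2. pt e (b2 e))" by blast
    have "u = (\<Sum>e\<in>E1 \<union> E2. pt e (b1 e))"
      unfolding E1(4) by (rule sum.mono_neutral_left) (use E1 E2 in auto)
    moreover have "v = (\<Sum>e\<in>E1 \<union> E2. pt e (b2 e))"
      unfolding E2(4) by (rule sum.mono_neutral_left) (use E1 E2 in auto)
    ultimately have "u + v = (\<Sum>e\<in>E1 \<union> E2. pt e (b1 e + b2 e))"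
      by (simp add: sum.distrib pt_add_right)
    with E1 E2 show ?case
      by (intro exI[of _ "E1 \<union> E2"] exI[of _ "\<lambda>e. b1 e + b2 e"]) auto
  qed
  then obtain E b where "finite E" "E \<subseteq> Bs" "t = (\<Sum>e\<in>E. pt e (b e))" by blast
  with A.independent_mono[OF Bs(1)] show ?thesis by blast
qed

definition tensor_fun :: "('a \<Rightarrow> 'k) \<Rightarrow> ('b \<Rightarrow> 'k) \<Rightarrow> ('a, 'b, 'k) tensor \<Rightarrow> 'k" where
  "tensor_fun f g = tensor_lift sA sB (*) (\<lambda>a b. f a * g b)"

lemma tensor_fun_bilinear:
  assumes "Vector_Spaces.linear sA (*) f" "Vector_Spaces.linear sB (*) g"
  shows "bilinear_map sA sB (*) (\<lambda>a b. f a * g b)"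
  using assms by (simp add: bilinear_map_def Vector_Spaces.linear_iff algebra_simps)

lemma tensor_fun_pt:
  assumes "Vector_Spaces.linear sA (*) f" "Vector_Spaces.linear sB (*) g"
  shows "tensor_fun f g (pt a b) = f a * g b"
  unfolding tensor_fun_def by (rule lift_pt[OF tensor_fun_bilinear[OF assms]])

lemma tensor_fun_linear:
  assumes "Vector_Spaces.linear sA (*) f" "Vector_Spaces.linear sB (*) g"
  shows "Vector_Spaces.linear fun_scale (*) (tensor_fun f g)"
  unfolding tensor_fun_def by (rule lift_linear[OF tensor_fun_bilinear[OF assms]])

text \<open>Write a tensor with linearly independent first factors. Contracting with \<open>g \<in> \<Psi>\<close> leaves a
  combination of these factors with coefficients \<open>g(b\<^sub>e)\<close>, which \<open>\<Phi>\<close> shows to be zero.\<close>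
lemma tensor_separation:
  assumes t: "t \<in> TS"
    and \<Phi>: "\<And>f. f \<in> \<Phi> \<Longrightarrow> Vector_Spaces.linear sA (*) f" "\<And>a. (\<And>f. f \<in> \<Phi> \<Longrightarrow> f a = 0) \<Longrightarrow> a = 0"
    and \<Psi>: "\<And>g. g \<in> \<Psi> \<Longrightarrow> Vector_Spaces.linear sB (*) g" "\<And>b. (\<And>g. g \<in> \<Psi> \<Longrightarrow> g b = 0) \<Longrightarrow> b = 0"
    and 0: "\<And>f g. f \<in> \<Phi> \<Longrightarrow> g \<in> \<Psi> \<Longrightarrow> tensor_fun f g t = 0"
  shows "t = 0"
proof -
  obtain E b where E: "finite E" "A.independent E" "t = (\<Sum>e\<in>E. pt e (b e))"
    using tensor_independent_rep[OF t] by blast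
  have "b e = 0" if e: "e \<in> E" for e
  proof (rule \<Psi>(2))
    fix g assume g: "g \<in> \<Psi>"
    have "(\<Sum>e\<in>E. sA (g (b e)) e) = 0"
    proof (rule \<Phi>(2))
      fix f assume f: "f \<in> \<Phi>"
      have "f (\<Sum>e\<in>E. sA (g (b e)) e) = (\<Sum>e\<in>E. f e * g (b e))"
        by (simp add: linear_sumD[OF \<Phi>(1)[OF f]] linear_scaleD[OF \<Phi>(1)[OF f]] mult.commute)
      also have "\<dots> = tensor_fun f g t"
        by (simp add: E(3) linear_sumD[OF tensor_fun_linear[OF \<Phi>(1)[OF f] \<Psi>(1)[OF g]]]
             tensor_fun_pt[OF \<Phi>(1)[OF f] \<Psi>(1)[OF g]])
      finally show "f (\<Sum>e\<in>E. sA (g (b e)) e) = 0" using 0[OF f g] by simp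
    qed
    then show "g (b e) = 0"
      using A.independentD[OF E(2) E(1) order_refl _ e, of "\<lambda>e. g (b e)"] by simp
  qed
  then show ?thesis by (simp add: E(3))
qed

lemma lift_in_subspace:
  assumes t: "t \<in> TS" and \<phi>: "bilinear_map sA sB sC \<phi>" and W: "module.subspace sC W"
    and "\<And>a b. \<phi> a b \<in> W"
  shows "tensor_lift sA sB sC \<phi> t \<in> W"
proof -
  have "vector_space sC" using \<phi> by (simp add: bilinear_map_def Vector_Spaces.linear_iff)
  then interpret C: vector_space sC .
  show ?thesis
    using t by (induction rule: TS_induct) (simp_all add: lift_pt[OF \<phi>] lift_add[OF \<phi>] assms(4) C.subspace_add[OF W])
qed

lemma linear_lift:
  assumes t: "t \<in> TS" and \<phi>: "bilinear_map sA sB sC \<phi>" and f: "Vector_Spaces.linear sC sD f"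
  shows "f (tensor_lift sA sB sC \<phi> t) = tensor_lift sA sB sD (\<lambda>a b. f (\<phi> a b)) t"
proof -
  have \<psi>: "bilinear_map sA sB sD (\<lambda>a b. f (\<phi> a b))"
    using \<phi> f by (simp add: bilinear_map_def Vector_Spaces.linear_iff)
  show ?thesis
    using t by (induction rule: TS_induct) (simp_all add: lift_pt[OF \<phi>] lift_add[OF \<phi>] lift_pt[OF \<psi>] lift_add[OF \<psi>] linear_addD[OF f])
qed

text \<open>Off the span of the pure tensors the induced map depends on a choice, so linear dependence of
  \<open>tensor_lift\<close> on its bilinear map is only available at genuine tensors.\<close>
lemma lift_param_linear:
  assumes t: "t \<in> TS" and \<phi>: "\<And>z. bilinear_map sA sB sC (\<phi> z)"
    and lin: "\<And>a b. Vector_Spaces.linear sD sC (\<lambda>z. \<phi> z a b)"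
  shows "Vector_Spaces.linear sD sC (\<lambda>z. tensor_lift sA sB sC (\<phi> z) t)"
proof -
  have V: "vector_space sD" "vector_space sC" using lin by (auto simp: Vector_Spaces.linear_iff)
  then interpret C: vector_space sC by blast
  show ?thesis
  proof (rule linearI[OF V])
    show "tensor_lift sA sB sC (\<phi> (x + y)) t = tensor_lift sA sB sC (\<phi> x) t + tensor_lift sA sB sC (\<phi> y) t" for x y
      using t by (induction rule: TS_induct)
        (simp_all only: lift_pt[OF \<phi>] lift_add[OF \<phi>] ac_simps, rule linear_addD[OF lin])
    show "tensor_lift sA sB sC (\<phi> (sD c x)) t = sC c (tensor_lift sA sB sC (\<phi> x) t)" for c x
      using t by (induction rule: TS_induct)
        (simp_all only: lift_pt[OF \<phi>] lift_add[OF \<phi>] C.scale_right_distrib, rule linear_scaleD[OF lin])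
  qed
qed

text \<open>A functional on triple tensors \<open>A \<otimes> (A \<otimes> A)\<close> has to be given as a bilinear map on
  \<open>A\<close> and the whole type that contains \<open>A \<otimes> A\<close>. A projection onto the genuine tensors extends it.\<close>
lemma tensor_projection:
  "\<exists>\<pi>. Vector_Spaces.linear fun_scale fun_scale \<pi> \<and> range \<pi> \<subseteq> TS \<and> (\<forall>t\<in>TS. \<pi> t = t)"
proof -
  interpret P: vector_space_pair "fun_scale :: 'k \<Rightarrow> ('a, 'b, 'k) tensor \<Rightarrow> _" "fun_scale :: 'k \<Rightarrow> ('a, 'b, 'k) tensor \<Rightarrow> _"
    by (intro vector_space_pair.intro vector_space_fun_scale)
  have "Vector_Spaces.linear fun_scale fun_scale (\<lambda>t :: ('a, 'b, 'k) tensor. t)"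
    by (rule F.linear_ident)
  from P.linear_exists_left_inverse_on[OF this TS_subspace] show ?thesis
    by (auto simp: inj_on_def)
qed

end

locale tensor_algebras = kA: k_algebra sA + kB: k_algebra sB
  for sA :: "'k::field \<Rightarrow> 'a::ring_1 \<Rightarrow> 'a" and sB :: "'k \<Rightarrow> 'b::ring_1 \<Rightarrow> 'b"
begin

sublocale tensor_vector_spaces sA sB by unfold_locales

abbreviation tm where "tm \<equiv> tensor_mult sA sB"

lemma kA: "k_algebra sA" and kB: "k_algebra sB"
  by unfold_locales

lemmas tm_pt = tensor_mult_pure[OF kA kB]

lemma tm_inner: "bilinear_map sA sB fun_scale (\<lambda>c d. pt (a * c) (b * d))"
  by (rule bilinear_mapI[OF VA VB vector_space_fun_scale])
    (simp_all add: distrib_left kA.scale_mult_right[symmetric] kB.scale_mult_right[symmetric]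
       pt_add_left pt_add_right pt_scale_left pt_scale_right)

lemma tm_outer:
  assumes "v \<in> TS"
  shows "bilinear_map sA sB fun_scale (\<lambda>a b. tensor_lift sA sB fun_scale (\<lambda>c d. pt (a * c) (b * d)) v)"
  unfolding bilinear_map_def
  by (intro conjI allI lift_param_linear[OF assms tm_inner] linearI VA VB vector_space_fun_scale)
   (simp_all add: distrib_right kA.scale_mult_left[symmetric] kB.scale_mult_left[symmetric]
       pt_add_left pt_add_right pt_scale_left pt_scale_right)

lemma tm_add_left: "v \<in> TS \<Longrightarrow> tm (u + u') v = tm u v + tm u' v"
  unfolding tensor_mult_def by (rule lift_add[OF tm_outer])

lemma tm_zero_left: "v \<in> TS \<Longrightarrow> tm 0 v = 0"
  unfolding tensor_mult_def by (rule lift_zero[OF tm_outer])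

lemma tm_pt_left: "v \<in> TS \<Longrightarrow> tm (pt a b) v = tensor_lift sA sB fun_scale (\<lambda>c d. pt (a * c) (b * d)) v"
  unfolding tensor_mult_def by (rule lift_pt[OF tm_outer])

lemma tm_add_right:
  assumes "u \<in> TS" "v \<in> TS" "v' \<in> TS"
  shows "tm u (v + v') = tm u v + tm u v'"
  using assms(1) by (induction rule: TS_induct)
    (simp_all add: tm_pt_left TS_add assms lift_add[OF tm_inner] tm_add_left)

lemma tm_pt_right:
  assumes "u \<in> TS"
  shows "tm u (pt c d) = tensor_lift sA sB fun_scale (\<lambda>a b. pt (a * c) (b * d)) u"
proof -
  have "tensor_lift sA sB fun_scale (\<lambda>c d. pt (a * c) (b * d)) (pt c d) = pt (a * c) (b * d)" for a b
    by (rule lift_pt[OF tm_inner])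
  then show ?thesis by (simp add: tensor_mult_def)
qed

end

section \<open>Translations by functionals and points\<close>

definition trilinear_map ::
  "('k::field \<Rightarrow> 'a::ab_group_add \<Rightarrow> 'a) \<Rightarrow> ('k \<Rightarrow> 'c::ab_group_add \<Rightarrow> 'c) \<Rightarrow> ('a \<Rightarrow> 'a \<Rightarrow> 'a \<Rightarrow> 'c) \<Rightarrow> bool" where
  "trilinear_map s sC \<phi> \<longleftrightarrow> (\<forall>b c. Vector_Spaces.linear s sC (\<lambda>a. \<phi> a b c)) \<and>
     (\<forall>a c. Vector_Spaces.linear s sC (\<lambda>b. \<phi> a b c)) \<and> (\<forall>a b. Vector_Spaces.linear s sC (\<lambda>c. \<phi> a b c))"

definition points :: "('k::field \<Rightarrow> 'a::ring_1 \<Rightarrow> 'a) \<Rightarrow> ('a \<Rightarrow> 'k) set" where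
  "points s = {p. algebra_hom s (*) p}"

lemma pointsD:
  assumes "p \<in> points s"
  shows "Vector_Spaces.linear s (*) p" "p 1 = 1" "p (x * y) = p x * p y"
    "p (x + y) = p x + p y" "p (s c x) = c * p x" "p 0 = 0" "p (x - y) = p x - p y" "p (- x) = - p x"
proof -
  show *: "Vector_Spaces.linear s (*) p" "p 1 = 1" "p (x * y) = p x * p y"
    using assms by (auto simp: points_def algebra_hom_def)
  show "p (x + y) = p x + p y" "p (s c x) = c * p x" "p 0 = 0" "p (x - y) = p x - p y" "p (- x) = - p x"
    by (simp_all add: linear_addD[OF *(1)] linear_scaleD[OF *(1)] linear_zeroD[OF *(1)] linear_diffD[OF *(1)] linear_minusD[OF *(1)])
qed

context hopf_algebra
begin

sublocale tensor_algebras scale scale by unfold_locales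

lemma V: "vector_space scale" by unfold_locales

text \<open>Coassociativity in Sweedler form: \<open>\<Sum> \<phi>(x\<^sub>1\<^sub>1, x\<^sub>1\<^sub>2, x\<^sub>2) = \<Sum> \<phi>(x\<^sub>1, x\<^sub>2\<^sub>1, x\<^sub>2\<^sub>2)\<close>. It
  follows by applying the linear map \<open>H\<close> induced by \<open>\<phi>\<close> on triple tensors.\<close>
lemma coassoc_trilinear:
  assumes \<phi>: "trilinear_map scale sC \<phi>"
  shows "tensor_lift scale scale sC (\<lambda>a b. tensor_lift scale scale sC (\<lambda>c d. \<phi> c d b) (\<Delta> a)) (\<Delta> x)
       = tensor_lift scale scale sC (\<lambda>a b. tensor_lift scale scale sC (\<lambda>c d. \<phi> a c d) (\<Delta> b)) (\<Delta> x)"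
proof -
  note tri = \<phi>[unfolded trilinear_map_def]
  have VC: "vector_space sC" using tri by (auto simp: Vector_Spaces.linear_iff)
  have bil: "bilinear_map scale scale sC (\<phi> a)" for a
    using tri by (simp add: bilinear_map_def)
  have bil': "bilinear_map scale scale sC (\<lambda>c d. \<phi> c d b)" for b
    using tri by (simp add: bilinear_map_def)
  obtain \<pi> where \<pi>: "Vector_Spaces.linear fun_scale fun_scale \<pi>" "\<And>u. \<pi> u \<in> TS" "\<And>t. t \<in> TS \<Longrightarrow> \<pi> t = t"
    using tensor_projection by blast
  interpret T3: tensor_vector_spaces scale "fun_scale :: 'k \<Rightarrow> ('a, 'a, 'k) tensor \<Rightarrow> _"
    by (intro tensor_vector_spaces.intro V vector_space_fun_scale)
  (* The projection makes psi bilinear on the whole type, also where u is not a tensor. *)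
  define \<psi> where "\<psi> a u = tensor_lift scale scale sC (\<phi> a) (\<pi> u)" for a u
  have \<psi>: "bilinear_map scale fun_scale sC \<psi>"
    unfolding bilinear_map_def
  proof (intro conjI allI)
    show "Vector_Spaces.linear scale sC (\<lambda>a. \<psi> a u)" for u
      unfolding \<psi>_def using tri by (intro lift_param_linear[OF \<pi>(2) bil]) simp
    show "Vector_Spaces.linear fun_scale sC (\<psi> a)" for a
      unfolding \<psi>_def using lift_linear[OF bil] \<pi>(1) by (simp add: Vector_Spaces.linear_iff)
  qed
  define H where "H = tensor_lift scale fun_scale sC \<psi>"
  have Hlin: "Vector_Spaces.linear fun_scale sC H"
    unfolding H_def by (rule T3.lift_linear[OF \<psi>])
  have H: "H (pure_tensor scale fun_scale a u) = tensor_lift scale scale sC (\<phi> a) u" if "u \<in> TS" for a u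
    unfolding H_def by (simp add: T3.lift_pt[OF \<psi>]) (simp add: \<psi>_def \<pi>(3)[OF that])
  have in1: "bilinear_map scale scale fun_scale (\<lambda>c d. pure_tensor scale fun_scale c (pt d b))" for b
    by (rule bilinear_mapI[OF V V vector_space_fun_scale])
      (simp_all add: T3.pt_add_left T3.pt_scale_left T3.pt_add_right T3.pt_scale_right pt_add_left pt_scale_left)
  have out1: "bilinear_map scale scale fun_scale (\<lambda>a b. tensor_lift scale scale fun_scale
            (\<lambda>c d. pure_tensor scale fun_scale c (pt d b)) (\<Delta> a))"
    unfolding bilinear_map_def
  proof (intro conjI allI)
    show "Vector_Spaces.linear scale fun_scale (\<lambda>b. tensor_lift scale scale fun_scale
            (\<lambda>c d. pure_tensor scale fun_scale c (pt d b)) (\<Delta> a))" for a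
      by (intro lift_param_linear[OF comult_in in1] linearI V vector_space_fun_scale)
        (simp_all add: T3.pt_add_right T3.pt_scale_right pt_add_right pt_scale_right)
    show "Vector_Spaces.linear scale fun_scale (\<lambda>a. tensor_lift scale scale fun_scale
            (\<lambda>c d. pure_tensor scale fun_scale c (pt d b)) (\<Delta> a))" for b
      using lift_linear[OF in1] comult_linear by (simp add: Vector_Spaces.linear_iff)
  qed
  have in2: "bilinear_map scale scale fun_scale (\<lambda>a b. pure_tensor scale fun_scale (id a) (\<Delta> b))"
    using comult_linear by (intro bilinear_mapI[OF V V vector_space_fun_scale])
      (simp_all add: T3.pt_add_left T3.pt_scale_left T3.pt_add_right T3.pt_scale_right linear_addD[OF comult_linear] linear_scaleD[OF comult_linear])
  have "tensor_lift scale scale sC (\<lambda>a b. tensor_lift scale scale sC (\<lambda>c d. \<phi> c d b) (\<Delta> a)) (\<Delta> x)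
    = tensor_lift scale scale sC (\<lambda>a b. H (tensor_lift scale scale fun_scale
            (\<lambda>c d. pure_tensor scale fun_scale c (pt d b)) (\<Delta> a))) (\<Delta> x)"
    by (simp add: linear_lift[OF comult_in in1 Hlin] H lift_pt[OF bil])
  also have "\<dots> = H (tensor_lift scale scale fun_scale
         (\<lambda>a b. tensor_lift scale scale fun_scale
            (\<lambda>c d. pure_tensor scale fun_scale c (pure_tensor scale scale d b)) (\<Delta> a)) (\<Delta> x))"
    by (rule linear_lift[OF comult_in out1 Hlin, symmetric])
  also have "\<dots> = H (tensor_map scale scale scale fun_scale id \<Delta> (\<Delta> x))"
    by (simp only: coassoc)
  also have "\<dots> = tensor_lift scale scale sC (\<lambda>a b. tensor_lift scale scale sC (\<lambda>c d. \<phi> a c d) (\<Delta> b)) (\<Delta> x)"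
    unfolding tensor_map_def linear_lift[OF comult_in in2 Hlin] by (simp add: H comult_in)
  finally show ?thesis .
qed

text \<open>For a point \<open>p\<close>, \<open>ltrans p\<close> and \<open>rtrans p\<close> turn a function \<open>x\<close> on the group of points into
  \<open>h \<mapsto> x(p h)\<close> and \<open>h \<mapsto> x(h p)\<close>, and \<open>conv\<close> is the group law. For a tangent vector \<open>d\<close> at the identity,
  \<open>rtrans d\<close> is the left invariant derivation with value \<open>d\<close> there.\<close>
definition ltrans :: "('a \<Rightarrow> 'k) \<Rightarrow> 'a \<Rightarrow> 'a" where
  "ltrans f x = tensor_lift scale scale scale (\<lambda>a b. scale (f a) b) (\<Delta> x)"

definition rtrans :: "('a \<Rightarrow> 'k) \<Rightarrow> 'a \<Rightarrow> 'a" where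
  "rtrans g x = tensor_lift scale scale scale (\<lambda>a b. scale (g b) a) (\<Delta> x)"

definition conv :: "('a \<Rightarrow> 'k) \<Rightarrow> ('a \<Rightarrow> 'k) \<Rightarrow> 'a \<Rightarrow> 'k" where
  "conv f g x = tensor_fun f g (\<Delta> x)"

abbreviation lin :: "('a \<Rightarrow> 'k) \<Rightarrow> bool" where "lin \<equiv> Vector_Spaces.linear scale (*)"

lemma slice_l: assumes "lin f" shows "bilinear_map scale scale scale (\<lambda>a b. scale (f a) b)"
  by (rule bilinear_mapI[OF V V V])
   (simp_all add: linear_addD[OF assms] linear_scaleD[OF assms] algebra_simps)

lemma slice_r: assumes "lin f" shows "bilinear_map scale scale scale (\<lambda>a b. scale (f b) a)"
  by (rule bilinear_mapI[OF V V V])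
   (simp_all add: linear_addD[OF assms] linear_scaleD[OF assms] algebra_simps)

lemma ltrans_linear: "lin f \<Longrightarrow> Vector_Spaces.linear scale scale (ltrans f)"
  using lift_linear[OF slice_l] comult_linear by (simp add: Vector_Spaces.linear_iff ltrans_def)

lemma rtrans_linear: "lin f \<Longrightarrow> Vector_Spaces.linear scale scale (rtrans f)"
  using lift_linear[OF slice_r] comult_linear by (simp add: Vector_Spaces.linear_iff rtrans_def)

lemma apply_ltrans: "lin f \<Longrightarrow> lin g \<Longrightarrow> g (ltrans f x) = conv f g x"
  unfolding ltrans_def conv_def tensor_fun_def
  by (subst linear_lift[OF comult_in slice_l]) (simp_all add: linear_scaleD)

lemma apply_rtrans: "lin f \<Longrightarrow> lin g \<Longrightarrow> f (rtrans g x) = conv f g x"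
  unfolding rtrans_def conv_def tensor_fun_def
  by (subst linear_lift[OF comult_in slice_r]) (simp_all add: linear_scaleD mult.commute)

lemma conv_linear: "lin f \<Longrightarrow> lin g \<Longrightarrow> lin (conv f g)"
  using tensor_fun_linear[of f g] comult_linear by (simp add: Vector_Spaces.linear_iff conv_def)

lemma functional_eqI:
  assumes "\<And>f. lin f \<Longrightarrow> f a = f b" shows "a = b"
proof -
  have "a - b = 0"
    by (rule linear_functionals_separate[OF V]) (simp add: linear_diffD assms)
  then show ?thesis by simp
qed

lemma conv_assoc:
  assumes f: "lin f" and g: "lin g" and h: "lin h"
  shows "conv (conv f g) h = conv f (conv g h)"
proof
  fix x
  have tri: "trilinear_map scale (*) (\<lambda>a b c. f a * g b * h c)"
    unfolding trilinear_map_def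
    by (intro conjI allI linearI V vector_space_field)
      (simp_all add: linear_addD[OF f] linear_addD[OF g] linear_addD[OF h]
        linear_scaleD[OF f] linear_scaleD[OF g] linear_scaleD[OF h] algebra_simps)
  have mult: "Vector_Spaces.linear (*) (*) (\<lambda>y. c * y)" "Vector_Spaces.linear (*) (*) (\<lambda>y. y * c)" for c :: 'k
    using vector_space_field by (simp_all add: Vector_Spaces.linear_iff algebra_simps)
  have 1: "tensor_lift scale scale (*) (\<lambda>c d. f c * g d * h b) (\<Delta> a) = conv f g a * h b" for a b
    using linear_lift[OF comult_in tensor_fun_bilinear[OF f g] mult(2)] by (simp add: conv_def tensor_fun_def)
  have 2: "tensor_lift scale scale (*) (\<lambda>c d. f a * g c * h d) (\<Delta> b) = f a * conv g h b" for a b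
    using linear_lift[OF comult_in tensor_fun_bilinear[OF g h] mult(1)] by (simp add: conv_def tensor_fun_def mult.assoc)
  show "conv (conv f g) h x = conv f (conv g h) x"
    using coassoc_trilinear[OF tri, of x] unfolding 1 2 by (simp add: conv_def[of _ _ x] tensor_fun_def)
qed

lemma ltrans_ltrans:
  assumes f: "lin f" and g: "lin g"
  shows "ltrans g (ltrans f x) = ltrans (conv f g) x"
  by (rule functional_eqI) (simp add: apply_ltrans f g conv_linear conv_assoc)

lemma rtrans_rtrans:
  assumes f: "lin f" and g: "lin g"
  shows "rtrans f (rtrans g x) = rtrans (conv f g) x"
  by (rule functional_eqI) (simp add: apply_rtrans f g conv_linear conv_assoc)

lemma ltrans_rtrans:
  assumes f: "lin f" and g: "lin g"
  shows "ltrans f (rtrans g x) = rtrans g (ltrans f x)"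
proof (rule functional_eqI)
  fix h assume h: "lin h"
  have "h (ltrans f (rtrans g x)) = conv (conv f h) g x"
    by (simp add: apply_ltrans[OF f h] apply_rtrans[OF conv_linear[OF f h] g])
  also have "\<dots> = h (rtrans g (ltrans f x))"
    by (simp add: conv_assoc f g h apply_rtrans[OF h g] apply_ltrans[OF f conv_linear[OF h g]])
  finally show "h (ltrans f (rtrans g x)) = h (rtrans g (ltrans f x))" .
qed

lemma \<epsilon>_point: "\<epsilon> \<in> points scale"
  using counit_hom by (simp add: points_def)

lemma ltrans_\<epsilon>: "ltrans \<epsilon> x = x" and rtrans_\<epsilon>: "rtrans \<epsilon> x = x"
  unfolding ltrans_def rtrans_def by (rule counit_left counit_right)+

text \<open>Translation by a point is the composition of the two homomorphisms \<open>\<Delta>\<close> and \<open>p \<otimes> id\<close>.\<close>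
lemma ltrans_mult:
  assumes p: "p \<in> points scale"
  shows "ltrans p (x * y) = ltrans p x * ltrans p y"
proof -
  note l = pointsD[OF p]
  have "tensor_lift scale scale scale (\<lambda>a b. scale (p a) b) (tm u v) =
    tensor_lift scale scale scale (\<lambda>a b. scale (p a) b) u * tensor_lift scale scale scale (\<lambda>a b. scale (p a) b) v"
    if "u \<in> TS" "v \<in> TS" for u v
    using that
  proof (induction u rule: TS_induct)
    case (pure a b)
    from pure show ?case
      by (induction v rule: TS_induct)
       (simp_all add: tm_pt lift_pt[OF slice_l[OF l(1)]] l tm_add_right lift_add[OF slice_l[OF l(1)]] distrib_left
         scale_mult_left[symmetric] scale_mult_right[symmetric])
  next
    case (add u u')
    then show ?case by (simp add: tm_add_left lift_add[OF slice_l[OF l(1)]] distrib_right)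
  qed
  from this[OF comult_in comult_in] show ?thesis by (simp add: ltrans_def comult_mult)
qed

lemma ltrans_one: "p \<in> points scale \<Longrightarrow> ltrans p 1 = 1"
  by (simp add: ltrans_def comult_one lift_pt[OF slice_l] pointsD)

lemma conv_point: "p \<in> points scale \<Longrightarrow> q \<in> points scale \<Longrightarrow> conv p q \<in> points scale"
  unfolding points_def algebra_hom_def mem_Collect_eq
  by (simp add: conv_linear apply_ltrans[symmetric] ltrans_mult ltrans_one points_def algebra_hom_def)

lemma conv_\<epsilon>_left: "lin f \<Longrightarrow> conv \<epsilon> f = f" and conv_\<epsilon>_right: "lin f \<Longrightarrow> conv f \<epsilon> = f"
  using apply_ltrans[of \<epsilon> f] apply_rtrans[of f \<epsilon>] pointsD(1)[OF \<epsilon>_point] by (auto simp: ltrans_\<epsilon> rtrans_\<epsilon> fun_eq_iff)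

lemma antipode_lin: "lin f \<Longrightarrow> lin (\<lambda>x. f (S x))"
  using antipode_linear by (simp add: Vector_Spaces.linear_iff)

lemma S_bil_l: "bilinear_map scale scale scale (\<lambda>a b. S a * b)"
  and S_bil_r: "bilinear_map scale scale scale (\<lambda>a b. a * S b)"
  by (rule bilinear_mapI[OF V V V], simp_all add: linear_addD[OF antipode_linear] linear_scaleD[OF antipode_linear]
     distrib_left distrib_right scale_mult_left[symmetric] scale_mult_right[symmetric])+

lemma conv_antipode:
  assumes p: "p \<in> points scale"
  shows "conv (\<lambda>x. p (S x)) p = \<epsilon>" "conv p (\<lambda>x. p (S x)) = \<epsilon>"
proof -
  note l = pointsD[OF p]
  show "conv (\<lambda>x. p (S x)) p = \<epsilon>"
  proof
    fix x
    have "conv (\<lambda>x. p (S x)) p x = p (tensor_lift scale scale scale (\<lambda>a b. S a * b) (\<Delta> x))"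
      unfolding conv_def tensor_fun_def by (subst linear_lift[OF comult_in S_bil_l l(1)]) (simp add: l)
    then show "conv (\<lambda>x. p (S x)) p x = \<epsilon> x" by (simp add: antipode_left l)
  qed
  show "conv p (\<lambda>x. p (S x)) = \<epsilon>"
  proof
    fix x
    have "conv p (\<lambda>x. p (S x)) x = p (tensor_lift scale scale scale (\<lambda>a b. a * S b) (\<Delta> x))"
      unfolding conv_def tensor_fun_def by (subst linear_lift[OF comult_in S_bil_r l(1)]) (simp add: l)
    then show "conv p (\<lambda>x. p (S x)) x = \<epsilon> x" by (simp add: antipode_right l)
  qed
qed

text \<open>Translation by \<open>p\<close> is multiplicative, and its inverse is the translation by \<open>p \<circ> S\<close>. The
  inverse is multiplicative too, and \<open>p \<circ> S\<close> is recovered from it by applying the counit.\<close>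
lemma antipode_point:
  assumes p: "p \<in> points scale"
  shows "(\<lambda>x. p (S x)) \<in> points scale"
proof -
  note l = pointsD[OF p]
  let ?q = "\<lambda>x. p (S x)"
  have q: "lin ?q" by (rule antipode_lin[OF l(1)])
  have 1: "ltrans p (ltrans ?q x) = x" and 2: "ltrans ?q (ltrans p x) = x" for x
    by (simp_all add: ltrans_ltrans l q conv_antipode[OF p] ltrans_\<epsilon>)
  have \<epsilon>q: "\<epsilon> (ltrans ?q x) = ?q x" for x
    using apply_ltrans[OF q pointsD(1)[OF \<epsilon>_point]] conv_\<epsilon>_right[OF q] by simp
  have "ltrans ?q (x * y) = ltrans ?q x * ltrans ?q y" for x y
    by (metis 1 2 ltrans_mult[OF p])
  then have "?q (x * y) = ?q x * ?q y" for x y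
    by (metis \<epsilon>q pointsD(3)[OF \<epsilon>_point])
  moreover have "?q 1 = 1"
    by (metis \<epsilon>q 2 ltrans_one[OF p] pointsD(2)[OF \<epsilon>_point])
  ultimately show ?thesis
    using q by (simp add: points_def algebra_hom_def)
qed

end

section \<open>Extension of homomorphisms to the dual numbers\<close>

text \<open>The ring \<open>k[\<epsilon>]\<close> with \<open>\<epsilon>\<^sup>2 = 0\<close>. A homomorphism into it is a point together with a tangent vector
  at that point.\<close>
datatype 'a dual = Dual (re: 'a) (du: 'a)

instantiation dual :: (comm_ring_1) comm_ring_1
begin

definition "0 = Dual 0 0"
definition "1 = Dual 1 0"
definition "x + y = Dual (re x + re y) (du x + du y)"
definition "x - y = Dual (re x - re y) (du x - du y)"
definition "- x = Dual (- re x) (- du x)"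
definition "x * y = Dual (re x * re y) (re x * du y + du x * re y)"

instance
  by standard
    (simp_all add: zero_dual_def one_dual_def plus_dual_def minus_dual_def uminus_dual_def times_dual_def algebra_simps)

end

lemma re_simps [simp]: "re 0 = 0" "re 1 = 1" "re (x + y) = re x + re y" "re (x - y) = re x - re y"
    "re (- x) = - re x" "re (x * y) = re x * re y"
  and du_simps [simp]: "du 0 = 0" "du 1 = 0" "du (x + y) = du x + du y" "du (x - y) = du x - du y"
    "du (- x) = - du x" "du (x * y) = re x * du y + du x * re y"
  by (simp_all add: zero_dual_def one_dual_def plus_dual_def minus_dual_def uminus_dual_def times_dual_def)

lemma dual_unit: "re x \<noteq> (0 :: 'k::field) \<Longrightarrow> \<exists>y. x * y = 1"
  by (rule exI[of _ "Dual (1 / re x) (- du x / (re x * re x))"])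
    (simp add: dual.expand)

lemma dual_cancel: "re x \<noteq> (0 :: 'k::field) \<Longrightarrow> x * y = 0 \<Longrightarrow> y = 0"
proof -
  assume "re x \<noteq> 0" "x * y = 0"
  then obtain z where "x * z = 1" using dual_unit by blast
  then have "y = z * (x * y)" by (metis mult.assoc mult.commute mult_1)
  with \<open>x * y = 0\<close> show "y = 0" by simp
qed

lemma re_power [simp]: "re (x ^ n) = re x ^ n" by (induction n) simp_all

lemma re_poly: "re (poly P z) = poly (map_poly re P) (re z)"
  by (induction P) (simp_all add: map_poly_pCons)

text \<open>The derivative is taken of the reduced polynomial over the field: the increment \<open>h\<close> kills the
  \<open>\<epsilon>\<close>-part of whatever it multiplies, and the dual numbers are not a domain.\<close>
lemma dual_taylor:
  fixes P :: "'k::field dual poly"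
  assumes h: "re h = 0"
  shows "poly P (z + h) = poly P z + h * Dual (poly (pderiv (map_poly re P)) (re z)) 0"
proof (induction P)
  case (pCons a P)
  have "poly (pCons a P) (z + h) = poly (pCons a P) z + h * (poly P z + z * Dual (poly (pderiv (map_poly re P)) (re z)) 0)
      + h * h * Dual (poly (pderiv (map_poly re P)) (re z)) 0"
    unfolding poly_pCons pCons.IH by (simp add: algebra_simps)
  also have "h * h = 0" using h by (simp add: dual.expand)
  also have "h * (poly P z + z * Dual (poly (pderiv (map_poly re P)) (re z)) 0)
      = h * Dual (poly (pderiv (map_poly re (pCons a P))) (re z)) 0"
    using h by (simp add: dual.expand map_poly_pCons pderiv_pCons re_poly algebra_simps)
  finally show ?case by simp
qed (simp add: dual.expand)

text \<open>One Newton step is exact because \<open>\<epsilon>\<^sup>2 = 0\<close>.\<close>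
lemma dual_root_lift:
  fixes P :: "'k::field dual poly"
  assumes "re (poly P z) = 0" "poly (pderiv (map_poly re P)) (re z) \<noteq> 0"
  shows "\<exists>z'. poly P z' = 0"
proof -
  define h where "h = Dual 0 (- du (poly P z) / poly (pderiv (map_poly re P)) (re z))"
  have "poly P (z + h) = poly P z + h * Dual (poly (pderiv (map_poly re P)) (re z)) 0"
    by (rule dual_taylor) (simp add: h_def)
  also have "\<dots> = 0" using assms by (simp add: h_def dual.expand)
  finally show ?thesis by blast
qed

definition subring :: "'r::comm_ring_1 set \<Rightarrow> bool" where
  "subring A \<longleftrightarrow> 1 \<in> A \<and> (\<forall>x\<in>A. \<forall>y\<in>A. x - y \<in> A \<and> x * y \<in> A)"

lemma subringD:
  assumes "subring A"
  shows "1 \<in> A" "0 \<in> A" "x \<in> A \<Longrightarrow> y \<in> A \<Longrightarrow> x - y \<in> A" "x \<in> A \<Longrightarrow> y \<in> A \<Longrightarrow> x * y \<in> A"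
    "x \<in> A \<Longrightarrow> - x \<in> A" "x \<in> A \<Longrightarrow> y \<in> A \<Longrightarrow> x + y \<in> A"
proof -
  show 1: "1 \<in> A" and d: "x \<in> A \<Longrightarrow> y \<in> A \<Longrightarrow> x - y \<in> A" and "x \<in> A \<Longrightarrow> y \<in> A \<Longrightarrow> x * y \<in> A" for x y
    using assms by (auto simp: subring_def)
  show 0: "0 \<in> A" using d[OF 1 1] by simp
  show m: "x \<in> A \<Longrightarrow> - x \<in> A" for x using d[OF 0, of x] by simp
  show "x \<in> A \<Longrightarrow> y \<in> A \<Longrightarrow> x + y \<in> A" using d[OF _ m, of x y] by simp
qed

lemma subring_sum: "subring A \<Longrightarrow> (\<And>i. i \<in> I \<Longrightarrow> f i \<in> A) \<Longrightarrow> (\<Sum>i\<in>I. f i) \<in> A"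
  by (induction I rule: infinite_finite_induct) (auto intro: subringD)

lemma subring_power: "subring A \<Longrightarrow> x \<in> A \<Longrightarrow> x ^ n \<in> A"
  by (induction n) (auto intro: subringD)

lemma subring_of_nat: "subring A \<Longrightarrow> of_nat n \<in> A"
  by (induction n) (auto intro: subringD)

definition polys_over :: "'r::comm_ring_1 set \<Rightarrow> 'r poly set" where
  "polys_over A = {P. \<forall>i. coeff P i \<in> A}"

lemma polys_overD: "P \<in> polys_over A \<Longrightarrow> coeff P i \<in> A"
  by (simp add: polys_over_def)

lemma polys_over_closed:
  assumes "subring A"
  shows "0 \<in> polys_over A" "1 \<in> polys_over A" "a \<in> A \<Longrightarrow> [:a:] \<in> polys_over A"
    "a \<in> A \<Longrightarrow> monom a n \<in> polys_over A"
    "P \<in> polys_over A \<Longrightarrow> Q \<in> polys_over A \<Longrightarrow> P - Q \<in> polys_over A"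
    "P \<in> polys_over A \<Longrightarrow> Q \<in> polys_over A \<Longrightarrow> P + Q \<in> polys_over A"
    "P \<in> polys_over A \<Longrightarrow> - P \<in> polys_over A"
    "P \<in> polys_over A \<Longrightarrow> Q \<in> polys_over A \<Longrightarrow> P * Q \<in> polys_over A"
    "a \<in> A \<Longrightarrow> P \<in> polys_over A \<Longrightarrow> smult a P \<in> polys_over A"
  using subringD[OF assms]
  by (auto simp: polys_over_def coeff_mult coeff_pCons split: nat.split intro!: subring_sum[OF assms])

lemma pderiv_over: "subring A \<Longrightarrow> P \<in> polys_over (A :: 'r::idom set) \<Longrightarrow> pderiv P \<in> polys_over A"
  by (auto simp: polys_over_def coeff_pderiv simp del: of_nat_Suc intro!: subringD(4) subring_of_nat)

definition adjoin :: "'r::comm_ring_1 set \<Rightarrow> 'r \<Rightarrow> 'r set" where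
  "adjoin A y = {poly P y | P. P \<in> polys_over A}"

lemma adjoinI: "P \<in> polys_over A \<Longrightarrow> poly P y \<in> adjoin A y"
  by (auto simp: adjoin_def)

lemma subring_adjoin:
  assumes A: "subring A" shows "subring (adjoin A y)" "A \<subseteq> adjoin A y" "y \<in> adjoin A y"
proof -
  show "subring (adjoin A y)"
    unfolding subring_def
  proof (intro conjI ballI)
    show "1 \<in> adjoin A y" using adjoinI[OF polys_over_closed(2)[OF A], of y] by simp
    fix u v assume "u \<in> adjoin A y" "v \<in> adjoin A y"
    then obtain P Q where "P \<in> polys_over A" "u = poly P y" "Q \<in> polys_over A" "v = poly Q y"
      by (auto simp: adjoin_def)
    then show "u - v \<in> adjoin A y" "u * v \<in> adjoin A y"
      using adjoinI[OF polys_over_closed(5)[OF A], of P Q y] adjoinI[OF polys_over_closed(8)[OF A], of P Q y] by simp_all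
  qed
  show "A \<subseteq> adjoin A y"
    using adjoinI[OF polys_over_closed(3)[OF A], of _ y] by auto
  show "y \<in> adjoin A y"
    using adjoinI[OF polys_over_closed(4)[OF A subringD(1)[OF A], of 1], of y] by (simp add: poly_monom)
qed

definition ring_hom_on :: "'r::comm_ring_1 set \<Rightarrow> ('r \<Rightarrow> 'l::comm_ring_1) \<Rightarrow> bool" where
  "ring_hom_on A \<phi> \<longleftrightarrow> \<phi> 1 = 1 \<and> (\<forall>x\<in>A. \<forall>y\<in>A. \<phi> (x + y) = \<phi> x + \<phi> y \<and> \<phi> (x * y) = \<phi> x * \<phi> y)"

context
  fixes A :: "'r::comm_ring_1 set" and \<phi> :: "'r \<Rightarrow> 'l::comm_ring_1"
  assumes A: "subring A" and \<phi>: "ring_hom_on A \<phi>"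
begin

lemma hom_simps: "\<phi> 1 = 1" "\<phi> 0 = 0"
  "x \<in> A \<Longrightarrow> y \<in> A \<Longrightarrow> \<phi> (x + y) = \<phi> x + \<phi> y" "x \<in> A \<Longrightarrow> y \<in> A \<Longrightarrow> \<phi> (x * y) = \<phi> x * \<phi> y"
proof -
  show *: "\<phi> 1 = 1" "x \<in> A \<Longrightarrow> y \<in> A \<Longrightarrow> \<phi> (x + y) = \<phi> x + \<phi> y"
    "x \<in> A \<Longrightarrow> y \<in> A \<Longrightarrow> \<phi> (x * y) = \<phi> x * \<phi> y" for x y
    using \<phi> by (auto simp: ring_hom_on_def)
  show "\<phi> 0 = 0" using *(2)[OF subringD(2)[OF A] subringD(2)[OF A]] by simp
qed

lemma hom_sum: "(\<And>i. i \<in> I \<Longrightarrow> f i \<in> A) \<Longrightarrow> \<phi> (\<Sum>i\<in>I. f i) = (\<Sum>i\<in>I. \<phi> (f i))"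
  by (induction I rule: infinite_finite_induct) (simp_all add: hom_simps subring_sum[OF A])

lemma hom_power: "x \<in> A \<Longrightarrow> \<phi> (x ^ n) = \<phi> x ^ n"
  by (induction n) (simp_all add: hom_simps subring_power[OF A])

lemma hom_of_nat: "\<phi> (of_nat n) = of_nat n"
  by (induction n) (simp_all add: hom_simps subring_of_nat[OF A] subringD[OF A])

lemma coeff_map_hom: "coeff (map_poly \<phi> P) i = \<phi> (coeff P i)"
  by (simp add: coeff_map_poly hom_simps)

lemma map_hom_simps:
  assumes "P \<in> polys_over A" "Q \<in> polys_over A"
  shows "map_poly \<phi> (P + Q) = map_poly \<phi> P + map_poly \<phi> Q"
    "map_poly \<phi> (P * Q) = map_poly \<phi> P * map_poly \<phi> Q"
  using assms
  by (auto intro!: poly_eqI simp: coeff_map_hom coeff_mult hom_simps polys_overD hom_sum subringD[OF A])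

lemma map_hom_smult: "a \<in> A \<Longrightarrow> P \<in> polys_over A \<Longrightarrow> map_poly \<phi> (smult a P) = smult (\<phi> a) (map_poly \<phi> P)"
  by (auto intro!: poly_eqI simp: coeff_map_hom hom_simps polys_overD)

lemma map_hom_const: "map_poly \<phi> [:a:] = [:\<phi> a:]"
  by (auto intro!: poly_eqI simp: coeff_map_hom hom_simps coeff_pCons split: nat.split)

text \<open>The value at \<open>poly P y\<close> is read off from any such \<open>P\<close>; the hypothesis says that it does not
  depend on the choice.\<close>
lemma extend_to_adjoin:
  assumes z: "\<And>P. P \<in> polys_over A \<Longrightarrow> poly P y = 0 \<Longrightarrow> poly (map_poly \<phi> P) z = 0"
  shows "\<exists>\<phi>'. ring_hom_on (adjoin A y) \<phi>' \<and> (\<forall>P\<in>polys_over A. \<phi>' (poly P y) = poly (map_poly \<phi> P) z)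
            \<and> (\<forall>x\<in>A. \<phi>' x = \<phi> x)"
proof -
  define \<phi>' where "\<phi>' u = poly (map_poly \<phi> (SOME P. P \<in> polys_over A \<and> poly P y = u)) z" for u
  have eq: "\<phi>' (poly P y) = poly (map_poly \<phi> P) z" if P: "P \<in> polys_over A" for P
  proof -
    define Q where "Q = (SOME Q. Q \<in> polys_over A \<and> poly Q y = poly P y)"
    have Q: "Q \<in> polys_over A" "poly Q y = poly P y"
      using someI[of "\<lambda>Q. Q \<in> polys_over A \<and> poly Q y = poly P y" P] P by (auto simp: Q_def)
    have d: "Q - P \<in> polys_over A" by (intro polys_over_closed[OF A] P Q)
    have "map_poly \<phi> Q = map_poly \<phi> (Q - P) + map_poly \<phi> P"
      using map_hom_simps(1)[OF d P] by simp
    then show ?thesis using z[OF d] Q by (simp add: \<phi>'_def Q_def[symmetric])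
  qed
  have const: "\<phi>' x = \<phi> x" if "x \<in> A" for x
    using eq[OF polys_over_closed(3)[OF A that]] by (simp add: map_hom_const)
  have "ring_hom_on (adjoin A y) \<phi>'"
    unfolding ring_hom_on_def
  proof (intro conjI ballI)
    show "\<phi>' 1 = 1" using const[OF subringD(1)[OF A]] by (simp add: hom_simps)
    fix u v assume "u \<in> adjoin A y" "v \<in> adjoin A y"
    then obtain P Q where PQ: "P \<in> polys_over A" "u = poly P y" "Q \<in> polys_over A" "v = poly Q y"
      by (auto simp: adjoin_def)
    show "\<phi>' (u + v) = \<phi>' u + \<phi>' v"
      using eq[OF polys_over_closed(6)[OF A PQ(1,3)]] by (simp add: PQ eq map_hom_simps)
    show "\<phi>' (u * v) = \<phi>' u * \<phi>' v"
      using eq[OF polys_over_closed(8)[OF A PQ(1,3)]] by (simp add: PQ eq map_hom_simps)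
  qed
  with eq const show ?thesis by blast
qed

end

lemma map_hom_pderiv:
  fixes \<phi> :: "'r::idom \<Rightarrow> 'l::idom"
  assumes A: "subring A" and \<phi>: "ring_hom_on A \<phi>" and P: "P \<in> polys_over A"
  shows "map_poly \<phi> (pderiv P) = pderiv (map_poly \<phi> P)"
  using hom_simps[OF A \<phi>] hom_of_nat[OF A \<phi>] subring_of_nat[OF A] polys_overD[OF P]
  by (intro poly_eqI) (simp add: coeff_map_hom[OF A \<phi>] coeff_pderiv del: of_nat_Suc)

text \<open>Division with remainder over a subring that need not be a field, at the price of a power of the
  leading coefficient.\<close>
lemma pseudo_division:
  fixes F G :: "'r::idom poly"
  assumes A: "subring A" and F: "F \<in> polys_over A" and G: "G \<in> polys_over A" "G \<noteq> 0"
  shows "\<exists>m Q H. Q \<in> polys_over A \<and> H \<in> polys_over A \<and> smult (lead_coeff G ^ m) F = Q * G + H \<and>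
           (H = 0 \<or> degree H < degree G)"
  using F
proof (induction "if F = 0 then 0 else Suc (degree F)" arbitrary: F rule: less_induct)
  case less
  show ?case
  proof (cases "F = 0 \<or> degree F < degree G")
    case True
    then show ?thesis
      using less.prems polys_over_closed(1)[OF A]
      by (intro exI[of _ 0] exI[of _ "0 :: 'r poly"] exI[of _ F]) auto
  next
    case False
    define c where "c = lead_coeff G"
    define M where "M = monom (lead_coeff F) (degree F - degree G)"
    define F1 where "F1 = smult c F - M * G"
    have c: "c \<noteq> 0" "c \<in> A" using G by (auto simp: c_def polys_overD)
    have M: "M \<in> polys_over A"
      using less.prems by (auto simp: M_def polys_overD intro: polys_over_closed[OF A])
    have F1: "F1 \<in> polys_over A" unfolding F1_def
      by (intro polys_over_closed[OF A] less.prems M G c)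
    have "degree (M * G) \<le> degree F"
      using False degree_mult_le[of M G] degree_monom_le[of "lead_coeff F" "degree F - degree G"] unfolding M_def by linarith
    then have le: "degree F1 \<le> degree F"
      unfolding F1_def by (intro degree_diff_le) auto
    have "coeff (M * G) (degree F) = lead_coeff F * c"
      using False by (simp add: M_def coeff_monom_mult c_def)
    then have "coeff F1 (degree F) = 0" by (simp add: F1_def)
    then have "F1 = 0 \<or> degree F1 < degree F"
      using le by (metis le_neq_implies_less leading_coeff_0_iff)
    then have "(if F1 = 0 then 0 else Suc (degree F1)) < (if F = 0 then 0 else Suc (degree F))"
      using False by auto
    from less.hyps[OF this F1] obtain m Q H where QH: "Q \<in> polys_over A" "H \<in> polys_over A"
      "smult (c ^ m) F1 = Q * G + H" "H = 0 \<or> degree H < degree G"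
      unfolding c_def by blast
    have "smult (c ^ Suc m) F = smult (c ^ m) F1 + smult (c ^ m) M * G"
      by (simp add: F1_def smult_diff_right mult.commute)
    also have "\<dots> = (Q + smult (c ^ m) M) * G + H"
      by (simp add: QH(3) algebra_simps)
    finally show ?thesis
      using QH M c unfolding c_def[symmetric]
      by (intro exI[of _ "Suc m"] exI[of _ "Q + smult (c ^ m) M"] exI[of _ H])
        (auto intro!: polys_over_closed[OF A] subring_power[OF A])
  qed
qed

text \<open>The polynomial of least degree with root \<open>y\<close> is coprime to every polynomial that does not
  vanish at \<open>y\<close>. The Euclidean algorithm runs with pseudo-division, and all remainders stay
  nonzero at \<open>y\<close>.\<close>
lemma minimal_polynomial_bezout:
  fixes F G :: "'r::idom poly"
  assumes A: "subring A" and F: "F \<in> polys_over A" "F \<noteq> 0" "poly F y = 0"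
    and min: "\<And>Q. Q \<in> polys_over A \<Longrightarrow> Q \<noteq> 0 \<Longrightarrow> poly Q y = 0 \<Longrightarrow> degree F \<le> degree Q"
    and G: "G \<in> polys_over A" "poly G y \<noteq> 0"
  shows "\<exists>U W a. U \<in> polys_over A \<and> W \<in> polys_over A \<and> a \<in> A \<and> a \<noteq> 0 \<and> U * F + W * G = [:a:]"
  using G
proof (induction "degree G" arbitrary: G rule: less_induct)
  case less
  have G0: "G \<noteq> 0" using less.prems by auto
  consider "degree G = 0" | "0 < degree G" "degree G < degree F" | "degree F \<le> degree G" by linarith
  then show ?case
  proof cases
    case 1
    then obtain g where g: "G = [:g:]" using degree_eq_zeroE by blast
    then have "g \<in> A" "g \<noteq> 0" using polys_overD[OF less.prems(1), of 0] G0 by auto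
    then show ?thesis using g polys_over_closed(1,2)[OF A]
      by (intro exI[of _ "0 :: 'r poly"] exI[of _ "1 :: 'r poly"] exI[of _ g]) auto
  next
    case 2
    obtain m Q H where QH: "Q \<in> polys_over A" "H \<in> polys_over A"
      "smult (lead_coeff G ^ m) F = Q * G + H" "H = 0 \<or> degree H < degree G"
      using pseudo_division[OF A F(1) less.prems(1) G0] by blast
    define c where "c = lead_coeff G ^ m"
    have c: "c \<noteq> 0" "c \<in> A" using G0 by (auto simp: c_def polys_overD[OF less.prems(1)] intro: subring_power[OF A])
    have eq: "smult c F = Q * G + H" using QH(3) by (simp add: c_def)
    have "H \<noteq> 0"
    proof
      assume "H = 0"
      then have eq': "smult c F = Q * G" using eq by simp
      then have Q0: "Q \<noteq> 0" using c F by auto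
      have "poly Q y * poly G y = 0" using arg_cong[OF eq', of "\<lambda>P. poly P y"] F(3) by simp
      then have "degree F \<le> degree Q" using min[OF QH(1) Q0] less.prems(2) by simp
      moreover have "degree F = degree Q + degree G"
        using arg_cong[OF eq', of degree] c Q0 G0 by (simp add: degree_mult_eq)
      ultimately show False using 2 by simp
    qed
    then have d: "degree H < degree G" using QH(4) by simp
    have "poly H y \<noteq> 0" using min[OF QH(2) \<open>H \<noteq> 0\<close>] d 2 by linarith
    from less.hyps[OF d QH(2) this] obtain U W a where U: "U \<in> polys_over A" "W \<in> polys_over A" "a \<in> A" "a \<noteq> 0"
      "U * F + W * H = [:a:]" by blast
    have H: "H = smult c F - Q * G" using eq by simp
    have "(U + smult c W) * F + (- (W * Q)) * G = [:a:]"
      unfolding U(5)[symmetric] H by (simp add: algebra_simps)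
    moreover have "U + smult c W \<in> polys_over A" "- (W * Q) \<in> polys_over A"
      using U QH c by (auto intro!: polys_over_closed[OF A])
    ultimately show ?thesis using U by blast
  next
    case 3
    obtain m Q H where QH: "Q \<in> polys_over A" "H \<in> polys_over A"
      "smult (lead_coeff F ^ m) G = Q * F + H" "H = 0 \<or> degree H < degree F"
      using pseudo_division[OF A less.prems(1) F(1,2)] by blast
    define c where "c = lead_coeff F ^ m"
    have c: "c \<noteq> 0" "c \<in> A" using F by (auto simp: c_def polys_overD intro: subring_power[OF A])
    have eq: "smult c G = Q * F + H" using QH(3) by (simp add: c_def)
    have "c * poly G y = poly H y" using arg_cong[OF eq, of "\<lambda>P. poly P y"] F(3) by simp
    then have Hy: "poly H y \<noteq> 0" using c less.prems(2) by auto
    then have d: "degree H < degree G" using QH(4) 3 by auto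
    from less.hyps[OF d QH(2) Hy] obtain U W a where U: "U \<in> polys_over A" "W \<in> polys_over A" "a \<in> A" "a \<noteq> 0"
      "U * F + W * H = [:a:]" by blast
    have H: "H = smult c G - Q * F" using eq by simp
    have "(U - W * Q) * F + smult c W * G = [:a:]"
      unfolding U(5)[symmetric] H by (simp add: algebra_simps)
    moreover have "U - W * Q \<in> polys_over A" "smult c W \<in> polys_over A"
      using U QH c by (auto intro!: polys_over_closed[OF A])
    ultimately show ?thesis using U by blast
  qed
qed

lemma map_poly_re_hom:
  assumes "subring A" "ring_hom_on A \<phi>"
  shows "map_poly re (map_poly \<phi> P) = map_poly (\<lambda>x. re (\<phi> x)) P"
  by (rule poly_eqI) (simp add: coeff_map_poly hom_simps[OF assms])

lemma poly_nonroot: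
  fixes P :: "'k::field_char_0 poly"
  assumes "P \<noteq> 0" shows "\<exists>z. poly P z \<noteq> 0"
  using poly_all_0_iff_0[of P] assms by auto

text \<open>If \<open>y\<close> is transcendental over \<open>A\<close>, it can be sent anywhere, in particular to a number at which
  \<open>b\<close> does not vanish. If \<open>y\<close> has minimal polynomial \<open>F\<close>, it must be sent to a root of the image of \<open>F\<close>.
  The Bezout identity for \<open>F\<close> and its derivative makes every root of the reduction simple, so that it
  lifts to the dual numbers; the one for \<open>F\<close> and \<open>b\<close> keeps the image of \<open>b\<close> invertible.\<close>
lemma extend_hom_adjoin:
  fixes A :: "'r::idom set" and y :: 'r
  assumes A: "subring A" and b: "b \<in> adjoin A y" "b \<noteq> 0"
    and char: "\<And>n. n > 0 \<Longrightarrow> (of_nat n :: 'r) \<noteq> 0"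
  shows "\<exists>a\<in>A. a \<noteq> 0 \<and> (\<forall>\<phi> :: 'r \<Rightarrow> 'k::{alg_closed_field,field_char_0} dual. ring_hom_on A \<phi> \<longrightarrow> re (\<phi> a) \<noteq> 0 \<longrightarrow>
     (\<exists>\<phi>'. ring_hom_on (adjoin A y) \<phi>' \<and> (\<forall>x\<in>A. \<phi>' x = \<phi> x) \<and> re (\<phi>' b) \<noteq> 0))"
proof -
  obtain B where B: "B \<in> polys_over A" "b = poly B y" using b(1) by (auto simp: adjoin_def)
  show ?thesis
  proof (cases "\<exists>P\<in>polys_over A. P \<noteq> 0 \<and> poly P y = 0")
    case False
    define a where "a = lead_coeff B"
    show ?thesis
    proof (intro bexI[of _ a] conjI allI impI)
      show "a \<noteq> 0" using B b by (auto simp: a_def)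
      show "a \<in> A" using B by (simp add: a_def polys_overD)
      fix \<phi> :: "'r \<Rightarrow> 'k dual" assume \<phi>: "ring_hom_on A \<phi>" "re (\<phi> a) \<noteq> 0"
      have "coeff (map_poly re (map_poly \<phi> B)) (degree B) \<noteq> 0"
        using \<phi>(2) by (simp add: coeff_map_poly coeff_map_hom[OF A \<phi>(1)] a_def)
      then obtain z0 where z0: "poly (map_poly re (map_poly \<phi> B)) z0 \<noteq> 0"
        using poly_nonroot by (metis coeff_0)
      have "poly (map_poly \<phi> P) (Dual z0 0) = 0" if "P \<in> polys_over A" "poly P y = 0" for P
        using that False by auto
      from extend_to_adjoin[OF A \<phi>(1) this] obtain \<phi>' where \<phi>': "ring_hom_on (adjoin A y) \<phi>'"
        "\<And>P. P\<in>polys_over A \<Longrightarrow> \<phi>' (poly P y) = poly (map_poly \<phi> P) (Dual z0 0)" "\<forall>x\<in>A. \<phi>' x = \<phi> x"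
        by blast
      have "re (\<phi>' b) \<noteq> 0" using z0 by (simp add: B \<phi>'(2)[OF B(1)] re_poly)
      with \<phi>' show "\<exists>\<phi>'. ring_hom_on (adjoin A y) \<phi>' \<and> (\<forall>x\<in>A. \<phi>' x = \<phi> x) \<and> re (\<phi>' b) \<noteq> 0" by blast
    qed
  next
    case True
    define isr where "isr P \<longleftrightarrow> P \<in> polys_over A \<and> P \<noteq> 0 \<and> poly P y = 0" for P
    obtain F where F: "isr F" "\<And>Q. isr Q \<Longrightarrow> degree F \<le> degree Q"
      using True ex_has_least_nat[of isr _ degree] unfolding isr_def[abs_def] by blast
    have F': "F \<in> polys_over A" "F \<noteq> 0" "poly F y = 0"
      and min: "\<And>Q. Q \<in> polys_over A \<Longrightarrow> Q \<noteq> 0 \<Longrightarrow> poly Q y = 0 \<Longrightarrow> degree F \<le> degree Q"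
      using F by (auto simp: isr_def)
    have degF: "degree F > 0"
    proof (rule ccontr)
      assume "\<not> degree F > 0"
      then obtain f where "F = [:f:]" using degree_eq_zeroE by blast
      then show False using F' by simp
    qed
    define c where "c = lead_coeff F"
    have c: "c \<in> A" "c \<noteq> 0" using F' by (auto simp: c_def polys_overD)
    have dF: "pderiv F \<in> polys_over A" by (intro pderiv_over[OF A] F')
    have cd: "coeff (pderiv F) (degree F - 1) \<noteq> 0"
      using degF char[of "degree F"] c by (simp add: coeff_pderiv c_def del: of_nat_Suc)
    have "degree (pderiv F) \<le> degree F - 1"
      by (rule degree_le) (auto simp: coeff_pderiv coeff_eq_0 simp del: of_nat_Suc)
    then have "degree (pderiv F) < degree F" using degF by linarith
    then have "poly (pderiv F) y \<noteq> 0"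
      using min[OF dF] cd by force
    from minimal_polynomial_bezout[OF A F' min dF this] obtain U1 W1 a1 where
      1: "U1 \<in> polys_over A" "W1 \<in> polys_over A" "a1 \<in> A" "a1 \<noteq> 0" "U1 * F + W1 * pderiv F = [:a1:]" by blast
    have "poly B y \<noteq> 0" using B b by simp
    from minimal_polynomial_bezout[OF A F' min B(1) this] obtain U2 W2 a2 where
      2: "U2 \<in> polys_over A" "W2 \<in> polys_over A" "a2 \<in> A" "a2 \<noteq> 0" "U2 * F + W2 * B = [:a2:]" by blast
    (* c keeps the degree of F, a1 its roots simple, and a2 the image of b nonzero. *)
    define a where "a = c * (a1 * a2)"
    show ?thesis
    proof (intro bexI[of _ a] conjI allI impI)
      show "a \<noteq> 0" using c 1 2 by (simp add: a_def)
      show "a \<in> A" using c 1 2 by (auto simp: a_def intro: subringD[OF A])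
      fix \<phi> :: "'r \<Rightarrow> 'k dual" assume \<phi>: "ring_hom_on A \<phi>" "re (\<phi> a) \<noteq> 0"
      note hs = hom_simps[OF A \<phi>(1)] and ms = map_hom_simps[OF A \<phi>(1)] and cl = polys_over_closed[OF A]
      have "\<phi> a = \<phi> c * (\<phi> a1 * \<phi> a2)" using c 1 2 by (simp add: a_def hs subringD[OF A])
      then have nz0: "re (\<phi> c) \<noteq> 0" "re (\<phi> a1) \<noteq> 0" "re (\<phi> a2) \<noteq> 0" using \<phi>(2) by auto
      define f where "f = map_poly re (map_poly \<phi> F)"
      have "coeff f (degree F) \<noteq> 0"
        using nz0 by (simp add: f_def coeff_map_poly coeff_map_hom[OF A \<phi>(1)] c_def)
      then have "degree f > 0" using degF le_degree[of f "degree F"] by linarith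
      then obtain z0 where z0: "poly f z0 = 0" using alg_closed_imp_poly_has_root by blast
      have r1: "re (poly (map_poly \<phi> F) (Dual z0 0)) = 0" using z0 by (simp add: re_poly f_def)
      have \<rho>: "ring_hom_on A (\<lambda>x. re (\<phi> x))"
        using \<phi>(1) by (simp add: ring_hom_on_def)
      have f: "f = map_poly (\<lambda>x. re (\<phi> x)) F"
        unfolding f_def by (rule map_poly_re_hom[OF A \<phi>(1)])
      have "poly (map_poly (\<lambda>x. re (\<phi> x)) U1) z0 * poly f z0 + poly (map_poly (\<lambda>x. re (\<phi> x)) W1) z0 * poly (pderiv f) z0 = re (\<phi> a1)"
        using arg_cong[OF 1(5), of "\<lambda>P. poly (map_poly (\<lambda>x. re (\<phi> x)) P) z0"] 1(1-4) F' dF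
        by (simp add: map_hom_simps[OF A \<rho>] cl map_hom_const[OF A \<rho>] map_hom_pderiv[OF A \<rho>] f)
      then have r2: "poly (pderiv (map_poly re (map_poly \<phi> F))) (re (Dual z0 0)) \<noteq> 0"
        using z0 nz0 by (auto simp: f_def)
      from dual_root_lift[OF r1 r2] obtain z where z: "poly (map_poly \<phi> F) z = 0" by blast
      (* F divides every polynomial with root y up to a power of c, which phi sends to a unit. *)
      have "poly (map_poly \<phi> P) z = 0" if P: "P \<in> polys_over A" "poly P y = 0" for P
      proof -
        obtain m Q H where QH: "Q \<in> polys_over A" "H \<in> polys_over A"
           "smult (c ^ m) P = Q * F + H" "H = 0 \<or> degree H < degree F"
          using pseudo_division[OF A P(1) F'(1,2)] unfolding c_def by blast
        have "poly H y = 0" using arg_cong[OF QH(3), of "\<lambda>P. poly P y"] F'(3) P(2) by simp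
        then have "H = 0" using QH min by force
        then have "map_poly \<phi> (smult (c ^ m) P) = map_poly \<phi> Q * map_poly \<phi> F"
          using QH F' by (simp add: ms)
        then have "smult (\<phi> c ^ m) (map_poly \<phi> P) = map_poly \<phi> Q * map_poly \<phi> F"
          using c P by (simp add: map_hom_smult[OF A \<phi>(1)] subring_power[OF A] hom_power[OF A \<phi>(1)])
        from arg_cong[OF this, of "\<lambda>P. poly P z"] z have "\<phi> c ^ m * poly (map_poly \<phi> P) z = 0"
          by simp
        then show ?thesis using dual_cancel[of "\<phi> c ^ m"] nz0 by simp
      qed
      from extend_to_adjoin[OF A \<phi>(1) this] obtain \<phi>' where \<phi>': "ring_hom_on (adjoin A y) \<phi>'"
        "\<And>P. P\<in>polys_over A \<Longrightarrow> \<phi>' (poly P y) = poly (map_poly \<phi> P) z" "\<forall>x\<in>A. \<phi>' x = \<phi> x"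
        by blast
      have "poly (map_poly \<phi> W2) z * poly (map_poly \<phi> B) z = \<phi> a2"
        using arg_cong[OF 2(5), of "\<lambda>P. poly (map_poly \<phi> P) z"] 2(1-4) F' B z
        by (simp add: ms cl map_hom_const[OF A \<phi>(1)])
      from arg_cong[OF this, of re] have "re (\<phi>' b) \<noteq> 0"
        using nz0 by (auto simp: B(2) \<phi>'(2)[OF B(1)])
      with \<phi>' show "\<exists>\<phi>'. ring_hom_on (adjoin A y) \<phi>' \<and> (\<forall>x\<in>A. \<phi>' x = \<phi> x) \<and> re (\<phi>' b) \<noteq> 0" by blast
    qed
  qed
qed

lemma subring_foldl_adjoin: "subring A \<Longrightarrow> subring (foldl adjoin A ys) \<and> A \<subseteq> foldl adjoin A ys \<and> set ys \<subseteq> foldl adjoin A ys"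
proof (induction ys arbitrary: A)
  case (Cons y ys)
  from subring_adjoin[OF Cons.prems, of y] Cons.IH[of "adjoin A y"] show ?case by auto
qed simp

text \<open>Passing to \<open>a\<close> turns the condition on \<open>b\<close> at the end of a chain of adjunctions into a condition
  on the homomorphism at the beginning.\<close>
lemma extend_hom:
  fixes A :: "'r::idom set"
  assumes A: "subring A" and b: "b \<in> foldl adjoin A ys" "b \<noteq> 0"
    and char: "\<And>n. n > 0 \<Longrightarrow> (of_nat n :: 'r) \<noteq> 0"
  shows "\<exists>a\<in>A. a \<noteq> 0 \<and> (\<forall>\<phi> :: 'r \<Rightarrow> 'k::{alg_closed_field,field_char_0} dual. ring_hom_on A \<phi> \<longrightarrow> re (\<phi> a) \<noteq> 0 \<longrightarrow>
     (\<exists>\<phi>'. ring_hom_on (foldl adjoin A ys) \<phi>' \<and> (\<forall>x\<in>A. \<phi>' x = \<phi> x) \<and> re (\<phi>' b) \<noteq> 0))"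
  using A b
proof (induction ys arbitrary: A)
  case Nil
  then show ?case by auto
next
  case (Cons y ys)
  note sa = subring_adjoin[OF Cons.prems(1), of y]
  from Cons.IH[OF sa(1)] Cons.prems obtain a' where a': "a' \<in> adjoin A y" "a' \<noteq> 0"
    "\<And>\<phi> :: 'r \<Rightarrow> 'k dual. ring_hom_on (adjoin A y) \<phi> \<Longrightarrow> re (\<phi> a') \<noteq> 0 \<Longrightarrow>
     (\<exists>\<phi>'. ring_hom_on (foldl adjoin (adjoin A y) ys) \<phi>' \<and> (\<forall>x\<in>adjoin A y. \<phi>' x = \<phi> x) \<and> re (\<phi>' b) \<noteq> 0)"
    by auto
  from extend_hom_adjoin[OF Cons.prems(1) a'(1,2) char] obtain a where a: "a \<in> A" "a \<noteq> 0"
    "\<And>\<phi> :: 'r \<Rightarrow> 'k dual. ring_hom_on A \<phi> \<Longrightarrow> re (\<phi> a) \<noteq> 0 \<Longrightarrow>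
     (\<exists>\<phi>'. ring_hom_on (adjoin A y) \<phi>' \<and> (\<forall>x\<in>A. \<phi>' x = \<phi> x) \<and> re (\<phi>' a') \<noteq> 0)"
    by blast
  show ?case
  proof (intro bexI[OF _ a(1)] conjI a(2) allI impI)
    fix \<phi> :: "'r \<Rightarrow> 'k dual" assume "ring_hom_on A \<phi>" "re (\<phi> a) \<noteq> 0"
    from a(3)[OF this] obtain \<phi>1 where 1: "ring_hom_on (adjoin A y) \<phi>1" "\<forall>x\<in>A. \<phi>1 x = \<phi> x" "re (\<phi>1 a') \<noteq> 0" by blast
    from a'(3)[OF 1(1,3)] obtain \<phi>2 where "ring_hom_on (foldl adjoin (adjoin A y) ys) \<phi>2" "\<forall>x\<in>adjoin A y. \<phi>2 x = \<phi>1 x" "re (\<phi>2 b) \<noteq> 0"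
      by blast
    with 1 sa(2) show "\<exists>\<phi>'. ring_hom_on (foldl adjoin A (y # ys)) \<phi>' \<and> (\<forall>x\<in>A. \<phi>' x = \<phi> x) \<and> re (\<phi>' b) \<noteq> 0"
      by (intro exI[of _ \<phi>2]) auto
  qed
qed

section \<open>Points and tangent vectors\<close>

locale fg_domain = k_algebra scale for scale :: "'k::{alg_closed_field,field_char_0} \<Rightarrow> 'r::idom \<Rightarrow> 'r" +
  assumes fg: "finitely_generated_algebra scale"
begin

definition scalars :: "'r set" where "scalars = range (\<lambda>c. scale c 1)"

lemma scale_eq: "scale c x = scale c 1 * x"
  using scale_mult_left[of c 1 x] by simp

lemma scale_one_inj: "scale c 1 = scale d 1 \<longleftrightarrow> c = d"
  using scale_cancel_right[of c 1 d] by simp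

lemma scale_one_mult: "scale c 1 * scale d 1 = scale (c * d) 1"
  by (simp add: scale_mult_left[symmetric])

lemma char_0: "n > 0 \<Longrightarrow> (of_nat n :: 'r) \<noteq> 0"
proof -
  have "(of_nat n :: 'r) = scale (of_nat n) 1"
    by (induction n) (simp_all add: scale_left_distrib)
  then show "n > 0 \<Longrightarrow> ?thesis" using scale_one_inj[of "of_nat n" 0] by simp
qed

lemma subring_scalars: "subring scalars"
  unfolding subring_def scalars_def
  by (auto simp: scale_one_mult scale_left_diff_distrib[symmetric] intro: range_eqI[of _ _ 1])

text \<open>The inverse of the embedding of the field, arbitrary on elements that are not scalars.\<close>
definition the_scalar :: "'r \<Rightarrow> 'k" where "the_scalar r = (THE c. r = scale c 1)"

lemma the_scalar: "the_scalar (scale c 1) = c"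
  unfolding the_scalar_def by (simp add: scale_one_inj)

lemma foldl_adjoin_UNIV: "\<exists>ys. \<forall>A. subring A \<longrightarrow> scalars \<subseteq> A \<longrightarrow> foldl adjoin A ys = UNIV"
proof -
  obtain G where G: "finite G" "subalgebra scale hull G = UNIV"
    using fg by (auto simp: finitely_generated_algebra_def)
  obtain ys where ys: "set ys = G" using finite_list[OF G(1)] by blast
  have "foldl adjoin A ys = UNIV" if A: "subring A" "scalars \<subseteq> A" for A
  proof -
    have *: "subring (foldl adjoin A ys)" "scalars \<subseteq> foldl adjoin A ys" "G \<subseteq> foldl adjoin A ys"
      using subring_foldl_adjoin[OF A(1), of ys] A(2) ys by auto
    have "subalgebra scale (foldl adjoin A ys)"
      unfolding subalgebra_def
    proof (intro conjI ballI)
      show "subspace (foldl adjoin A ys)"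
        unfolding subspace_def
      proof (intro conjI ballI allI)
        fix c x assume x: "x \<in> foldl adjoin A ys"
        have "scale c 1 \<in> foldl adjoin A ys" using *(2) by (auto simp: scalars_def)
        then show "scale c x \<in> foldl adjoin A ys"
          using subringD(4)[OF *(1) _ x] scale_eq[of c x] by metis
      qed (auto intro: subringD[OF *(1)])
    qed (auto intro: subringD[OF *(1)])
    then have "subalgebra scale hull G \<subseteq> foldl adjoin A ys"
      by (intro hull_minimal *(3))
    then show ?thesis using G(2) by auto
  qed
  then show ?thesis by blast
qed

lemma hom_dual_point:
  assumes \<phi>: "ring_hom_on UNIV (\<phi> :: 'r \<Rightarrow> 'k dual)" and s: "\<And>c. \<phi> (scale c 1) = Dual c 0"
  shows "(\<lambda>x. re (\<phi> x)) \<in> points scale" and "Vector_Spaces.linear scale (*) (\<lambda>x. du (\<phi> x))"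
    and "du (\<phi> (x * y)) = re (\<phi> x) * du (\<phi> y) + du (\<phi> x) * re (\<phi> y)"
proof -
  have U: "subring (UNIV :: 'r set)" by (simp add: subring_def)
  note h = hom_simps[OF U \<phi>, simplified]
  have sc: "\<phi> (scale c x) = Dual c 0 * \<phi> x" for c x
    using scale_eq[of c x] h(4)[of "scale c 1" x] by (simp add: s)
  have V: "vector_space scale" by unfold_locales
  show "(\<lambda>x. re (\<phi> x)) \<in> points scale"
    unfolding points_def algebra_hom_def using V vector_space_field
    by (auto simp: Vector_Spaces.linear_iff h sc)
  show "Vector_Spaces.linear scale (*) (\<lambda>x. du (\<phi> x))"
    using V vector_space_field by (auto simp: Vector_Spaces.linear_iff h sc)
  show "du (\<phi> (x * y)) = re (\<phi> x) * du (\<phi> y) + du (\<phi> x) * re (\<phi> y)"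
    by (simp add: h)
qed

lemma scalars_hom: "ring_hom_on scalars (\<lambda>x. Dual (the_scalar x) 0)"
proof -
  have "the_scalar 1 = 1" using the_scalar[of 1] by simp
  then show ?thesis
    unfolding ring_hom_on_def scalars_def
    by (auto simp: the_scalar scale_one_mult scale_left_distrib[symmetric] dual.expand)
qed

text \<open>Hilbert's Nullstellensatz: extend the identity of the field \<open>k\<close> to \<open>R\<close>.\<close>
lemma points_separate:
  assumes "b \<noteq> 0" shows "\<exists>p\<in>points scale. p b \<noteq> 0"
proof -
  obtain ys where ys: "foldl adjoin scalars ys = UNIV"
    using foldl_adjoin_UNIV subring_scalars by blast
  obtain a where a: "a \<in> scalars" "a \<noteq> 0" and
    ext: "\<And>\<phi> :: 'r \<Rightarrow> 'k dual. ring_hom_on scalars \<phi> \<Longrightarrow> re (\<phi> a) \<noteq> 0 \<Longrightarrow>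
     (\<exists>\<phi>'. ring_hom_on UNIV \<phi>' \<and> (\<forall>x\<in>scalars. \<phi>' x = \<phi> x) \<and> re (\<phi>' b) \<noteq> 0)"
    using extend_hom[OF subring_scalars, of b ys, unfolded ys, OF _ assms char_0, where ?'k='k] by blast
  obtain c where c: "a = scale c 1" "c \<noteq> 0" using a by (auto simp: scalars_def)
  have "re (Dual (the_scalar a) 0) \<noteq> 0" using c by (simp add: the_scalar)
  from ext[OF scalars_hom this] obtain \<phi> :: "'r \<Rightarrow> 'k dual" where \<phi>: "ring_hom_on UNIV \<phi>"
    "\<forall>x\<in>scalars. \<phi> x = Dual (the_scalar x) 0" "re (\<phi> b) \<noteq> 0" by blast
  have "\<phi> (scale c 1) = Dual c 0" for c using \<phi>(2) by (simp add: scalars_def the_scalar)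
  note pt = hom_dual_point(1)[OF \<phi>(1) this]
  show ?thesis by (rule bexI[OF _ pt]) (rule \<phi>(3))
qed

text \<open>Over an algebraically closed field the polynomial splits, and \<open>R\<close> is a domain, so \<open>r\<close> is one
  of its roots.\<close>
lemma algebraic_scalar:
  assumes "P \<in> polys_over scalars" "P \<noteq> 0" "poly P r = 0"
  shows "r \<in> scalars"
proof -
  have *: "r \<in> scalars" if "map_poly (\<lambda>c. scale c 1) Q \<noteq> 0" "poly (map_poly (\<lambda>c. scale c 1) Q) r = 0" for Q
    using that
  proof (induction "degree Q" arbitrary: Q)
    case 0
    then obtain q where "Q = [:q:]" by (metis degree_eq_zeroE)
    with 0 show ?case by (simp add: map_poly_pCons)
  next
    case (Suc n)
    then obtain c where "poly Q c = 0" using alg_closed_imp_poly_has_root[of Q] by auto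
    then obtain Q1 where Q1: "Q = [:-c, 1:] * Q1" using poly_eq_0_iff_dvd by blast
    have h: "ring_hom_on UNIV (\<lambda>c. scale c 1)"
      by (simp add: ring_hom_on_def scale_left_distrib scale_one_mult)
    have U: "subring (UNIV :: 'k set)" by (simp add: subring_def)
    have "map_poly (\<lambda>c. scale c 1) Q = map_poly (\<lambda>c. scale c 1) [:-c, 1:] * map_poly (\<lambda>c. scale c 1) Q1"
      unfolding Q1 by (rule map_hom_simps(2)[OF U h]) (simp_all add: polys_over_def)
    also have "map_poly (\<lambda>c. scale c 1) [:-c, 1:] = [:- scale c 1, 1:]"
      by (simp add: map_poly_pCons)
    finally have eq: "map_poly (\<lambda>c. scale c 1) Q = [:- scale c 1, 1:] * map_poly (\<lambda>c. scale c 1) Q1" .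
    have "Q1 \<noteq> 0" using Suc.hyps(2) Q1 by auto
    then have "degree Q = Suc (degree Q1)" unfolding Q1 by (subst degree_mult_eq) auto
    then have n: "n = degree Q1" using Suc.hyps(2) by simp
    from Suc.prems(2) have "(r - scale c 1) * poly (map_poly (\<lambda>c. scale c 1) Q1) r = 0"
      by (simp add: eq algebra_simps)
    then have "r = scale c 1 \<or> poly (map_poly (\<lambda>c. scale c 1) Q1) r = 0" by auto
    then show ?case
    proof
      assume "r = scale c 1"
      then show ?case by (simp add: scalars_def)
    next
      have "map_poly (\<lambda>c. scale c 1) Q1 \<noteq> 0" using Suc.prems(1) eq by auto
      moreover assume "poly (map_poly (\<lambda>c. scale c 1) Q1) r = 0"
      ultimately show ?case by (rule Suc.hyps(1)[OF n])
    qed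
  qed
  have "map_poly (\<lambda>c. scale c 1) (map_poly the_scalar P) = P"
  proof (rule poly_eqI)
    fix i
    have "coeff P i \<in> scalars" using assms(1) by (rule polys_overD)
    moreover have "the_scalar 0 = 0" using the_scalar[of 0] by simp
    ultimately show "coeff (map_poly (\<lambda>c. scale c 1) (map_poly the_scalar P)) i = coeff P i"
      by (auto simp: coeff_map_poly scalars_def the_scalar)
  qed
  with *[of "map_poly the_scalar P"] assms(2,3) show ?thesis by simp
qed

text \<open>As \<open>r\<close> is transcendental over \<open>k\<close>, sending \<open>r\<close> to \<open>z\<^sub>0 + \<epsilon>\<close> defines a homomorphism on \<open>k[r]\<close>.
  For suitable \<open>z\<^sub>0\<close> it extends to \<open>R\<close>, and the \<open>\<epsilon>\<close>-part of the extension is the tangent vector.\<close>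
lemma tangent_vector_exists:
  assumes r: "r \<notin> scalars"
  shows "\<exists>p\<in>points scale. \<exists>d. Vector_Spaces.linear scale (*) d \<and>
    (\<forall>x y. d (x * y) = p x * d y + d x * p y) \<and> d r \<noteq> 0"
proof -
  define A where "A = adjoin scalars r"
  have A: "subring A" "scalars \<subseteq> A" "r \<in> A" using subring_adjoin[OF subring_scalars] by (auto simp: A_def)
  obtain ys where ys: "foldl adjoin A ys = UNIV"
    using foldl_adjoin_UNIV A by blast
  obtain a where a: "a \<in> A" "a \<noteq> 0" and
    ext: "\<And>\<phi> :: 'r \<Rightarrow> 'k dual. ring_hom_on A \<phi> \<Longrightarrow> re (\<phi> a) \<noteq> 0 \<Longrightarrow>
     (\<exists>\<phi>'. ring_hom_on UNIV \<phi>' \<and> (\<forall>x\<in>A. \<phi>' x = \<phi> x) \<and> re (\<phi>' 1) \<noteq> 0)"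
    using extend_hom[OF A(1), of 1 ys, unfolded ys, OF _ one_neq_zero char_0, where ?'k='k] by blast
  obtain B where B: "B \<in> polys_over scalars" "a = poly B r" using a(1) by (auto simp: A_def adjoin_def)
  let ?\<phi> = "\<lambda>x. Dual (the_scalar x) 0"
  have "lead_coeff B \<in> scalars" "lead_coeff B \<noteq> 0" using B a by (auto simp: polys_overD)
  then obtain c where c: "lead_coeff B = scale c 1" "scale c 1 \<noteq> 0" unfolding scalars_def by force
  then have "c \<noteq> 0" by auto
  have "coeff (map_poly re (map_poly ?\<phi> B)) (degree B) = re (coeff (map_poly ?\<phi> B) (degree B))"
    by (rule coeff_map_poly) simp
  also have "\<dots> = re (?\<phi> (lead_coeff B))"
    unfolding coeff_map_hom[OF subring_scalars scalars_hom] ..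
  also have "\<dots> = c" by (simp add: c(1) the_scalar)
  finally have "coeff (map_poly re (map_poly ?\<phi> B)) (degree B) = c" .
  then obtain z0 where z0: "poly (map_poly re (map_poly ?\<phi> B)) z0 \<noteq> 0"
    using poly_nonroot \<open>c \<noteq> 0\<close> by (metis coeff_0)
  define z where "z = Dual z0 1"
  have root: "poly (map_poly ?\<phi> P) z = 0" if "P \<in> polys_over scalars" "poly P r = 0" for P
  proof -
    have "P = 0" using that r algebraic_scalar[of P r] by blast
    then show ?thesis by simp
  qed
  have "\<exists>\<phi>'. ring_hom_on (adjoin scalars r) \<phi>' \<and>
      (\<forall>P\<in>polys_over scalars. \<phi>' (poly P r) = poly (map_poly ?\<phi> P) z) \<and> (\<forall>x\<in>scalars. \<phi>' x = ?\<phi> x)"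
    by (rule extend_to_adjoin[OF subring_scalars scalars_hom root])
  then obtain \<phi>' where \<phi>': "ring_hom_on A \<phi>'"
    "\<And>P. P\<in>polys_over scalars \<Longrightarrow> \<phi>' (poly P r) = poly (map_poly ?\<phi> P) z" "\<forall>x\<in>scalars. \<phi>' x = ?\<phi> x"
    by (auto simp: A_def)
  have "re (\<phi>' a) \<noteq> 0" using z0 by (simp add: B \<phi>'(2)[OF B(1)] re_poly z_def)
  from ext[OF \<phi>'(1) this] obtain \<phi> :: "'r \<Rightarrow> 'k dual" where \<phi>: "ring_hom_on UNIV \<phi>" "\<forall>x\<in>A. \<phi> x = \<phi>' x" by blast
  have s: "\<phi> (scale c 1) = Dual c 0" for c
  proof -
    have m: "scale c 1 \<in> scalars" by (simp add: scalars_def)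
    have "\<phi> (scale c 1) = \<phi>' (scale c 1)" using \<phi>(2) A(2) m by blast
    also have "\<dots> = ?\<phi> (scale c 1)" using \<phi>'(3) m by blast
    finally show ?thesis by (simp add: the_scalar)
  qed
  have X: "monom 1 1 \<in> polys_over scalars"
    by (rule polys_over_closed(4)[OF subring_scalars subringD(1)[OF subring_scalars]])
  have "map_poly ?\<phi> (monom 1 1) = monom (?\<phi> 1) 1"
    by (rule map_poly_monom) (rule hom_simps(2)[OF subring_scalars scalars_hom])
  also have "?\<phi> 1 = 1" by (rule hom_simps(1)[OF subring_scalars scalars_hom])
  finally have "\<phi>' r = z" using \<phi>'(2)[OF X] by (simp add: poly_monom)
  then have "\<phi> r = z" using \<phi>(2) A(3) by simp
  then have "du (\<phi> r) \<noteq> 0" by (simp add: z_def)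
  then have "Vector_Spaces.linear scale (*) (\<lambda>x. du (\<phi> x)) \<and>
      (\<forall>x y. du (\<phi> (x * y)) = re (\<phi> x) * du (\<phi> y) + du (\<phi> x) * re (\<phi> y)) \<and> du (\<phi> r) \<noteq> 0"
    using hom_dual_point(2,3)[OF \<phi>(1) s] by blast
  from exI[where P = "\<lambda>d. Vector_Spaces.linear scale (*) d \<and>
      (\<forall>x y. d (x * y) = re (\<phi> x) * d y + d x * re (\<phi> y)) \<and> d r \<noteq> 0", OF this]
  show ?thesis
    by (rule bexI[OF _ hom_dual_point(1)[OF \<phi>(1) s]])
qed

end

section \<open>Eigenvalues of derivations\<close>

lemma vector_space_rat: "vector_space (\<lambda>q x. of_rat q * x :: 'k::field_char_0)"
  by unfold_locales (simp_all add: algebra_simps of_rat_add of_rat_mult)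

text \<open>The field is torsion-free as an additive group. To compare eigenvalues as in an ordered group it
  suffices to map them to the rationals by an additive map that is injective on the finitely many
  eigenvalues at hand.\<close>
lemma additive_functional_nonzero:
  fixes Z :: "'k::field_char_0 set"
  assumes "finite Z" "0 \<notin> Z"
  shows "\<exists>\<phi> :: 'k \<Rightarrow> rat. (\<forall>x y. \<phi> (x + y) = \<phi> x + \<phi> y) \<and> (\<forall>z\<in>Z. \<phi> z \<noteq> 0)"
  using assms
proof (induction Z rule: finite_induct)
  case empty
  show ?case by (intro exI[of _ "\<lambda>_. 0"]) simp
next
  case (insert z Z)
  then obtain l1 :: "'k \<Rightarrow> rat" where l1: "\<And>x y. l1 (x + y) = l1 x + l1 y" "\<And>z. z \<in> Z \<Longrightarrow> l1 z \<noteq> 0" by auto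
  have "z \<noteq> 0" using insert.prems by auto
  then obtain l2 where l2: "Vector_Spaces.linear (\<lambda>q x. of_rat q * x) (*) l2" "l2 z \<noteq> 0"
    using linear_functionals_separate[OF vector_space_rat, of z] by blast
  note l2a = linear_addD[OF l2(1)]
  (* n * l1 + l2 is the functional sought, for any n outside finitely many bad values: each of the
     points excludes at most one n. *)
  let ?bad = "\<lambda>w. {n :: nat. of_nat n * l1 w + l2 w = 0}"
  have fin: "finite (?bad w)" if "w \<in> insert z Z" for w
  proof (cases "l1 w = 0")
    case True
    then have "w = z" using l1(2) that by auto
    then show ?thesis using l2(2) True by simp
  next
    case False
    have "?bad w \<subseteq> {n. of_nat n = - l2 w / l1 w}" using False by (auto simp: field_simps eq_neg_iff_add_eq_0)
    moreover have "finite {n :: nat. of_nat n = - l2 w / l1 w}"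
      using finite_vimageI[of "{- l2 w / l1 w}" "of_nat :: nat \<Rightarrow> rat"] by (simp add: vimage_def inj_of_nat)
    ultimately show ?thesis by (rule finite_subset)
  qed
  have "finite (\<Union>w\<in>insert z Z. ?bad w)" using insert.hyps fin by blast
  then obtain n where n: "n \<notin> (\<Union>w\<in>insert z Z. ?bad w)" using ex_new_if_finite[OF infinite_UNIV_nat] by blast
  show ?case
    by (rule exI[of _ "\<lambda>x. of_nat n * l1 x + l2 x"]) (use n in \<open>auto simp: l1(1) l2a algebra_simps\<close>)
qed

lemma additive_functional_inj:
  fixes \<Lambda> :: "'k::field_char_0 set"
  assumes "finite \<Lambda>"
  shows "\<exists>\<phi> :: 'k \<Rightarrow> rat. (\<forall>x y. \<phi> (x + y) = \<phi> x + \<phi> y) \<and> inj_on \<phi> \<Lambda>"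
proof -
  let ?Z = "(\<lambda>(x, y). x - y) ` (\<Lambda> \<times> \<Lambda>) - {0}"
  obtain \<phi> :: "'k \<Rightarrow> rat" where l: "\<And>x y. \<phi> (x + y) = \<phi> x + \<phi> y" "\<forall>z\<in>?Z. \<phi> z \<noteq> 0"
    using additive_functional_nonzero[of ?Z] assms by auto
  have "inj_on \<phi> \<Lambda>"
  proof (rule inj_onI, rule ccontr)
    fix x y assume xy: "x \<in> \<Lambda>" "y \<in> \<Lambda>" "\<phi> x = \<phi> y" "x \<noteq> y"
    then have "x - y \<in> ?Z" by force
    moreover have "\<phi> (x - y) = 0" using l(1)[of "x - y" y] xy(3) by simp
    ultimately show False using l(2) by blast
  qed
  with l show ?thesis by blast
qed

locale derivation = k_algebra scale for scale :: "'k::{alg_closed_field,field_char_0} \<Rightarrow> 'r::idom \<Rightarrow> 'r" +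
  fixes D :: "'r \<Rightarrow> 'r"
  assumes D_linear: "Vector_Spaces.linear scale scale D"
    and D_mult: "D (x * y) = x * D y + D x * y"
begin

lemmas D_add = linear_addD[OF D_linear] and D_scale = linear_scaleD[OF D_linear]
  and D_zero = linear_zeroD[OF D_linear] and D_sum = linear_sumD[OF D_linear] and D_diff = linear_diffD[OF D_linear]

definition shift :: "'k \<Rightarrow> 'r \<Rightarrow> 'r" where "shift \<nu> x = D x - scale \<nu> x"

lemma shift_simps: "shift \<nu> (x + y) = shift \<nu> x + shift \<nu> y" "shift \<nu> (scale c x) = scale c (shift \<nu> x)"
   "shift \<nu> 0 = 0" "shift \<nu> (x - y) = shift \<nu> x - shift \<nu> y"
  by (simp_all add: shift_def D_add D_scale D_zero D_diff algebra_simps scale_left_commute)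

lemma shift_sum: "shift \<nu> (\<Sum>i\<in>I. f i) = (\<Sum>i\<in>I. shift \<nu> (f i))"
  by (induction I rule: infinite_finite_induct) (simp_all add: shift_simps)

lemma shiftn_simps: "(shift \<nu> ^^ n) (x + y) = (shift \<nu> ^^ n) x + (shift \<nu> ^^ n) y"
    "(shift \<nu> ^^ n) (scale c x) = scale c ((shift \<nu> ^^ n) x)" "(shift \<nu> ^^ n) 0 = 0"
    "(shift \<nu> ^^ n) (x - y) = (shift \<nu> ^^ n) x - (shift \<nu> ^^ n) y"
  by (induction n arbitrary: x y) (simp_all add: shift_simps)

lemma shiftn_sum: "(shift \<nu> ^^ n) (\<Sum>i\<in>I. f i) = (\<Sum>i\<in>I. (shift \<nu> ^^ n) (f i))"
  by (induction I rule: infinite_finite_induct) (simp_all add: shiftn_simps)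

lemma shift_commute: "shift \<nu> (shift \<mu> x) = shift \<mu> (shift \<nu> x)"
  by (simp add: shift_def D_diff D_scale algebra_simps scale_left_commute)

lemma shiftn_shift_commute: "(shift \<nu> ^^ n) (shift \<mu> x) = shift \<mu> ((shift \<nu> ^^ n) x)"
  by (induction n) (simp_all add: shift_commute)

definition gen_eigenspace :: "'k \<Rightarrow> 'r set" where "gen_eigenspace \<nu> = {x. \<exists>n. (shift \<nu> ^^ n) x = 0}"

lemma shiftn_zero_mono: "(shift \<nu> ^^ n) x = 0 \<Longrightarrow> n \<le> m \<Longrightarrow> (shift \<nu> ^^ m) x = 0"
proof -
  assume "(shift \<nu> ^^ n) x = 0" "n \<le> m"
  then show "(shift \<nu> ^^ m) x = 0"
    using funpow_add[of "m - n" n "shift \<nu>"] by (simp add: shiftn_simps)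
qed

lemma gen_eigenspace_zero: "0 \<in> gen_eigenspace \<nu>" by (auto simp: gen_eigenspace_def shiftn_simps)

lemma gen_eigenspace_scale: "x \<in> gen_eigenspace \<nu> \<Longrightarrow> scale c x \<in> gen_eigenspace \<nu>" by (auto simp: gen_eigenspace_def shiftn_simps)

lemma gen_eigenspace_add: "x \<in> gen_eigenspace \<nu> \<Longrightarrow> y \<in> gen_eigenspace \<nu> \<Longrightarrow> x + y \<in> gen_eigenspace \<nu>"
proof -
  assume "x \<in> gen_eigenspace \<nu>" "y \<in> gen_eigenspace \<nu>"
  then obtain n m where nm: "(shift \<nu> ^^ n) x = 0" "(shift \<nu> ^^ m) y = 0" by (auto simp: gen_eigenspace_def)
  have "(shift \<nu> ^^ max n m) (x + y) = 0"
    using shiftn_zero_mono[OF nm(1), of "max n m"] shiftn_zero_mono[OF nm(2), of "max n m"] by (simp add: shiftn_simps)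
  then show ?thesis by (auto simp: gen_eigenspace_def)
qed

lemma gen_eigenspace_diff: "x \<in> gen_eigenspace \<nu> \<Longrightarrow> y \<in> gen_eigenspace \<nu> \<Longrightarrow> x - y \<in> gen_eigenspace \<nu>"
  using gen_eigenspace_add[of x \<nu> "scale (-1) y"] gen_eigenspace_scale[of y \<nu> "-1"] by simp

lemma gen_eigenspace_sum: "(\<And>i. i \<in> I \<Longrightarrow> f i \<in> gen_eigenspace \<nu>) \<Longrightarrow> (\<Sum>i\<in>I. f i) \<in> gen_eigenspace \<nu>"
  by (induction I rule: infinite_finite_induct) (auto simp: gen_eigenspace_zero intro: gen_eigenspace_add)

lemma gen_eigenspace_shift: "x \<in> gen_eigenspace \<nu> \<Longrightarrow> shift \<mu> x \<in> gen_eigenspace \<nu>"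
  unfolding gen_eigenspace_def mem_Collect_eq shiftn_shift_commute by (metis shift_simps(3))

lemma gen_eigenspace_shiftn: "x \<in> gen_eigenspace \<nu> \<Longrightarrow> (shift \<mu> ^^ n) x \<in> gen_eigenspace \<nu>"
  by (induction n) (auto intro: gen_eigenspace_shift)

text \<open>On the generalized eigenspace of \<open>\<mu>\<close> the operator \<open>D - \<nu>\<close> is a nonzero scalar plus a nilpotent
  operator.\<close>
lemma gen_eigenspace_shift_surj:
  assumes "c \<in> gen_eigenspace \<mu>" "\<nu> \<noteq> \<mu>"
  shows "\<exists>w\<in>gen_eigenspace \<mu>. shift \<nu> w = c"
proof -
  have "\<exists>w\<in>gen_eigenspace \<mu>. shift \<nu> w = c" if "(shift \<mu> ^^ n) c = 0" for n c
    using that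
  proof (induction n arbitrary: c)
    case 0
    then show ?case by (auto intro!: bexI[of _ 0] simp: gen_eigenspace_zero shift_simps)
  next
    case (Suc n)
    from Suc.prems have "(shift \<mu> ^^ n) (shift \<mu> c) = 0" by (simp add: funpow_swap1)
    from Suc.IH[OF this] obtain w where w: "w \<in> gen_eigenspace \<mu>" "shift \<nu> w = shift \<mu> c" by blast
    have c: "c \<in> gen_eigenspace \<mu>" using Suc.prems by (auto simp: gen_eigenspace_def simp del: funpow.simps)
    (* (D - nu) c = (D - mu) c + (mu - nu) c, and w is a preimage of the first summand. *)
    have "shift \<nu> (c - w) = scale (\<mu> - \<nu>) c"
      unfolding shift_simps(4) w(2) by (simp add: shift_def algebra_simps)
    then have "shift \<nu> (scale (1 / (\<mu> - \<nu>)) (c - w)) = c"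
      using assms(2) by (simp add: shift_simps)
    then show ?case using gen_eigenspace_scale[OF gen_eigenspace_diff[OF c w(1)]] by blast
  qed
  then show ?thesis using assms(1) by (auto simp: gen_eigenspace_def)
qed

lemma gen_eigenspace_shift_inj:
  assumes "c \<in> gen_eigenspace \<mu>" "\<nu> \<noteq> \<mu>" "shift \<nu> c = 0"
  shows "c = 0"
proof -
  obtain n where n: "(shift \<mu> ^^ n) c = 0" using assms(1) by (auto simp: gen_eigenspace_def)
  have "shift \<mu> c = scale (\<nu> - \<mu>) c" using assms(3) by (simp add: shift_def algebra_simps)
  then have "(shift \<mu> ^^ n) c = scale ((\<nu> - \<mu>) ^ n) c"
    by (induction n) (simp_all add: shift_simps)
  with n assms(2) show ?thesis by simp
qed

lemma gen_eigenspace_shiftn_inj: "c \<in> gen_eigenspace \<mu> \<Longrightarrow> (shift \<nu> ^^ n) c = 0 \<Longrightarrow> \<nu> \<noteq> \<mu> \<Longrightarrow> c = 0"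
proof (induction n)
  case (Suc n)
  have "(shift \<nu> ^^ n) c = 0"
    by (rule gen_eigenspace_shift_inj[OF gen_eigenspace_shiftn[OF Suc.prems(1)] Suc.prems(3)]) (use Suc.prems in simp)
  with Suc show ?case by simp
qed simp

lemma gen_eigenspace_independent:
  assumes "finite \<Lambda>" "\<And>\<nu>. \<nu> \<in> \<Lambda> \<Longrightarrow> c \<nu> \<in> gen_eigenspace \<nu>" "(\<Sum>\<nu>\<in>\<Lambda>. c \<nu>) = 0" "\<nu> \<in> \<Lambda>"
  shows "c \<nu> = 0"
  using assms
proof (induction \<Lambda> arbitrary: c \<nu> rule: finite_induct)
  case (insert \<nu>0 \<Lambda>)
  obtain n where n: "(shift \<nu>0 ^^ n) (c \<nu>0) = 0" using insert.prems(1)[of \<nu>0] by (auto simp: gen_eigenspace_def)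
  have "(shift \<nu>0 ^^ n) (\<Sum>\<nu>\<in>insert \<nu>0 \<Lambda>. c \<nu>) = 0" by (simp only: insert.prems shiftn_simps)
  then have s: "(\<Sum>\<nu>\<in>\<Lambda>. (shift \<nu>0 ^^ n) (c \<nu>)) = 0"
    using insert.hyps n by (simp add: shiftn_sum shiftn_simps)
  have z: "c \<mu> = 0" if \<mu>: "\<mu> \<in> \<Lambda>" for \<mu>
  proof -
    have "(shift \<nu>0 ^^ n) (c \<mu>) = 0"
      by (rule insert.IH[OF _ s \<mu>]) (auto intro: gen_eigenspace_shiftn insert.prems)
    moreover have "\<nu>0 \<noteq> \<mu>" using insert.hyps \<mu> by auto
    moreover have "c \<mu> \<in> gen_eigenspace \<mu>" using insert.prems(1) \<mu> by auto
    ultimately show ?thesis using gen_eigenspace_shiftn_inj by blast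
  qed
  then have "c \<nu>0 = 0" using insert.prems(2) insert.hyps by simp
  with z insert.prems(3) show ?case by auto
qed simp

lemma shift_mult: "shift (\<nu> + \<mu>) (a * b) = a * shift \<mu> b + shift \<nu> a * b"
  by (simp add: shift_def D_mult algebra_simps scale_mult_left[symmetric] scale_mult_right[symmetric])

lemma shiftn_mult_zero:
  assumes "(shift \<nu> ^^ m) a = 0" "(shift \<mu> ^^ n) b = 0" "m + n \<le> N"
  shows "(shift (\<nu> + \<mu>) ^^ N) (a * b) = 0"
  using assms
proof (induction N arbitrary: m n a b)
  case (Suc N)
  show ?case
  proof (cases "m = 0 \<or> n = 0")
    case True
    then show ?thesis using Suc.prems shiftn_simps(3)[of "Suc N" "\<nu> + \<mu>"] by auto
  next
    case False
    then obtain m' n' where mn: "m = Suc m'" "n = Suc n'" by (auto simp: gr0_conv_Suc)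
    have "(shift (\<nu> + \<mu>) ^^ N) (a * shift \<mu> b) = 0"
      by (rule Suc.IH[of m _ n']) (use Suc.prems mn in \<open>auto simp: funpow_swap1\<close>)
    moreover have "(shift (\<nu> + \<mu>) ^^ N) (shift \<nu> a * b) = 0"
      by (rule Suc.IH[of m' _ n]) (use Suc.prems mn in \<open>auto simp: funpow_swap1\<close>)
    ultimately show ?thesis
      by (simp add: funpow_Suc_right shift_mult shiftn_simps del: funpow.simps)
  qed
qed simp

text \<open>The generalized eigenspaces form a grading of the algebra by the additive group of the
  field.\<close>
lemma gen_eigenspace_mult: "a \<in> gen_eigenspace \<nu> \<Longrightarrow> b \<in> gen_eigenspace \<mu> \<Longrightarrow> a * b \<in> gen_eigenspace (\<nu> + \<mu>)"
proof -
  assume "a \<in> gen_eigenspace \<nu>" "b \<in> gen_eigenspace \<mu>"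
  then obtain m n where "(shift \<nu> ^^ m) a = 0" "(shift \<mu> ^^ n) b = 0" by (auto simp: gen_eigenspace_def)
  from shiftn_mult_zero[OF this order_refl] show ?thesis unfolding gen_eigenspace_def mem_Collect_eq by (rule exI)
qed

text \<open>The top term in the Leibniz formula. It shows that in a domain of characteristic zero the
  nilpotency orders of two generalized eigenvectors add up in their product.\<close>
lemma shiftn_mult_top:
  assumes "(shift \<nu> ^^ Suc m) a = 0" "(shift \<mu> ^^ Suc n) b = 0"
  shows "(shift (\<nu> + \<mu>) ^^ (m + n)) (a * b) = of_nat ((m + n) choose m) * ((shift \<nu> ^^ m) a * (shift \<mu> ^^ n) b)"
  using assms
proof (induction "m + n" arbitrary: m n a b)
  case 0
  then show ?case by simp
next
  case (Suc N)
  let ?E = "shift (\<nu> + \<mu>)"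
  note hyp = Suc.hyps(1) and N = Suc.hyps(2) and pr = Suc.prems
  have 1: "(?E ^^ N) (a * shift \<mu> b) = of_nat (N choose m) * ((shift \<nu> ^^ m) a * (shift \<mu> ^^ n) b)"
  proof (cases n)
    case 0
    then have "shift \<mu> b = 0" "N < m" using pr N by auto
    then show ?thesis by (simp add: shiftn_simps binomial_eq_0)
  next
    case (Suc n')
    have N': "N = m + n'" using Suc N by simp
    have "(shift \<mu> ^^ Suc n') (shift \<mu> b) = 0" using pr(2) Suc by (simp add: funpow_swap1)
    from hyp[OF N' pr(1) this] show ?thesis using Suc N' by (simp add: funpow_swap1)
  qed
  have 2: "(?E ^^ N) (shift \<nu> a * b) = of_nat (if m = 0 then 0 else N choose (m - 1)) * ((shift \<nu> ^^ m) a * (shift \<mu> ^^ n) b)"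
  proof (cases m)
    case 0
    then have "shift \<nu> a = 0" using pr by auto
    then show ?thesis using 0 by (simp add: shiftn_simps)
  next
    case (Suc m')
    have N': "N = m' + n" using Suc N by simp
    have "(shift \<nu> ^^ Suc m') (shift \<nu> a) = 0" using pr(1) Suc by (simp add: funpow_swap1)
    from hyp[OF N' this pr(2)] show ?thesis using Suc N' by (simp add: funpow_swap1)
  qed
  have c: "Suc N choose m = (N choose m) + (if m = 0 then 0 else N choose (m - 1))"
    by (cases m) simp_all
  have "(?E ^^ Suc N) (a * b) = (?E ^^ N) (a * shift \<mu> b) + (?E ^^ N) (shift \<nu> a * b)"
    by (simp add: funpow_Suc_right shift_mult shiftn_simps del: funpow.simps)
  then show ?case
    unfolding N[symmetric] c of_nat_add by (simp only: 1 2 distrib_right)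
qed

end

lemma finite_has_max:
  fixes \<phi> :: "'a \<Rightarrow> 'b::linorder"
  assumes "finite A" "A \<noteq> {}" shows "\<exists>x\<in>A. \<forall>y\<in>A. \<phi> y \<le> \<phi> x"
proof -
  have "Max (\<phi> ` A) \<in> \<phi> ` A" using assms by (intro Max_in) auto
  then obtain x where "x \<in> A" "\<phi> x = Max (\<phi> ` A)" by force
  then show ?thesis using assms by (intro bexI[of _ x]) auto
qed

context derivation
begin

definition polyD :: "'k poly \<Rightarrow> 'r \<Rightarrow> 'r" where
  "polyD P x = (\<Sum>i\<le>degree P. scale (coeff P i) ((D ^^ i) x))"

lemma polyD_bound: "degree P \<le> n \<Longrightarrow> polyD P x = (\<Sum>i\<le>n. scale (coeff P i) ((D ^^ i) x))"
  unfolding polyD_def by (rule sum.mono_neutral_left) (auto simp: coeff_eq_0)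

lemma polyD_pCons: "polyD (pCons a P) x = scale a x + polyD P (D x)"
proof -
  have "polyD (pCons a P) x = (\<Sum>i\<le>Suc (degree P). scale (coeff (pCons a P) i) ((D ^^ i) x))"
    by (rule polyD_bound) (rule degree_pCons_le)
  also have "\<dots> = scale a x + (\<Sum>i\<le>degree P. scale (coeff P i) ((D ^^ i) (D x)))"
    by (subst sum.atMost_Suc_shift) (simp add: funpow_swap1)
  finally show ?thesis by (simp add: polyD_def)
qed

lemma polyD_zero [simp]: "polyD 0 x = 0"
  by (simp add: polyD_def)

lemma polyD_simps: "polyD P (x + y) = polyD P x + polyD P y" "polyD P (scale c x) = scale c (polyD P x)"
  by (induction P arbitrary: x y) (simp_all add: polyD_pCons D_add D_scale scale_right_distrib scale_left_commute)

lemma polyD_diff: "polyD P (x - y) = polyD P x - polyD P y"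
  using polyD_simps(1)[of P x "scale (-1) y"] polyD_simps(2)[of P "-1" y] by simp

lemma polyD_linear_factor: "polyD ([:-\<nu>, 1:] * Q) x = polyD Q (shift \<nu> x)"
proof -
  have *: "polyD (P + R) x = polyD P x + polyD R x" for P R x
    by (subst (1 2 3) polyD_bound[of _ "max (degree P) (degree R)"])
      (auto intro: degree_add_le simp: sum.distrib scale_left_distrib)
  have **: "polyD (smult c P) x = scale c (polyD P x)" for c P x
    by (subst (1 2) polyD_bound[of _ "degree P"]) (auto intro: degree_smult_le simp: scale_sum_right)
  have e: "[:-\<nu>, 1:] * Q = pCons 0 Q + smult (-\<nu>) Q" by simp
  show ?thesis
    unfolding e * ** polyD_pCons by (simp add: shift_def polyD_diff polyD_simps)
qed

lemma D_one: "D 1 = 0"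
proof -
  have "D 1 + 0 = D 1 + D 1" using D_mult[of 1 1] by (simp only: mult_1_left mult_1_right add_0_right)
  then show ?thesis by (simp only: add_left_cancel)
qed

text \<open>Induction on the degree of \<open>P\<close>: split off a root \<open>\<nu>\<close>, decompose \<open>(D - \<nu>) x\<close>, and lift each
  component through \<open>D - \<nu>\<close>, which is possible away from the eigenvalue \<open>\<nu>\<close>. What is left of \<open>x\<close> is a
  generalized eigenvector for \<open>\<nu>\<close>.\<close>
lemma generalized_eigen_decomposition:
  assumes "P \<noteq> 0" "polyD P x = 0"
  shows "\<exists>\<Lambda> c. finite \<Lambda> \<and> (\<forall>\<nu>\<in>\<Lambda>. c \<nu> \<in> gen_eigenspace \<nu> \<and> c \<nu> \<noteq> 0) \<and> x = (\<Sum>\<nu>\<in>\<Lambda>. c \<nu>)"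
proof -
  have "\<exists>\<Lambda> c. finite \<Lambda> \<and> (\<forall>\<nu>\<in>\<Lambda>. c \<nu> \<in> gen_eigenspace \<nu>) \<and> x = (\<Sum>\<nu>\<in>\<Lambda>. c \<nu>)"
    using assms
  proof (induction "degree P" arbitrary: P x)
    case 0
    then obtain a where "P = [:a:]" by (metis degree_eq_zeroE)
    with 0 have "x = 0" by (simp add: polyD_def)
    then show ?case by (intro exI[of _ "{}"]) auto
  next
    case (Suc n)
    then obtain \<nu> where "poly P \<nu> = 0" using alg_closed_imp_poly_has_root[of P] by auto
    then obtain Q where Q: "P = [:-\<nu>, 1:] * Q" using poly_eq_0_iff_dvd by blast
    have Q0: "Q \<noteq> 0" using Suc.prems Q by auto
    then have "degree P = Suc (degree Q)" unfolding Q by (subst degree_mult_eq) auto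
    then have n: "n = degree Q" using Suc.hyps(2) by simp
    have "polyD Q (shift \<nu> x) = 0" using Suc.prems(2) unfolding Q polyD_linear_factor .
    from Suc.hyps(1)[OF n Q0 this] obtain \<Lambda> c where c: "finite \<Lambda>" "\<forall>\<mu>\<in>\<Lambda>. c \<mu> \<in> gen_eigenspace \<mu>" "shift \<nu> x = (\<Sum>\<mu>\<in>\<Lambda>. c \<mu>)"
      by blast
    have "\<forall>\<mu>\<in>\<Lambda> - {\<nu>}. \<exists>w. w \<in> gen_eigenspace \<mu> \<and> shift \<nu> w = c \<mu>"
    proof
      fix \<mu> assume "\<mu> \<in> \<Lambda> - {\<nu>}"
      then show "\<exists>w. w \<in> gen_eigenspace \<mu> \<and> shift \<nu> w = c \<mu>" using gen_eigenspace_shift_surj[of "c \<mu>" \<mu> \<nu>] c(2) by auto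
    qed
    from bchoice[OF this] obtain w where w: "\<forall>\<mu>\<in>\<Lambda> - {\<nu>}. w \<mu> \<in> gen_eigenspace \<mu> \<and> shift \<nu> (w \<mu>) = c \<mu>" ..
    define w0 where "w0 = x - (\<Sum>\<mu>\<in>\<Lambda> - {\<nu>}. w \<mu>)"
    have s: "shift \<nu> w0 = (\<Sum>\<mu>\<in>\<Lambda>. c \<mu>) - (\<Sum>\<mu>\<in>\<Lambda> - {\<nu>}. c \<mu>)"
      using w by (simp add: w0_def shift_simps c(3) shift_sum)
    have "shift \<nu> w0 \<in> gen_eigenspace \<nu>"
    proof (cases "\<nu> \<in> \<Lambda>")
      case True
      then have "shift \<nu> w0 = c \<nu>" unfolding s using sum.remove[OF c(1) True, of c] by simp
      then show ?thesis using c(2) True by simp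
    next
      case False
      then show ?thesis unfolding s by (simp add: gen_eigenspace_zero)
    qed
    then obtain m where "(shift \<nu> ^^ m) (shift \<nu> w0) = 0" by (auto simp: gen_eigenspace_def)
    then have "(shift \<nu> ^^ Suc m) w0 = 0" by (simp add: funpow_swap1)
    then have w0: "w0 \<in> gen_eigenspace \<nu>" unfolding gen_eigenspace_def mem_Collect_eq by (rule exI)
    have "x = w0 + (\<Sum>\<mu>\<in>\<Lambda> - {\<nu>}. w \<mu>)" by (simp add: w0_def)
    also have "\<dots> = (\<Sum>\<mu>\<in>insert \<nu> (\<Lambda> - {\<nu>}). if \<mu> = \<nu> then w0 else w \<mu>)"
      using c(1) by (subst sum.insert) (auto intro!: sum.cong)
    finally show ?case
      using c(1) w w0 by (intro exI[of _ "insert \<nu> (\<Lambda> - {\<nu>})"] exI[of _ "\<lambda>\<mu>. if \<mu> = \<nu> then w0 else w \<mu>"]) auto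
  qed
  then obtain \<Lambda> c where c: "finite \<Lambda>" "\<forall>\<nu>\<in>\<Lambda>. c \<nu> \<in> gen_eigenspace \<nu>" "x = (\<Sum>\<nu>\<in>\<Lambda>. c \<nu>)" by blast
  moreover have "(\<Sum>\<nu>\<in>\<Lambda>. c \<nu>) = (\<Sum>\<nu>\<in>{\<nu>\<in>\<Lambda>. c \<nu> \<noteq> 0}. c \<nu>)"
    using c(1) by (intro sum.mono_neutral_right) auto
  ultimately show ?thesis by (intro exI[of _ "{\<nu>\<in>\<Lambda>. c \<nu> \<noteq> 0}"] exI[of _ c]) auto
qed

text \<open>Units of a domain graded by a torsion-free group are homogeneous. The products of the two
  highest and of the two lowest components cannot cancel, and both have to lie in the degree 0 of
  their product 1, so highest and lowest components coincide.\<close>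
lemma unit_single_eigenvalue:
  assumes \<Lambda>: "finite \<Lambda>" "\<forall>\<nu>\<in>\<Lambda>. c \<nu> \<in> gen_eigenspace \<nu> \<and> c \<nu> \<noteq> 0"
    and M: "finite M" "\<forall>\<mu>\<in>M. d \<mu> \<in> gen_eigenspace \<mu> \<and> d \<mu> \<noteq> 0"
    and 1: "(\<Sum>\<nu>\<in>\<Lambda>. c \<nu>) * (\<Sum>\<mu>\<in>M. d \<mu>) = 1"
  shows "\<exists>\<nu>. \<Lambda> = {\<nu>} \<and> M = {-\<nu>}"
proof -
  have ne: "\<Lambda> \<noteq> {}" "M \<noteq> {}" using 1 by auto
  obtain \<phi> :: "'k \<Rightarrow> rat" where \<phi>: "\<And>x y. \<phi> (x + y) = \<phi> x + \<phi> y" "inj_on \<phi> (\<Lambda> \<union> M)"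
    using additive_functional_inj[of "\<Lambda> \<union> M"] \<Lambda> M by auto
  have unique: "\<nu> + \<mu> = 0" if \<nu>: "\<nu> \<in> \<Lambda>" and \<mu>: "\<mu> \<in> M"
    and u: "\<And>\<nu>' \<mu>'. \<nu>' \<in> \<Lambda> \<Longrightarrow> \<mu>' \<in> M \<Longrightarrow> \<nu>' + \<mu>' = \<nu> + \<mu> \<Longrightarrow> \<nu>' = \<nu> \<and> \<mu>' = \<mu>" for \<nu> \<mu>
  proof (rule ccontr)
    assume nz0: "\<nu> + \<mu> \<noteq> 0"
    let ?sum = "\<lambda>(\<nu>, \<mu>). \<nu> + \<mu>"
    define T where "T = insert 0 (?sum ` (\<Lambda> \<times> M))"
    (* The components of f * g - 1, where 1 has eigenvalue 0. *)
    define e where "e k = (\<Sum>(\<nu>, \<mu>)\<in>{p \<in> \<Lambda> \<times> M. ?sum p = k}. c \<nu> * d \<mu>) - (if k = 0 then 1 else 0)" for k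
    have fT: "finite T" using \<Lambda> M by (simp add: T_def)
    have "shift 0 1 = 0" by (simp add: shift_def D_one)
    then have one: "(1 :: 'r) \<in> gen_eigenspace 0" unfolding gen_eigenspace_def by (intro CollectI exI[of _ 1]) simp
    have e_gen: "e k \<in> gen_eigenspace k" for k
    proof -
      have "(\<Sum>(\<nu>, \<mu>)\<in>{p \<in> \<Lambda> \<times> M. ?sum p = k}. c \<nu> * d \<mu>) \<in> gen_eigenspace k"
      proof (rule gen_eigenspace_sum)
        fix p assume "p \<in> {p \<in> \<Lambda> \<times> M. ?sum p = k}"
        then obtain \<nu> \<mu> where "p = (\<nu>, \<mu>)" "\<nu> \<in> \<Lambda>" "\<mu> \<in> M" "k = \<nu> + \<mu>" by auto
        then show "(case p of (\<nu>, \<mu>) \<Rightarrow> c \<nu> * d \<mu>) \<in> gen_eigenspace k"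
          using gen_eigenspace_mult[of "c \<nu>" \<nu> "d \<mu>" \<mu>] \<Lambda>(2) M(2) by simp
      qed
      moreover have "(if k = 0 then 1 else 0) \<in> gen_eigenspace k" using one gen_eigenspace_zero by simp
      ultimately show ?thesis unfolding e_def by (rule gen_eigenspace_diff)
    qed
    have e_sum: "(\<Sum>k\<in>T. e k) = 0"
    proof -
      have "(\<Sum>k\<in>T. \<Sum>(\<nu>, \<mu>)\<in>{p \<in> \<Lambda> \<times> M. ?sum p = k}. c \<nu> * d \<mu>) = (\<Sum>(\<nu>, \<mu>)\<in>\<Lambda> \<times> M. c \<nu> * d \<mu>)"
        by (rule sum.group) (use \<Lambda> M fT in \<open>auto simp: T_def\<close>)
      also have "\<dots> = 1" using 1 by (simp add: sum_product sum.cartesian_product)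
      finally show ?thesis using fT by (simp add: e_def sum_subtractf) (simp add: T_def)
    qed
    have "?sum (\<nu>, \<mu>) \<in> T" unfolding T_def using \<nu> \<mu> by (intro insertI2 imageI SigmaI)
    then have "\<nu> + \<mu> \<in> T" by simp
    from gen_eigenspace_independent[OF fT e_gen e_sum this] have "e (\<nu> + \<mu>) = 0" .
    moreover have "{p \<in> \<Lambda> \<times> M. ?sum p = \<nu> + \<mu>} = {(\<nu>, \<mu>)}" using \<nu> \<mu> u by auto
    ultimately have "c \<nu> * d \<mu> = 0" using nz0 by (simp add: e_def)
    then show False using \<nu> \<mu> \<Lambda> M by auto
  qed
  obtain n1 where n1: "n1 \<in> \<Lambda>" "\<forall>x\<in>\<Lambda>. \<phi> x \<le> \<phi> n1"
    using finite_has_max[OF \<Lambda>(1) ne(1), of \<phi>] by blast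
  obtain m1 where m1: "m1 \<in> M" "\<forall>x\<in>M. \<phi> x \<le> \<phi> m1"
    using finite_has_max[OF M(1) ne(2), of \<phi>] by blast
  obtain n2 where n2: "n2 \<in> \<Lambda>" "\<forall>x\<in>\<Lambda>. \<phi> n2 \<le> \<phi> x"
    using finite_has_max[OF \<Lambda>(1) ne(1), of "\<lambda>x. - \<phi> x"] by auto
  obtain m2 where m2: "m2 \<in> M" "\<forall>x\<in>M. \<phi> m2 \<le> \<phi> x"
    using finite_has_max[OF M(1) ne(2), of "\<lambda>x. - \<phi> x"] by auto
  (* The sum of the two largest eigenvalues, and that of the two smallest, arises in one way only. *)
  have s1: "n1 + m1 = 0"
  proof (rule unique[OF n1(1) m1(1)])
    fix \<nu>' \<mu>' assume a: "\<nu>' \<in> \<Lambda>" "\<mu>' \<in> M" "\<nu>' + \<mu>' = n1 + m1"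
    then have "\<phi> \<nu>' + \<phi> \<mu>' = \<phi> n1 + \<phi> m1" by (simp flip: \<phi>(1))
    moreover have "\<phi> \<nu>' \<le> \<phi> n1" "\<phi> \<mu>' \<le> \<phi> m1" using a n1 m1 by auto
    ultimately have "\<phi> \<nu>' = \<phi> n1" "\<phi> \<mu>' = \<phi> m1" by linarith+
    then show "\<nu>' = n1 \<and> \<mu>' = m1"
      using inj_onD[OF \<phi>(2), of \<nu>' n1] inj_onD[OF \<phi>(2), of \<mu>' m1] a n1 m1 by simp
  qed
  have s2: "n2 + m2 = 0"
  proof (rule unique[OF n2(1) m2(1)])
    fix \<nu>' \<mu>' assume a: "\<nu>' \<in> \<Lambda>" "\<mu>' \<in> M" "\<nu>' + \<mu>' = n2 + m2"
    then have "\<phi> \<nu>' + \<phi> \<mu>' = \<phi> n2 + \<phi> m2" by (simp flip: \<phi>(1))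
    moreover have "\<phi> n2 \<le> \<phi> \<nu>'" "\<phi> m2 \<le> \<phi> \<mu>'" using a n2 m2 by auto
    ultimately have "\<phi> \<nu>' = \<phi> n2" "\<phi> \<mu>' = \<phi> m2" by linarith+
    then show "\<nu>' = n2 \<and> \<mu>' = m2"
      using inj_onD[OF \<phi>(2), of \<nu>' n2] inj_onD[OF \<phi>(2), of \<mu>' m2] a n2 m2 by simp
  qed
  have "\<phi> n1 + \<phi> m1 = \<phi> n2 + \<phi> m2" using s1 s2 by (simp flip: \<phi>(1))
  moreover have "\<phi> n2 \<le> \<phi> n1" "\<phi> m2 \<le> \<phi> m1" using n1 n2 m1 by (auto simp: m2)
  ultimately have eq: "\<phi> n1 = \<phi> n2" "\<phi> m1 = \<phi> m2" by linarith+
  have "\<Lambda> = {n1}"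
  proof -
    have "x = n1" if "x \<in> \<Lambda>" for x
    proof (rule inj_onD[OF \<phi>(2)])
      show "\<phi> x = \<phi> n1" using n1(2) n2(2) that eq(1) by (intro antisym) auto
    qed (use that n1 in auto)
    then show ?thesis using n1 by blast
  qed
  moreover have "M = {m1}"
  proof -
    have "x = m1" if "x \<in> M" for x
    proof (rule inj_onD[OF \<phi>(2)])
      show "\<phi> x = \<phi> m1" using m1(2) m2(2) that eq(2) by (intro antisym) auto
    qed (use that m1 in auto)
    then show ?thesis using m1 by blast
  qed
  moreover have "m1 = - n1" using s1 by (simp add: add_eq_0_iff)
  ultimately show ?thesis by blast
qed

lemma gen_eigenspace_order:
  assumes "x \<in> gen_eigenspace \<nu>" "x \<noteq> 0"
  shows "\<exists>m. (shift \<nu> ^^ Suc m) x = 0 \<and> (shift \<nu> ^^ m) x \<noteq> 0"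
proof -
  obtain n where n: "(shift \<nu> ^^ n) x = 0" using assms by (auto simp: gen_eigenspace_def)
  define N where "N = (LEAST n. (shift \<nu> ^^ n) x = 0)"
  have N: "(shift \<nu> ^^ N) x = 0" unfolding N_def by (rule LeastI[of _ n]) (rule n)
  then obtain m where m: "N = Suc m" using assms(2) by (cases N) auto
  have "(shift \<nu> ^^ m) x \<noteq> 0" using not_less_Least[of m "\<lambda>n. (shift \<nu> ^^ n) x = 0"] m unfolding N_def by auto
  with N m show ?thesis by blast
qed

text \<open>By the grading both \<open>f\<close> and \<open>g\<close> are generalized eigenvectors, for opposite eigenvalues. Their
  nilpotency orders add up to that of \<open>f g = 1\<close>, which \<open>D\<close> kills, so both are true eigenvectors.\<close>
theorem unit_eigenvector:
  assumes fg: "f * g = 1" and P: "P \<noteq> 0" "polyD P f = 0" and Q: "Q \<noteq> 0" "polyD Q g = 0"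
    and char: "\<And>n. n > 0 \<Longrightarrow> (of_nat n :: 'r) \<noteq> 0"
  shows "\<exists>\<nu>. D f = scale \<nu> f"
proof -
  obtain \<Lambda> c where c: "finite \<Lambda>" "\<forall>\<nu>\<in>\<Lambda>. c \<nu> \<in> gen_eigenspace \<nu> \<and> c \<nu> \<noteq> 0" "f = (\<Sum>\<nu>\<in>\<Lambda>. c \<nu>)"
    using generalized_eigen_decomposition[OF P] by blast
  obtain M d where d: "finite M" "\<forall>\<nu>\<in>M. d \<nu> \<in> gen_eigenspace \<nu> \<and> d \<nu> \<noteq> 0" "g = (\<Sum>\<nu>\<in>M. d \<nu>)"
    using generalized_eigen_decomposition[OF Q] by blast
  obtain \<nu> where \<nu>: "\<Lambda> = {\<nu>}" "M = {-\<nu>}"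
    using unit_single_eigenvalue[OF c(1,2) d(1,2)] fg c(3) d(3) by blast
  then have f: "f \<in> gen_eigenspace \<nu>" "f \<noteq> 0" and g: "g \<in> gen_eigenspace (-\<nu>)" "g \<noteq> 0" using c d by auto
  obtain m where m: "(shift \<nu> ^^ Suc m) f = 0" "(shift \<nu> ^^ m) f \<noteq> 0" using gen_eigenspace_order[OF f] by blast
  obtain n where n: "(shift (-\<nu>) ^^ Suc n) g = 0" "(shift (-\<nu>) ^^ n) g \<noteq> 0" using gen_eigenspace_order[OF g] by blast
  have "(shift 0 ^^ (m + n)) 1 = of_nat ((m + n) choose m) * ((shift \<nu> ^^ m) f * (shift (-\<nu>) ^^ n) g)"
    using shiftn_mult_top[OF m(1) n(1)] fg by simp
  also have "\<dots> \<noteq> 0" using m n char[of "(m + n) choose m"] by simp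
  finally have nz0: "(shift 0 ^^ (m + n)) 1 \<noteq> 0" .
  have "shift 0 1 = 0" by (simp add: shift_def D_one)
  then have "m + n = 0" using nz0 shiftn_zero_mono[of 1 0 1 "m + n"] by (cases "m + n") auto
  then have "shift \<nu> f = 0" using m(1) by simp
  then show ?thesis by (auto simp: shift_def)
qed

end

section \<open>Units of commutative Hopf algebras\<close>

locale affine_hopf = hopf_algebra scale \<Delta> \<epsilon> S + fg_domain scale
  for scale :: "'k::{alg_closed_field,field_char_0} \<Rightarrow> 'r::idom \<Rightarrow> 'r" and \<Delta> \<epsilon> S
begin

lemma point_eqI:
  assumes "\<And>p. p \<in> points scale \<Longrightarrow> p a = p b" shows "a = b"
  using points_separate[of "a - b"] assms by (auto simp: pointsD)

lemma tensor_eqI: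
  assumes u: "u \<in> TS" and v: "v \<in> TS"
    and eq: "\<And>p q. p \<in> points scale \<Longrightarrow> q \<in> points scale \<Longrightarrow> tensor_fun p q u = tensor_fun p q v"
  shows "u = v"
proof -
  have "u - v = 0"
  proof (rule tensor_separation[where \<Phi> = "points scale" and \<Psi> = "points scale"])
    show "u - v \<in> TS" using u v by (rule TS_diff)
    show "tensor_fun f g (u - v) = 0" if "f \<in> points scale" "g \<in> points scale" for f g
      using eq[OF that] linear_diffD[OF tensor_fun_linear[OF pointsD(1)[OF that(1)] pointsD(1)[OF that(2)]]] by simp
  qed (use points_separate in \<open>auto simp: pointsD\<close>)
  then show ?thesis by simp
qed

definition tangent :: "('r \<Rightarrow> 'k) \<Rightarrow> bool" where
  "tangent d \<longleftrightarrow> lin d \<and> (\<forall>x y. d (x * y) = \<epsilon> x * d y + d x * \<epsilon> y)"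

text \<open>A tangent vector at the identity satisfies the Leibniz rule with coefficients evaluated by \<open>\<epsilon>\<close>,
  and \<open>(id \<otimes> \<epsilon>) \<circ> \<Delta>\<close> is the identity.\<close>
lemma rtrans_derivation:
  assumes d: "tangent d" shows "derivation scale (rtrans d)"
proof -
  have ld: "lin d" and dm: "\<And>x y. d (x * y) = \<epsilon> x * d y + d x * \<epsilon> y" using d by (auto simp: tangent_def)
  note e = pointsD[OF \<epsilon>_point]
  let ?R = "\<lambda>g. tensor_lift scale scale scale (\<lambda>a b. scale (g b) a)"
  note sr = slice_r[OF ld] and se = slice_r[OF e(1)]
  have "?R d (tm u v) = ?R \<epsilon> u * ?R d v + ?R d u * ?R \<epsilon> v" if "u \<in> TS" "v \<in> TS" for u v
    using that
  proof (induction u rule: TS_induct)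
    case (pure a b)
    from pure show ?case
    proof (induction v rule: TS_induct)
      case (pure a' b')
      show ?case
        by (simp add: tm_pt lift_pt[OF sr] lift_pt[OF se] dm e scale_left_distrib
            scale_mult_left[symmetric] scale_mult_right[symmetric]) (simp only: mult.commute)
    next
      case (add v v')
      then show ?case by (simp add: tm_add_right lift_add[OF sr] lift_add[OF se] algebra_simps)
    qed
  next
    case (add u u')
    then show ?case by (simp add: tm_add_left lift_add[OF sr] lift_add[OF se] algebra_simps)
  qed
  from this[OF comult_in comult_in] have "rtrans d (x * y) = x * rtrans d y + rtrans d x * y" for x y
    unfolding comult_mult[symmetric] counit_right unfolding rtrans_def .
  then show ?thesis
    by (intro derivation.intro derivation_axioms.intro rtrans_linear[OF ld]) unfold_locales
qed

lemma rtrans_finite_span: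
  "\<exists>E. finite E \<and> (\<forall>g. lin g \<longrightarrow> rtrans g x \<in> span E)"
proof -
  obtain E b where E: "finite E" "\<Delta> x = (\<Sum>e\<in>E. pt e (b e))"
    using tensor_independent_rep[OF comult_in] by blast
  have "rtrans g x = (\<Sum>e\<in>E. scale (g (b e)) e)" if "lin g" for g
    unfolding rtrans_def E(2) by (simp add: linear_sumD[OF lift_linear[OF slice_r[OF that]]] lift_pt[OF slice_r[OF that]])
  then show ?thesis
    by (intro exI[of _ E]) (auto simp: E(1) intro: span_sum span_scale span_base)
qed

text \<open>All iterates of the derivation are again translations of \<open>x\<close> by functionals, so they lie in the
  finite-dimensional space spanned by the first factors of \<open>\<Delta> x\<close>, and some of them are linearly
  dependent.\<close>
lemma rtrans_annihilator:
  assumes d: "tangent d"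
  shows "\<exists>P. P \<noteq> 0 \<and> derivation.polyD scale (rtrans d) P x = 0"
proof -
  interpret R: derivation scale "rtrans d" by (rule rtrans_derivation[OF d])
  have ld: "lin d" using d by (auto simp: tangent_def)
  have "\<exists>g. lin g \<and> (rtrans d ^^ i) x = rtrans g x" for i
  proof (induction i)
    case 0
    show ?case using pointsD(1)[OF \<epsilon>_point] by (intro exI[of _ \<epsilon>]) (simp add: rtrans_\<epsilon>)
  next
    case (Suc i)
    then obtain g where g: "lin g" "(rtrans d ^^ i) x = rtrans g x" by blast
    then show ?case by (intro exI[of _ "conv d g"]) (simp add: rtrans_rtrans[OF ld g(1)] conv_linear ld)
  qed
  moreover obtain E where E: "finite E" "\<And>g. lin g \<Longrightarrow> rtrans g x \<in> span E"
    using rtrans_finite_span by blast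
  ultimately have in_span: "(rtrans d ^^ i) x \<in> span E" for i by metis
  let ?v = "\<lambda>i. (rtrans d ^^ i) x"
  define n where "n = card E"
  show ?thesis
  proof (cases "inj_on ?v {..n}")
    case False
    then obtain i j where ij: "?v i = ?v j" "i \<noteq> j" by (auto simp: inj_on_def)
    let ?P = "monom 1 i - monom (1 :: 'k) j"
    have "coeff ?P i \<noteq> 0" using ij(2) by simp
    then have "?P \<noteq> 0" by force
    moreover have "R.polyD ?P x = (\<Sum>k\<le>max i j. scale (coeff ?P k) (?v k))"
      by (intro R.polyD_bound degree_diff_le order.trans[OF degree_monom_le]) simp_all
    moreover have "\<dots> = (\<Sum>k\<le>max i j. (if k = i then ?v k else 0) - (if k = j then ?v k else 0))"
      by (intro sum.cong) auto
    moreover have "\<dots> = 0" using ij by (simp add: sum_subtractf)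
    ultimately show ?thesis by metis
  next
    case True
    let ?S = "?v ` {..n}"
    have "dependent ?S"
    proof (rule ccontr)
      assume "\<not> dependent ?S"
      then have "card ?S \<le> card E" using independent_span_bound[OF E(1)] in_span by blast
      then show False using True by (simp add: card_image n_def)
    qed
    then obtain u where u: "\<exists>v\<in>?S. u v \<noteq> 0" "(\<Sum>v\<in>?S. scale (u v) v) = 0"
      using dependent_finite[of ?S] by auto
    define P where "P = (\<Sum>i\<le>n. monom (u (?v i)) i)"
    have cP: "coeff P k = (if k \<le> n then u (?v k) else 0)" for k
      by (simp add: P_def coeff_sum)
    from u(1) obtain i where "i \<le> n" "u (?v i) \<noteq> 0" by auto
    then have "P \<noteq> 0" using cP[of i] by auto
    moreover have "R.polyD P x = (\<Sum>k\<le>n. scale (u (?v k)) (?v k))"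
      by (subst R.polyD_bound[of _ n]) (auto simp: cP intro!: degree_le)
    moreover have "\<dots> = 0" using u(2) by (simp add: sum.reindex[OF True])
    ultimately show ?thesis by metis
  qed
qed

text \<open>If \<open>r\<close> is not constant, some tangent vector at some point \<open>q\<close> does not kill it. Translating this
  tangent vector to the identity gives an invariant derivation that does not kill \<open>r\<close> at \<open>q\<close>.\<close>
lemma invariant_scalar:
  assumes "\<And>d. tangent d \<Longrightarrow> rtrans d r = 0"
  shows "r \<in> scalars"
proof (rule ccontr)
  assume "r \<notin> scalars"
  from tangent_vector_exists[OF this] obtain q d' where q: "q \<in> points scale" and d': "lin d'"
    "\<And>x y. d' (x * y) = q x * d' y + d' x * q y" "d' r \<noteq> 0" by blast
  (* The inverse of the point q, by which the tangent vector is moved to the identity. *)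
  define q' where "q' = (\<lambda>x. q (S x))"
  have q': "q' \<in> points scale" unfolding q'_def by (rule antipode_point[OF q])
  note lq = pointsD(1)[OF q] and lq' = pointsD(1)[OF q']
  define d where "d = conv q' d'"
  have ld: "lin d" unfolding d_def by (rule conv_linear[OF lq' d'(1)])
  have inv: "q (ltrans q' x) = \<epsilon> x" for x
    using apply_ltrans[OF lq' lq] conv_antipode(1)[OF q] by (simp add: q'_def)
  have deq: "d x = d' (ltrans q' x)" for x
    unfolding d_def apply_ltrans[OF lq' d'(1)] ..
  have "tangent d"
    unfolding tangent_def by (auto simp: ld deq ltrans_mult[OF q'] d'(2) inv)
  then have "rtrans d r = 0" by (rule assms)
  then have "0 = q (rtrans d r)" by (simp add: pointsD[OF q])
  also have "\<dots> = conv q d r" by (rule apply_rtrans[OF lq ld])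
  also have "conv q d = conv (conv q q') d'" unfolding d_def by (rule conv_assoc[OF lq lq' d'(1), symmetric])
  also have "conv q q' = \<epsilon>" unfolding q'_def by (rule conv_antipode(2)[OF q])
  also have "conv \<epsilon> d' = d'" by (rule conv_\<epsilon>_left[OF d'(1)])
  finally show False using d'(3) by simp
qed

text \<open>Rosenlicht's theorem. The translate of \<open>f\<close> by a point \<open>p\<close> has the same eigenvalue as \<open>f\<close> under
  every invariant derivation, so its quotient by \<open>f\<close> is killed by all of them and is a constant. At the
  identity this constant is \<open>p f\<close>.\<close>
theorem unit_group_like:
  assumes fg: "f * g = 1" and f1: "\<epsilon> f = 1"
  shows "\<Delta> f = pt f f"
proof (rule tensor_eqI[OF comult_in TS_pt])
  fix p q assume p: "p \<in> points scale" and q: "q \<in> points scale"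
  note lp = pointsD(1)[OF p] and lq = pointsD(1)[OF q] and le = pointsD(1)[OF \<epsilon>_point]
  (* The quotient of the translate of f by f. *)
  define r where "r = ltrans p f * g"
  have "rtrans d r = 0" if d: "tangent d" for d
  proof -
    interpret R: derivation scale "rtrans d" by (rule rtrans_derivation[OF d])
    have ld: "lin d" using d by (auto simp: tangent_def)
    obtain P where P: "P \<noteq> 0" "R.polyD P f = 0" using rtrans_annihilator[OF d] by blast
    obtain Q where Q: "Q \<noteq> 0" "R.polyD Q g = 0" using rtrans_annihilator[OF d] by blast
    obtain \<nu> where \<nu>: "rtrans d f = scale \<nu> f" using R.unit_eigenvector[OF fg P Q char_0] by blast
    have "f * rtrans d g + scale \<nu> f * g = 0"
      using R.D_mult[of f g] R.D_one fg \<nu> by simp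
    then have "g * (f * rtrans d g + scale \<nu> f * g) = 0" by simp
    moreover have "g * (f * rtrans d g + scale \<nu> f * g) = (f * g) * rtrans d g + scale \<nu> ((f * g) * g)"
      by (simp add: distrib_left scale_mult_left[symmetric] scale_mult_right[symmetric] ac_simps)
    ultimately have g: "rtrans d g = - scale \<nu> g" by (simp add: fg add_eq_0_iff2)
    have "rtrans d (ltrans p f) = scale \<nu> (ltrans p f)"
      unfolding ltrans_rtrans[OF lp ld, symmetric] \<nu> linear_scaleD[OF ltrans_linear[OF lp]] ..
    then show ?thesis
      unfolding r_def R.D_mult g by (simp add: scale_mult_left[symmetric] scale_mult_right[symmetric])
  qed
  then obtain c where c: "r = scale c 1" using invariant_scalar[of r] by (auto simp: scalars_def)
  have "ltrans p f = ltrans p f * (f * g)" by (simp add: fg)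
  also have "\<dots> = r * f" by (simp add: r_def ac_simps)
  finally have L: "ltrans p f = scale c f" by (simp add: c scale_mult_left[symmetric])
  have "p f = \<epsilon> (ltrans p f)" using apply_ltrans[OF lp le] conv_\<epsilon>_right[OF lp] by simp
  then have "c = p f" by (simp add: L pointsD[OF \<epsilon>_point] f1)
  have "tensor_fun p q (\<Delta> f) = q (ltrans p f)" by (simp add: apply_ltrans[OF lp lq] conv_def)
  also have "\<dots> = tensor_fun p q (pt f f)"
    by (simp add: L \<open>c = p f\<close> pointsD[OF q] tensor_fun_pt[OF lp lq])
  finally show "tensor_fun p q (\<Delta> f) = tensor_fun p q (pt f f)" .
qed

end

section \<open>Coordinates on an Ore extension\<close>

locale hopf_ore = R: affine_hopf sR \<Delta>R \<epsilon>R SR + T: hopf_algebra sT \<Delta> \<epsilon> S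
  for sR :: "'k::{alg_closed_field,field_char_0} \<Rightarrow> 'r::idom \<Rightarrow> 'r" and \<Delta>R \<epsilon>R SR
    and sT :: "'k \<Rightarrow> 't::ring_1 \<Rightarrow> 't" and \<Delta> \<epsilon> S +
  fixes \<iota> :: "'r \<Rightarrow> 't" and \<sigma> \<delta> :: "'r \<Rightarrow> 'r" and x :: 't
  assumes ore: "ore_extension sR sT \<iota> \<sigma> \<delta> x"
    and ext: "hopf_extension sR \<Delta>R \<epsilon>R SR sT \<Delta> \<epsilon> S \<iota>"
begin

lemma \<iota>_linear: "Vector_Spaces.linear sR sT \<iota>"
  and \<iota>_one [simp]: "\<iota> 1 = 1" and \<iota>_mult: "\<iota> (a * b) = \<iota> a * \<iota> b"
  using ore by (auto simp: ore_extension_def algebra_hom_def)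

lemmas \<iota>_add = linear_addD[OF \<iota>_linear] and \<iota>_scale = linear_scaleD[OF \<iota>_linear]
  and \<iota>_zero [simp] = linear_zeroD[OF \<iota>_linear]

lemma \<sigma>_linear: "Vector_Spaces.linear sR sR \<sigma>"
  and \<sigma>_one [simp]: "\<sigma> 1 = 1" and \<sigma>_mult: "\<sigma> (a * b) = \<sigma> a * \<sigma> b" and \<sigma>_bij: "bij \<sigma>"
  using ore by (auto simp: ore_extension_def algebra_automorphism_def algebra_hom_def)

lemmas \<sigma>_add = linear_addD[OF \<sigma>_linear] and \<sigma>_scale = linear_scaleD[OF \<sigma>_linear]
  and \<sigma>_zero [simp] = linear_zeroD[OF \<sigma>_linear]

lemma \<delta>_linear: "Vector_Spaces.linear sR sR \<delta>"
  using ore by (auto simp: ore_extension_def skew_derivation_def)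

lemmas \<delta>_zero [simp] = linear_zeroD[OF \<delta>_linear]

lemma x_comm: "x * \<iota> r = \<iota> (\<sigma> r) * x + \<iota> (\<delta> r)"
  using ore by (auto simp: ore_extension_def)

definition coord :: "nat \<Rightarrow> 't \<Rightarrow> 'r" where
  "coord i t = coeff (THE p. t = (\<Sum>n\<le>degree p. \<iota> (coeff p n) * x ^ n)) i"

lemma coord_poly: "coord i (\<Sum>n\<le>degree p. \<iota> (coeff p n) * x ^ n) = coeff p i"
proof -
  let ?t = "\<Sum>n\<le>degree p. \<iota> (coeff p n) * x ^ n"
  have "\<exists>!q. ?t = (\<Sum>n\<le>degree q. \<iota> (coeff q n) * x ^ n)"
    using ore by (simp add: ore_extension_def)
  then have "(THE q. ?t = (\<Sum>n\<le>degree q. \<iota> (coeff q n) * x ^ n)) = p"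
    by (rule the1_equality) simp
  then show ?thesis by (simp add: coord_def)
qed

lemma coord_sum: "coord i (\<Sum>n\<le>N. \<iota> (r n) * x ^ n) = (if i \<le> N then r i else 0)"
proof -
  define p where "p = (\<Sum>n\<le>N. monom (r n) n)"
  have c: "coeff p i = (if i \<le> N then r i else 0)" for i by (simp add: p_def coeff_sum)
  have "degree p \<le> N" by (rule degree_le) (simp add: c)
  then have "(\<Sum>n\<le>degree p. \<iota> (coeff p n) * x ^ n) = (\<Sum>n\<le>N. \<iota> (coeff p n) * x ^ n)"
    by (intro sum.mono_neutral_left) (auto simp: coeff_eq_0)
  also have "\<dots> = (\<Sum>n\<le>N. \<iota> (r n) * x ^ n)" by (intro sum.cong) (simp_all add: c)
  finally show ?thesis using coord_poly[of i p] c by simp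
qed

lemma ex_coord_expand: "\<exists>N. t = (\<Sum>n\<le>N. \<iota> (coord n t) * x ^ n) \<and> (\<forall>i>N. coord i t = 0)"
proof -
  obtain p where p: "t = (\<Sum>n\<le>degree p. \<iota> (coeff p n) * x ^ n)"
    using ore by (force simp: ore_extension_def)
  have "coord i t = coeff p i" for i using coord_poly[of i p] p by simp
  with p show ?thesis by (intro exI[of _ "degree p"]) (auto simp: coeff_eq_0)
qed

lemma coord_expand_le:
  assumes "\<forall>i>N. coord i t = 0"
  shows "t = (\<Sum>n\<le>N. \<iota> (coord n t) * x ^ n)"
proof -
  obtain M where M: "t = (\<Sum>n\<le>M. \<iota> (coord n t) * x ^ n)" "\<forall>i>M. coord i t = 0" using ex_coord_expand by blast
  have "(\<Sum>n\<le>M. \<iota> (coord n t) * x ^ n) = (\<Sum>n\<le>max M N. \<iota> (coord n t) * x ^ n)"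
    using M(2) by (intro sum.mono_neutral_left) auto
  also have "\<dots> = (\<Sum>n\<le>N. \<iota> (coord n t) * x ^ n)"
    using assms by (intro sum.mono_neutral_right) auto
  finally show ?thesis using M(1) by simp
qed

lemma coord_expand2: "\<exists>N. s = (\<Sum>n\<le>N. \<iota> (coord n s) * x ^ n) \<and> t = (\<Sum>n\<le>N. \<iota> (coord n t) * x ^ n)
   \<and> (\<forall>i>N. coord i s = 0) \<and> (\<forall>i>N. coord i t = 0)"
proof -
  obtain M N where "\<forall>i>M. coord i s = 0" "\<forall>i>N. coord i t = 0" using ex_coord_expand by metis
  then show ?thesis using coord_expand_le[of "max M N" s] coord_expand_le[of "max M N" t]
    by (intro exI[of _ "max M N"]) auto
qed

lemma coord_add: "coord i (s + t) = coord i s + coord i t"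
proof -
  obtain N where N: "s = (\<Sum>n\<le>N. \<iota> (coord n s) * x ^ n)" "t = (\<Sum>n\<le>N. \<iota> (coord n t) * x ^ n)"
    "\<forall>i>N. coord i s = 0" "\<forall>i>N. coord i t = 0" using coord_expand2 by blast
  have "s + t = (\<Sum>n\<le>N. \<iota> (coord n s + coord n t) * x ^ n)"
    by (subst N(1), subst N(2)) (simp add: \<iota>_add distrib_right sum.distrib)
  then show ?thesis using coord_sum[of i "\<lambda>n. coord n s + coord n t" N] N(3,4) by auto
qed

lemma coord_left_mult: "coord i (\<iota> r * t) = r * coord i t"
proof -
  obtain N where N: "t = (\<Sum>n\<le>N. \<iota> (coord n t) * x ^ n)" "\<forall>i>N. coord i t = 0" using ex_coord_expand by blast
  have "\<iota> r * t = (\<Sum>n\<le>N. \<iota> (r * coord n t) * x ^ n)"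
    by (subst N(1)) (simp add: \<iota>_mult sum_distrib_left mult.assoc)
  then show ?thesis using coord_sum[of i "\<lambda>n. r * coord n t" N] N(2) by auto
qed

lemma sT_eq: "sT c t = \<iota> (sR c 1) * t"
  using T.scale_mult_left[of c 1 t] by (simp add: \<iota>_scale)

lemma coord_linear: "Vector_Spaces.linear sT sR (coord i)"
  by (rule linearI[OF T.V R.V]) (simp_all add: coord_add sT_eq coord_left_mult R.scale_mult_left[symmetric])

lemma coord_zero [simp]: "coord i 0 = 0"
  by (rule linear_zeroD[OF coord_linear])

lemma coord_mon [simp]: "coord i (\<iota> r * x ^ j) = (if i = j then r else 0)"
proof -
  have "\<iota> r * x ^ j = (\<Sum>n\<le>j. \<iota> (if n = j then r else 0) * x ^ n)"
    by (subst sum.mono_neutral_right[of _ "{j}"]) auto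
  then show ?thesis by (simp only: coord_sum) auto
qed

lemma coord_\<iota> [simp]: "coord i (\<iota> r) = (if i = 0 then r else 0)"
  using coord_mon[of i r 0] by simp

lemma coord_one [simp]: "coord i 1 = (if i = 0 then 1 else 0)"
  using coord_\<iota>[of i 1] by simp

lemma coord_x [simp]: "coord i x = (if i = 1 then 1 else 0)"
  using coord_mon[of i 1 1] by simp

lemma coord_x_mult: "coord i (x * t) = (if i = 0 then 0 else \<sigma> (coord (i - 1) t)) + \<delta> (coord i t)"
proof -
  obtain N where N: "t = (\<Sum>n\<le>N. \<iota> (coord n t) * x ^ n)" "\<forall>i>N. coord i t = 0" using ex_coord_expand by blast
  have "x * t = (\<Sum>n\<le>N. \<iota> (\<sigma> (coord n t)) * x ^ Suc n) + (\<Sum>n\<le>N. \<iota> (\<delta> (coord n t)) * x ^ n)"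
    by (subst N(1)) (simp add: sum_distrib_left mult.assoc[symmetric] x_comm distrib_right sum.distrib)
  also have "(\<Sum>n\<le>N. \<iota> (\<sigma> (coord n t)) * x ^ Suc n)
      = (\<Sum>n\<le>Suc N. \<iota> (case n of 0 \<Rightarrow> 0 | Suc n \<Rightarrow> \<sigma> (coord n t)) * x ^ n)"
    by (subst sum.atMost_Suc_shift) simp
  finally show ?thesis using N(2)
    by (cases i) (auto simp: coord_add coord_sum simp del: sum.atMost_Suc)
qed

definition degree_le_set :: "nat \<Rightarrow> 't set" where "degree_le_set n = {t. \<forall>i>n. coord i t = 0}"

lemma x_power_mult:
  assumes "t \<in> degree_le_set n"
  shows "x ^ i * t \<in> degree_le_set (n + i)" "coord (n + i) (x ^ i * t) = (\<sigma> ^^ i) (coord n t)"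
proof -
  have "x ^ i * t \<in> degree_le_set (n + i) \<and> coord (n + i) (x ^ i * t) = (\<sigma> ^^ i) (coord n t)"
  proof (induction i)
    case 0
    then show ?case using assms by simp
  next
    case (Suc i)
    then show ?case by (auto simp: degree_le_set_def mult.assoc coord_x_mult)
  qed
  then show "x ^ i * t \<in> degree_le_set (n + i)" "coord (n + i) (x ^ i * t) = (\<sigma> ^^ i) (coord n t)" by auto
qed

text \<open>The leading coefficient of a product. The derivation \<open>\<delta>\<close> only contributes to lower degrees.\<close>
lemma degree_le_set_mult:
  assumes "s \<in> degree_le_set m" "t \<in> degree_le_set n"
  shows "s * t \<in> degree_le_set (m + n)" "coord (m + n) (s * t) = coord m s * (\<sigma> ^^ m) (coord n t)"
proof -
  have st: "s * t = (\<Sum>k\<le>m. \<iota> (coord k s) * (x ^ k * t))"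
  proof -
    have s: "s = (\<Sum>k\<le>m. \<iota> (coord k s) * x ^ k)" using coord_expand_le[of m s] assms(1) by (simp add: degree_le_set_def)
    show ?thesis by (subst (1) s) (simp add: sum_distrib_right mult.assoc)
  qed
  have k: "coord i (x ^ k * t) = 0" if "n + k < i" for i k using x_power_mult(1)[OF assms(2), of k] that by (simp add: degree_le_set_def)
  have c: "coord i (s * t) = (\<Sum>k\<le>m. coord k s * coord i (x ^ k * t))" for i
    unfolding st by (subst linear_sumD[OF coord_linear]) (simp add: coord_left_mult)
  show "s * t \<in> degree_le_set (m + n)"
    unfolding degree_le_set_def by (auto simp: c k intro!: sum.neutral)
  have "coord (m + n) (s * t) = (\<Sum>k\<in>{m}. coord k s * coord (m + n) (x ^ k * t))"
    unfolding c by (rule sum.mono_neutral_right) (auto simp: k)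
  then show "coord (m + n) (s * t) = coord m s * (\<sigma> ^^ m) (coord n t)"
    using x_power_mult(2)[OF assms(2), of m] by (simp add: add.commute)
qed

lemma mon_degree_le_set: "\<iota> r * x ^ i \<in> degree_le_set i"
  by (simp add: degree_le_set_def)

section \<open>Coordinates on the tensor square\<close>

abbreviation RP where "RP \<equiv> points sR"

text \<open>The coefficient at \<open>x\<^sup>i \<otimes> x\<^sup>j\<close>, for \<open>s = (i, j)\<close>, evaluated at the pair of points \<open>(p, h)\<close>.\<close>
definition tcoord :: "nat \<times> nat \<Rightarrow> ('r \<Rightarrow> 'k) \<Rightarrow> ('r \<Rightarrow> 'k) \<Rightarrow> ('t, 't, 'k) tensor \<Rightarrow> 'k" where
  "tcoord s p h = T.tensor_fun (\<lambda>a. p (coord (fst s) a)) (\<lambda>b. h (coord (snd s) b))"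

lemma pcoord_linear: "p \<in> RP \<Longrightarrow> T.lin (\<lambda>a. p (coord i a))"
  using coord_linear[of i] pointsD(1)[of p sR] by (simp add: Vector_Spaces.linear_iff)

lemma tcoord_pt: "p \<in> RP \<Longrightarrow> h \<in> RP \<Longrightarrow> tcoord s p h (T.pt a b) = p (coord (fst s) a) * h (coord (snd s) b)"
  unfolding tcoord_def by (rule T.tensor_fun_pt) (rule pcoord_linear, assumption)+

lemma tcoord_linear: "p \<in> RP \<Longrightarrow> h \<in> RP \<Longrightarrow> Vector_Spaces.linear fun_scale (*) (tcoord s p h)"
  unfolding tcoord_def by (rule T.tensor_fun_linear) (rule pcoord_linear, assumption)+

lemmas tcoord_add = linear_addD[OF tcoord_linear] and tcoord_zero = linear_zeroD[OF tcoord_linear]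
  and tcoord_diff = linear_diffD[OF tcoord_linear]

lemma tcoord_separate:
  assumes t: "t \<in> T.TS" and 0: "\<And>s p h. p \<in> RP \<Longrightarrow> h \<in> RP \<Longrightarrow> tcoord s p h t = 0"
  shows "t = 0"
proof -
  let ?\<Phi> = "{\<lambda>a. p (coord i a) | p i. p \<in> RP}"
  have sep: "a = 0" if "\<And>f. f \<in> ?\<Phi> \<Longrightarrow> f a = 0" for a
  proof -
    have "coord i a = 0" for i
      using R.points_separate[of "coord i a"] that by blast
    then show ?thesis using coord_expand_le[of 0 a] by simp
  qed
  show ?thesis
  proof (rule T.tensor_separation[OF t, of ?\<Phi> ?\<Phi>])
    fix f g assume "f \<in> ?\<Phi>" "g \<in> ?\<Phi>"
    then obtain p i h j where "p \<in> RP" "h \<in> RP" "f = (\<lambda>a. p (coord i a))" "g = (\<lambda>a. h (coord j a))" by blast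
    then show "T.tensor_fun f g t = 0" using 0[of p h "(i, j)"] by (simp add: tcoord_def)
  qed (use sep pcoord_linear in blast)+
qed

lemma tcoord_eqI:
  assumes "s \<in> T.TS" "t \<in> T.TS" "\<And>i p h. p \<in> RP \<Longrightarrow> h \<in> RP \<Longrightarrow> tcoord i p h s = tcoord i p h t"
  shows "s = t"
  using tcoord_separate[OF T.TS_diff[OF assms(1,2)]] assms(3) by (simp add: tcoord_diff)

text \<open>The tensors whose exponents lie in \<open>B\<close>. It is given by generators, which is what products are
  computed with; \<open>mono_span_remove\<close> below relates it to vanishing coefficients.\<close>
definition mono_span :: "(nat \<times> nat) set \<Rightarrow> ('t, 't, 'k) tensor set" where
  "mono_span B = T.F.span {T.pt (\<iota> r * x ^ i) (\<iota> r' * x ^ j) | r r' i j. (i, j) \<in> B}"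

lemma mono_span_gen: "(i, j) \<in> B \<Longrightarrow> T.pt (\<iota> r * x ^ i) (\<iota> r' * x ^ j) \<in> mono_span B"
  unfolding mono_span_def by (rule T.F.span_base) blast

lemma mono_span_add: "u \<in> mono_span B \<Longrightarrow> v \<in> mono_span B \<Longrightarrow> u + v \<in> mono_span B"
  and mono_span_zero: "0 \<in> mono_span B"
  unfolding mono_span_def by (auto intro: T.F.span_add T.F.span_zero)

lemma mono_span_sum: "(\<And>i. i \<in> I \<Longrightarrow> f i \<in> mono_span B) \<Longrightarrow> (\<Sum>i\<in>I. f i) \<in> mono_span B"
  unfolding mono_span_def by (rule T.F.span_sum)

lemma mono_span_mono: "A \<subseteq> B \<Longrightarrow> mono_span A \<subseteq> mono_span B"
  unfolding mono_span_def by (rule T.F.span_mono) blast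

lemma mono_span_induct [consumes 1, case_names zero gen add]:
  assumes t: "t \<in> mono_span B" and zero: "P 0"
    and gen: "\<And>r r' i j. (i, j) \<in> B \<Longrightarrow> P (T.pt (\<iota> r * x ^ i) (\<iota> r' * x ^ j))"
    and add: "\<And>u v. u \<in> mono_span B \<Longrightarrow> v \<in> mono_span B \<Longrightarrow> P u \<Longrightarrow> P v \<Longrightarrow> P (u + v)"
  shows "P t"
proof -
  have "t \<in> mono_span B \<and> P t"
    using t[unfolded mono_span_def]
  proof (induction rule: T.F.span_induct_alt)
    case base
    show ?case using zero mono_span_zero by blast
  next
    case (step c u v)
    then obtain r r' i j where u: "u = T.pt (\<iota> r * x ^ i) (\<iota> r' * x ^ j)" and B: "(i, j) \<in> B" by blast
    have "fun_scale c u = T.pt (\<iota> (sR c r) * x ^ i) (\<iota> r' * x ^ j)"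
      by (simp add: u T.pt_scale_left[symmetric] T.scale_mult_left \<iota>_scale)
    then have "fun_scale c u \<in> mono_span B" "P (fun_scale c u)"
      using mono_span_gen[OF B] gen[OF B] by auto
    with step show ?case using add mono_span_add by blast
  qed
  then show ?thesis ..
qed

lemma mono_span_TS: "t \<in> mono_span B \<Longrightarrow> t \<in> T.TS"
  by (induction rule: mono_span_induct) (auto intro: T.TS_add)

lemma pt_mono_span:
  assumes "a \<in> degree_le_set m" "b \<in> degree_le_set n"
  shows "T.pt a b \<in> mono_span {(i, j). i \<le> m \<and> j \<le> n}"
proof -
  have a: "a = (\<Sum>i\<le>m. \<iota> (coord i a) * x ^ i)" and b: "b = (\<Sum>i\<le>n. \<iota> (coord i b) * x ^ i)"
    using assms coord_expand_le by (auto simp: degree_le_set_def)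
  have "T.pt a b = (\<Sum>i\<le>m. \<Sum>j\<le>n. T.pt (\<iota> (coord i a) * x ^ i) (\<iota> (coord j b) * x ^ j))"
    by (subst a, subst b) (simp add: T.pt_sum_left T.pt_sum_right, rule sum.swap)
  also have "\<dots> \<in> mono_span {(i, j). i \<le> m \<and> j \<le> n}"
    by (intro mono_span_sum mono_span_gen) auto
  finally show ?thesis .
qed

lemma ex_degree_le_set: "\<exists>n. t \<in> degree_le_set n"
  using ex_coord_expand[of t] by (auto simp: degree_le_set_def)

lemma TS_mono_span: "t \<in> T.TS \<Longrightarrow> \<exists>A. finite A \<and> t \<in> mono_span A"
proof (induction rule: T.TS_induct)
  case (pure a b)
  obtain m n where "a \<in> degree_le_set m" "b \<in> degree_le_set n" using ex_degree_le_set by metis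
  from pt_mono_span[OF this] show ?case
    by (intro exI[of _ "{(i, j). i \<le> m \<and> j \<le> n}"] conjI)
      (auto intro: finite_subset[of _ "{..m} \<times> {..n}"])
next
  case (add u v)
  then obtain A B where "finite A" "u \<in> mono_span A" "finite B" "v \<in> mono_span B" by blast
  then show ?case
    using mono_span_mono[of A "A \<union> B"] mono_span_mono[of B "A \<union> B"] by (intro exI[of _ "A \<union> B"]) (auto intro: mono_span_add)
qed

lemma tcoord_gen: "p \<in> RP \<Longrightarrow> h \<in> RP \<Longrightarrow>
    tcoord s p h (T.pt (\<iota> r * x ^ i) (\<iota> r' * x ^ j)) = (if s = (i, j) then p r * h r' else 0)"
  by (cases s) (auto simp: tcoord_pt pointsD)

lemma mono_span_tcoord_zero: "t \<in> mono_span B \<Longrightarrow> s \<notin> B \<Longrightarrow> p \<in> RP \<Longrightarrow> h \<in> RP \<Longrightarrow> tcoord s p h t = 0"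
  by (induction rule: mono_span_induct) (auto simp: tcoord_zero tcoord_add tcoord_gen)

lemma mono_span_split: "t \<in> mono_span (A \<union> B) \<Longrightarrow> \<exists>u\<in>mono_span A. \<exists>v\<in>mono_span B. t = u + v"
proof (induction rule: mono_span_induct)
  case zero
  show ?case using mono_span_zero by (metis add_0)
next
  case (gen r r' i j)
  then show ?case
    using mono_span_gen[of i j A r r'] mono_span_gen[of i j B r r'] mono_span_zero by (metis Un_iff add_0 add_0_right)
next
  case (add t t')
  then obtain u v u' v' where "u \<in> mono_span A" "v \<in> mono_span B" "u' \<in> mono_span A" "v' \<in> mono_span B" "t = u + v" "t' = u' + v'" by blast
  then show ?case
    by (intro bexI[of _ "u + u'"] bexI[of _ "v + v'"]) (auto intro: mono_span_add simp: algebra_simps)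
qed

text \<open>Split off the part with exponent \<open>s\<close>. All its coefficients vanish, so it is zero.\<close>
lemma mono_span_remove:
  assumes t: "t \<in> mono_span A" and 0: "\<And>p h. p \<in> RP \<Longrightarrow> h \<in> RP \<Longrightarrow> tcoord s p h t = 0"
  shows "t \<in> mono_span (A - {s})"
proof -
  have "t \<in> mono_span ((A - {s}) \<union> {s})" using t mono_span_mono[of A "(A - {s}) \<union> {s}"] by blast
  then obtain u v where uv: "u \<in> mono_span (A - {s})" "v \<in> mono_span {s}" "t = u + v" using mono_span_split by blast
  have "v = 0"
  proof (rule tcoord_separate[OF mono_span_TS[OF uv(2)]])
    fix s' p h assume ph: "p \<in> RP" "h \<in> RP"
    show "tcoord s' p h v = 0"
    proof (cases "s' = s")
      case True
      then show ?thesis using 0[OF ph] mono_span_tcoord_zero[OF uv(1) _ ph, of s] by (simp add: uv(3) tcoord_add[OF ph])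
    next
      case False
      then show ?thesis using mono_span_tcoord_zero[OF uv(2) _ ph] by blast
    qed
  qed
  with uv show ?thesis by simp
qed

lemma mono_span_restrict:
  assumes "finite A" "t \<in> mono_span A" "\<And>s p h. s \<notin> B \<Longrightarrow> p \<in> RP \<Longrightarrow> h \<in> RP \<Longrightarrow> tcoord s p h t = 0"
  shows "t \<in> mono_span B"
proof -
  have "t \<in> mono_span (A - C)" if "finite C" "C \<inter> B = {}" for C
    using that
  proof (induction C rule: finite_induct)
    case (insert s C)
    then have "t \<in> mono_span (A - C - {s})" by (intro mono_span_remove assms(3)) auto
    moreover have "A - C - {s} = A - insert s C" by auto
    ultimately show ?case by simp
  qed (use assms in simp)
  from this[of "A - B"] have "t \<in> mono_span (A - (A - B))" using assms(1) by auto
  then show ?thesis using mono_span_mono[of "A - (A - B)" B] by blast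
qed

end

section \<open>Leading terms\<close>

text \<open>The lexicographic order, and for \<open>b = False\<close> its mirror image in which the second exponent
  counts first.\<close>
definition lex_less :: "bool \<Rightarrow> nat \<times> nat \<Rightarrow> nat \<times> nat \<Rightarrow> bool" where
  "lex_less b s s' = (if b then fst s < fst s' \<or> fst s = fst s' \<and> snd s < snd s'
                 else snd s < snd s' \<or> snd s = snd s' \<and> fst s < fst s')"

definition lex_below :: "bool \<Rightarrow> nat \<times> nat \<Rightarrow> (nat \<times> nat) set" where
  "lex_below b s = {s'. s' = s \<or> lex_less b s' s}"

lemma lex_less_total: "s \<noteq> s' \<Longrightarrow> lex_less b s s' \<or> lex_less b s' s"
  by (cases s; cases s') (auto simp: lex_less_def)

lemma finite_has_lex_less_max:
  assumes "finite A" "A \<noteq> {}" shows "\<exists>s\<in>A. A \<subseteq> lex_below b s"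
proof -
  have "asymp_on A (lex_less b)" by (intro asymp_onI) (auto simp: lex_less_def split: if_splits)
  moreover have "transp_on A (lex_less b)" by (intro transp_onI) (auto simp: lex_less_def split: if_splits)
  ultimately obtain m where "m \<in> A" "\<forall>x\<in>A. x \<noteq> m \<longrightarrow> \<not> lex_less b m x"
    using Finite_Set.bex_max_element[OF assms(1)] assms(2) by blast
  then show ?thesis using lex_less_total[of _ m b] by (intro bexI[of _ m]) (auto simp: lex_below_def)
qed

context hopf_ore
begin

text \<open>Take a smallest set of exponents that supports \<open>t\<close>. Its largest element cannot be removed, so
  the coefficient there does not vanish.\<close>
lemma mono_span_top:
  assumes t: "t \<in> T.TS" "t \<noteq> 0"
  shows "\<exists>s. t \<in> mono_span (lex_below b s) \<and> (\<exists>p\<in>RP. \<exists>h\<in>RP. tcoord s p h t \<noteq> 0)"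
proof -
  define isA where "isA A \<longleftrightarrow> finite A \<and> t \<in> mono_span A" for A
  obtain A0 where "isA A0" using TS_mono_span[OF t(1)] by (auto simp: isA_def)
  then obtain A where A: "isA A" "\<And>B. isA B \<Longrightarrow> card A \<le> card B"
    using ex_has_least_nat[of isA A0 card] by blast
  have "A \<noteq> {}"
  proof
    assume "A = {}"
    then have "t \<in> mono_span {}" using A(1) by (simp add: isA_def)
    then have "t = 0" by (induction rule: mono_span_induct) auto
    with t(2) show False by simp
  qed
  then obtain s where s: "s \<in> A" "A \<subseteq> lex_below b s"
    using finite_has_lex_less_max[OF _ \<open>A \<noteq> {}\<close>, of b] A(1) unfolding isA_def by blast
  have "\<exists>p\<in>RP. \<exists>h\<in>RP. tcoord s p h t \<noteq> 0"
  proof (rule ccontr)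
    assume "\<not> ?thesis"
    then have "t \<in> mono_span (A - {s})" using A(1) by (intro mono_span_remove) (auto simp: isA_def)
    then have "isA (A - {s})" using A(1) by (simp add: isA_def)
    from A(2)[OF this] show False using s(1) A(1) card_Diff1_less[of A s] by (auto simp: isA_def)
  qed
  moreover have "t \<in> mono_span (lex_below b s)" using A(1) mono_span_mono[OF s(2)] by (auto simp: isA_def)
  ultimately show ?thesis by blast
qed

text \<open>The action of \<open>\<sigma>\<^sup>n\<close> on points. It enters when \<open>x\<^sup>n\<close> is moved past a coefficient.\<close>
definition twist :: "nat \<Rightarrow> ('r \<Rightarrow> 'k) \<Rightarrow> 'r \<Rightarrow> 'k" where "twist n p = (\<lambda>r. p ((\<sigma> ^^ n) r))"

lemma \<sigma>n_simps: "(\<sigma> ^^ n) (a + b) = (\<sigma> ^^ n) a + (\<sigma> ^^ n) b" "(\<sigma> ^^ n) (a * b) = (\<sigma> ^^ n) a * (\<sigma> ^^ n) b"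
   "(\<sigma> ^^ n) 1 = 1" "(\<sigma> ^^ n) (sR c a) = sR c ((\<sigma> ^^ n) a)" "(\<sigma> ^^ n) 0 = 0"
  by (induction n) (simp_all add: \<sigma>_add \<sigma>_mult \<sigma>_scale)

lemma twist_point: "p \<in> RP \<Longrightarrow> twist n p \<in> RP"
  unfolding points_def algebra_hom_def twist_def mem_Collect_eq
  by (simp add: \<sigma>n_simps Vector_Spaces.linear_iff)

lemma twist_surj:
  assumes "p \<in> RP" shows "\<exists>p'\<in>RP. twist n p' = p"
proof -
  have bij: "bij (\<sigma> ^^ n)" by (rule bij_betw_funpow[OF \<sigma>_bij])
  define \<tau> where "\<tau> = inv (\<sigma> ^^ n)"
  have \<tau>: "(\<sigma> ^^ n) (\<tau> r) = r" "\<tau> ((\<sigma> ^^ n) r) = r" for r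
    using bij by (auto simp: \<tau>_def bij_is_surj surj_f_inv_f bij_is_inj)
  have inj: "a = b" if "(\<sigma> ^^ n) a = (\<sigma> ^^ n) b" for a b using \<tau>(2) that by metis
  have t: "\<tau> (a + b) = \<tau> a + \<tau> b" "\<tau> (a * b) = \<tau> a * \<tau> b" "\<tau> 1 = 1" "\<tau> (sR c a) = sR c (\<tau> a)" for a b c
    by (rule inj, simp add: \<sigma>n_simps \<tau>)+
  have "(\<lambda>r. p (\<tau> r)) \<in> RP"
    using assms unfolding points_def algebra_hom_def mem_Collect_eq
    by (simp add: t Vector_Spaces.linear_iff)
  then show ?thesis by (intro bexI[of _ "\<lambda>r. p (\<tau> r)"]) (auto simp: twist_def \<tau>)
qed

lemma monomial_mult_top:
  fixes r s r' s' :: 'r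
  assumes ph: "p \<in> RP" "h \<in> RP"
    and s1: "(i, j) \<in> lex_below b (m, n)" and s2: "(i', j') \<in> lex_below b (m', n')"
  defines "u \<equiv> T.pt (\<iota> r * x ^ i) (\<iota> s * x ^ j)" and "u' \<equiv> T.pt (\<iota> r' * x ^ i') (\<iota> s' * x ^ j')"
  shows "T.tm u u' \<in> mono_span (lex_below b (m + m', n + n'))"
    "tcoord (m + m', n + n') p h (T.tm u u') = tcoord (m, n) p h u * tcoord (m', n') (twist m p) (twist n h) u'"
proof -
  let ?a = "\<iota> r * x ^ i * (\<iota> r' * x ^ i')" and ?b = "\<iota> s * x ^ j * (\<iota> s' * x ^ j')"
  have tm: "T.tm u u' = T.pt ?a ?b" by (simp add: u_def u'_def T.tm_pt)
  have a: "?a \<in> degree_le_set (i + i')" "coord (i + i') ?a = r * (\<sigma> ^^ i) r'"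
    and b: "?b \<in> degree_le_set (j + j')" "coord (j + j') ?b = s * (\<sigma> ^^ j) s'"
    using degree_le_set_mult[OF mon_degree_le_set[of r i] mon_degree_le_set[of r' i']] degree_le_set_mult[OF mon_degree_le_set[of s j] mon_degree_le_set[of s' j']] by auto
  have "{(k, l). k \<le> i + i' \<and> l \<le> j + j'} \<subseteq> lex_below b (m + m', n + n')"
    using s1 s2 by (auto simp: lex_below_def lex_less_def split: if_splits)
  then show "T.tm u u' \<in> mono_span (lex_below b (m + m', n + n'))"
    using pt_mono_span[OF a(1) b(1)] mono_span_mono tm by auto
  have k: "tcoord (m + m', n + n') p h (T.tm u u') = p (coord (m + m') ?a) * h (coord (n + n') ?b)"
    unfolding tm by (simp add: tcoord_pt[OF ph])
  show "tcoord (m + m', n + n') p h (T.tm u u') = tcoord (m, n) p h u * tcoord (m', n') (twist m p) (twist n h) u'"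
  proof (cases "(i, j) = (m, n) \<and> (i', j') = (m', n')")
    case True
    then have e: "i = m" "j = n" "i' = m'" "j' = n'" by auto
    have "tcoord (m, n) p h u = p r * h s" "tcoord (m', n') (twist m p) (twist n h) u' = twist m p r' * twist n h s'"
      by (simp_all add: u_def u'_def e tcoord_gen ph twist_point)
    then show ?thesis
      using a(2) b(2) unfolding k e
      by (simp add: twist_def pointsD[OF ph(1)] pointsD[OF ph(2)] mult_ac)
  next
    case False
    then have "m + m' > i + i' \<or> n + n' > j + j'"
      using s1 s2 by (auto simp: lex_below_def lex_less_def split: if_splits)
    then have "p (coord (m + m') ?a) * h (coord (n + n') ?b) = 0"
      using a(1) b(1) by (auto simp: degree_le_set_def pointsD[OF ph(1)] pointsD[OF ph(2)])
    moreover have "tcoord (m, n) p h u * tcoord (m', n') (twist m p) (twist n h) u' = 0"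
      using False by (auto simp: u_def u'_def tcoord_gen ph twist_point)
    ultimately show ?thesis by (simp only: k)
  qed
qed

text \<open>By bilinearity it is enough to multiply monomials. Exponents of a product are bounded by the sums
  of the exponents, and the order is compatible with addition, so only the two leading monomials
  contribute to the leading coefficient.\<close>
lemma mono_span_mult_top:
  assumes t: "t \<in> mono_span (lex_below b (m, n))" and u: "u \<in> mono_span (lex_below b (m', n'))"
  shows "T.tm t u \<in> mono_span (lex_below b (m + m', n + n'))"
    "p \<in> RP \<Longrightarrow> h \<in> RP \<Longrightarrow> tcoord (m + m', n + n') p h (T.tm t u) = tcoord (m, n) p h t * tcoord (m', n') (twist m p) (twist n h) u"
proof -
  define G where "G t u \<longleftrightarrow> T.tm t u \<in> mono_span (lex_below b (m + m', n + n')) \<and>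
    (\<forall>p\<in>RP. \<forall>h\<in>RP. tcoord (m + m', n + n') p h (T.tm t u) = tcoord (m, n) p h t * tcoord (m', n') (twist m p) (twist n h) u)" for t u
  have "G t u"
    using t
  proof (induction t rule: mono_span_induct)
    case zero
    then show ?case using mono_span_TS[OF u] by (simp add: G_def T.tm_zero_left mono_span_zero tcoord_zero)
  next
    case (gen r r' i j)
    from u show ?case
    proof (induction u rule: mono_span_induct)
      case zero
      have "T.tm (T.pt (\<iota> r * x ^ i) (\<iota> r' * x ^ j)) 0 = 0"
        using T.tm_pt[of "\<iota> r * x ^ i" "\<iota> r' * x ^ j" 0 0] by simp
      then show ?case by (simp add: G_def mono_span_zero tcoord_zero twist_point)
    next
      case (gen s s' k l)
      then show ?case unfolding G_def
        using monomial_mult_top[OF _ _ \<open>(i, j) \<in> lex_below b (m, n)\<close> gen] R.\<epsilon>_point by blast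
    next
      case (add v w)
      then show ?case by (auto simp: G_def T.tm_add_right mono_span_TS mono_span_add tcoord_add twist_point distrib_left)
    qed
  next
    case (add v w)
    then show ?case using mono_span_TS[OF u] by (auto simp: G_def T.tm_add_left mono_span_add tcoord_add distrib_right)
  qed
  then show "T.tm t u \<in> mono_span (lex_below b (m + m', n + n'))"
    "p \<in> RP \<Longrightarrow> h \<in> RP \<Longrightarrow> tcoord (m + m', n + n') p h (T.tm t u) = tcoord (m, n) p h t * tcoord (m', n') (twist m p) (twist n h) u"
    by (auto simp: G_def)
qed

lemma \<Delta>_\<iota>: "\<Delta> (\<iota> r) = tensor_map sR sR sT sT \<iota> \<iota> (\<Delta>R r)"
  using ext by (simp add: hopf_extension_def)

lemma \<epsilon>_\<iota>: "\<epsilon> (\<iota> r) = \<epsilon>R r"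
  using ext by (simp add: hopf_extension_def)

lemma \<iota>\<iota>_bilinear: "bilinear_map sR sR fun_scale (\<lambda>a b. T.pt (\<iota> a) (\<iota> b))"
  by (rule bilinear_mapI[OF R.V R.V vector_space_fun_scale])
    (simp_all add: \<iota>_add \<iota>_scale T.pt_add_left T.pt_add_right T.pt_scale_left T.pt_scale_right)

lemma \<iota>\<iota>_pt: "tensor_map sR sR sT sT \<iota> \<iota> (R.pt a b) = T.pt (\<iota> a) (\<iota> b)"
  by (rule tensor_map_pure[OF \<iota>_linear \<iota>_linear])

lemma \<iota>\<iota>_linear: "Vector_Spaces.linear fun_scale fun_scale (tensor_map sR sR sT sT \<iota> \<iota>)"
  unfolding tensor_map_def by (rule R.lift_linear[OF \<iota>\<iota>_bilinear])

lemma \<iota>\<iota>_mono_span: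
  assumes "w \<in> R.TS" shows "tensor_map sR sR sT sT \<iota> \<iota> w \<in> mono_span {(0, 0)}"
  using assms
proof (induction rule: R.TS_induct)
  case (pure a b)
  show ?case using mono_span_gen[of 0 0 "{(0, 0)}" a b] by (simp add: \<iota>\<iota>_pt)
qed (simp add: linear_addD[OF \<iota>\<iota>_linear] mono_span_add)

lemma \<iota>\<iota>_tcoord:
  assumes "w \<in> R.TS" and ph: "p \<in> RP" "h \<in> RP"
  shows "tcoord (0, 0) p h (tensor_map sR sR sT sT \<iota> \<iota> w) = R.tensor_fun p h w"
  using assms(1)
proof (induction rule: R.TS_induct)
  case (pure a b)
  show ?case by (simp add: \<iota>\<iota>_pt tcoord_pt[OF ph] R.tensor_fun_pt pointsD[OF ph(1)] pointsD[OF ph(2)])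
qed (simp add: linear_addD[OF \<iota>\<iota>_linear] tcoord_add[OF ph]
   linear_addD[OF R.tensor_fun_linear[OF pointsD(1)[OF ph(1)] pointsD(1)[OF ph(2)]]])

lemma \<Delta>\<iota>_mono_span: "\<Delta> (\<iota> r) \<in> mono_span (lex_below b (0, 0))"
  using \<iota>\<iota>_mono_span[OF R.comult_in] mono_span_mono[of "{(0, 0)}" "lex_below b (0, 0)"] by (auto simp: \<Delta>_\<iota> lex_below_def)

lemma \<Delta>\<iota>_tcoord: "p \<in> RP \<Longrightarrow> h \<in> RP \<Longrightarrow> tcoord (0, 0) p h (\<Delta> (\<iota> r)) = R.conv p h r"
  by (simp add: \<Delta>_\<iota> \<iota>\<iota>_tcoord R.comult_in R.conv_def)

text \<open>If \<open>v\<close> is the leading coefficient of a tensor, in degree \<open>(m, q)\<close>, then this product of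
  twists of \<open>v\<close> is the leading coefficient of its \<open>n\<close>-th power.\<close>
fun lead_power :: "(('r \<Rightarrow> 'k) \<Rightarrow> ('r \<Rightarrow> 'k) \<Rightarrow> 'k) \<Rightarrow> nat \<Rightarrow> nat \<Rightarrow> nat \<Rightarrow> ('r \<Rightarrow> 'k) \<Rightarrow> ('r \<Rightarrow> 'k) \<Rightarrow> 'k" where
  "lead_power v m q 0 p h = 1"
| "lead_power v m q (Suc n) p h = v p h * lead_power v m q n (twist m p) (twist q h)"

abbreviation comult_coeff where "comult_coeff s \<equiv> \<lambda>p h. tcoord s p h (\<Delta> x)"

lemma \<Delta>_power_top:
  assumes "\<Delta> x \<in> mono_span (lex_below b (m, q))"
  shows "\<Delta> (x ^ n) \<in> mono_span (lex_below b (m * n, q * n)) \<and>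
    (\<forall>p\<in>RP. \<forall>h\<in>RP. tcoord (m * n, q * n) p h (\<Delta> (x ^ n)) = lead_power (comult_coeff (m, q)) m q n p h)"
proof (induction n)
  case 0
  have e: "\<Delta> (x ^ 0) = T.pt (\<iota> 1 * x ^ 0) (\<iota> 1 * x ^ 0)" by (simp add: T.comult_one)
  have "(0, 0) \<in> lex_below b (m * 0, q * 0)" by (simp add: lex_below_def)
  from mono_span_gen[OF this] show ?case unfolding e by (simp add: tcoord_gen pointsD del: \<iota>_one power_0)
next
  case (Suc n)
  have "\<Delta> (x ^ Suc n) = T.tm (\<Delta> x) (\<Delta> (x ^ n))" by (simp add: T.comult_mult)
  then show ?case
    using mono_span_mult_top[OF assms, where m' = "m * n" and n' = "q * n" and u = "\<Delta> (x ^ n)"] Suc by (auto simp: twist_point)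
qed

lemma \<Delta>_mon_top:
  assumes "\<Delta> x \<in> mono_span (lex_below b (m, q))"
  shows "\<Delta> (\<iota> r * x ^ n) \<in> mono_span (lex_below b (m * n, q * n))"
    "p \<in> RP \<Longrightarrow> h \<in> RP \<Longrightarrow> tcoord (m * n, q * n) p h (\<Delta> (\<iota> r * x ^ n)) = R.conv p h r * lead_power (comult_coeff (m, q)) m q n p h"
proof -
  note pw = \<Delta>_power_top[OF assms, of n]
  note top = mono_span_mult_top[OF \<Delta>\<iota>_mono_span, where m' = "m * n" and n' = "q * n" and u = "\<Delta> (x ^ n)" and b = b and r1 = r]
  show "\<Delta> (\<iota> r * x ^ n) \<in> mono_span (lex_below b (m * n, q * n))"
    using top(1) pw by (simp add: T.comult_mult)
  show "p \<in> RP \<Longrightarrow> h \<in> RP \<Longrightarrow> tcoord (m * n, q * n) p h (\<Delta> (\<iota> r * x ^ n)) = R.conv p h r * lead_power (comult_coeff (m, q)) m q n p h"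
    using top(2)[of p h] pw by (simp add: T.comult_mult \<Delta>\<iota>_tcoord twist_def)
qed

section \<open>Separately regular functions\<close>

definition sep_regular :: "(('r \<Rightarrow> 'k) \<Rightarrow> ('r \<Rightarrow> 'k) \<Rightarrow> 'k) \<Rightarrow> bool" where
  "sep_regular F \<longleftrightarrow> (\<forall>p\<in>RP. \<exists>r. \<forall>h\<in>RP. F p h = h r) \<and> (\<forall>h\<in>RP. \<exists>r. \<forall>p\<in>RP. F p h = p r)"

definition nonvanishing :: "(('r \<Rightarrow> 'k) \<Rightarrow> ('r \<Rightarrow> 'k) \<Rightarrow> 'k) \<Rightarrow> bool" where
  "nonvanishing F \<longleftrightarrow> (\<exists>p\<in>RP. \<exists>h\<in>RP. F p h \<noteq> 0)"

lemma sep_regular_mult: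
  assumes "sep_regular F" "sep_regular G" shows "sep_regular (\<lambda>p h. F p h * G p h)"
  unfolding sep_regular_def
proof (intro conjI ballI)
  fix p assume p: "p \<in> RP"
  obtain r s where "\<forall>h\<in>RP. F p h = h r" "\<forall>h\<in>RP. G p h = h s" using assms p unfolding sep_regular_def by metis
  then show "\<exists>r. \<forall>h\<in>RP. F p h * G p h = h r" by (intro exI[of _ "r * s"]) (simp add: pointsD)
next
  fix h assume h: "h \<in> RP"
  obtain r s where "\<forall>p\<in>RP. F p h = p r" "\<forall>p\<in>RP. G p h = p s" using assms h unfolding sep_regular_def by metis
  then show "\<exists>r. \<forall>p\<in>RP. F p h * G p h = p r" by (intro exI[of _ "r * s"]) (simp add: pointsD)
qed

lemma points_separate_prod:
  assumes "p \<in> RP" "p r \<noteq> 0" "q \<in> RP" "q s \<noteq> 0"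
  shows "\<exists>h\<in>RP. h r \<noteq> 0 \<and> h s \<noteq> 0"
proof -
  have "r \<noteq> 0" "s \<noteq> 0" using assms by (auto simp: pointsD)
  then obtain h where "h \<in> RP" "h (r * s) \<noteq> 0" using R.points_separate[of "r * s"] by auto
  then show ?thesis by (intro bexI[of _ h]) (auto simp: pointsD)
qed

text \<open>Fix \<open>h\<^sub>0\<close> and \<open>h\<^sub>1\<close> with \<open>F(\<cdot>, h\<^sub>0)\<close> and \<open>G(\<cdot>, h\<^sub>1)\<close> nonzero. As \<open>R\<close> is a domain, both are
  nonzero at a common \<open>p\<close>; then \<open>F(p, \<cdot>)\<close> and \<open>G(p, \<cdot>)\<close> are both nonzero at a common \<open>h\<close>. In
  geometric terms, \<open>G \<times> G\<close> is irreducible because \<open>G\<close> is.\<close>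
lemma nonvanishing_mult:
  assumes "sep_regular F" "sep_regular G" "nonvanishing F" "nonvanishing G" shows "nonvanishing (\<lambda>p h. F p h * G p h)"
proof -
  obtain p0 h0 where 0: "p0 \<in> RP" "h0 \<in> RP" "F p0 h0 \<noteq> 0" using assms(3) by (auto simp: nonvanishing_def)
  obtain p1 h1 where 1: "p1 \<in> RP" "h1 \<in> RP" "G p1 h1 \<noteq> 0" using assms(4) by (auto simp: nonvanishing_def)
  obtain r where r: "\<forall>p\<in>RP. F p h0 = p r" using assms(1) 0 unfolding sep_regular_def by blast
  obtain s where s: "\<forall>p\<in>RP. G p h1 = p s" using assms(2) 1 unfolding sep_regular_def by blast
  obtain p where p: "p \<in> RP" "F p h0 \<noteq> 0" "G p h1 \<noteq> 0"
    using points_separate_prod[of p0 r p1 s] 0 1 r s by auto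
  obtain r' where r': "\<forall>h\<in>RP. F p h = h r'" using assms(1) p unfolding sep_regular_def by blast
  obtain s' where s': "\<forall>h\<in>RP. G p h = h s'" using assms(2) p unfolding sep_regular_def by blast
  obtain h where "h \<in> RP" "F p h \<noteq> 0" "G p h \<noteq> 0"
    using points_separate_prod[of h0 r' h1 s'] 0 1 p r' s' by auto
  then show ?thesis using p(1) unfolding nonvanishing_def by (metis no_zero_divisors)
qed

lemma sep_regular_twist:
  assumes "sep_regular F" shows "sep_regular (\<lambda>p h. F (twist m p) (twist n h))"
  unfolding sep_regular_def
proof (intro conjI ballI)
  fix p assume "p \<in> RP"
  then obtain r where r: "\<forall>h\<in>RP. F (twist m p) h = h r" using assms twist_point unfolding sep_regular_def by metis
  then show "\<exists>r. \<forall>h\<in>RP. F (twist m p) (twist n h) = h r"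
    by (intro exI[of _ "(\<sigma> ^^ n) r"]) (simp add: twist_point, simp add: twist_def)
next
  fix h assume "h \<in> RP"
  then obtain r where r: "\<forall>p\<in>RP. F p (twist n h) = p r" using assms twist_point unfolding sep_regular_def by metis
  then show "\<exists>r. \<forall>p\<in>RP. F (twist m p) (twist n h) = p r"
    by (intro exI[of _ "(\<sigma> ^^ m) r"]) (simp add: twist_point, simp add: twist_def)
qed

lemma nonvanishing_twist: "nonvanishing F \<Longrightarrow> nonvanishing (\<lambda>p h. F (twist m p) (twist n h))"
  unfolding nonvanishing_def by (metis twist_surj)

text \<open>The source of separate regularity: fixing one of the two points in a coefficient of a tensor
  leaves the evaluation of an element of \<open>R\<close> at the other.\<close>
lemma tensor_fun_regular:
  assumes t: "t \<in> T.TS" and h: "h \<in> RP" and F: "Vector_Spaces.linear sT sR F" and G: "Vector_Spaces.linear sT sR G"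
  shows "T.tensor_fun (\<lambda>a. h (F a)) (\<lambda>b. h (G b)) t = h (tensor_lift sT sT sR (\<lambda>a b. F a * G b) t)"
proof -
  have "bilinear_map sT sT sR (\<lambda>a b. F a * G b)"
    by (rule bilinear_mapI[OF T.V T.V R.V])
     (simp_all add: linear_addD[OF F] linear_scaleD[OF F] linear_addD[OF G] linear_scaleD[OF G] distrib_left distrib_right
        R.scale_mult_left[symmetric] R.scale_mult_right[symmetric])
  from T.linear_lift[OF t this pointsD(1)[OF h]] show ?thesis
    unfolding T.tensor_fun_def by (simp add: pointsD[OF h])
qed

lemma scalar_linear: "p \<in> RP \<Longrightarrow> Vector_Spaces.linear sT sR (\<lambda>a. sR (p (coord i a)) 1)"
  by (rule linearI[OF T.V R.V])
    (simp_all add: linear_addD[OF coord_linear] linear_scaleD[OF coord_linear] pointsD R.scale_left_distrib)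

lemma sep_regular_tcoord:
  assumes t: "t \<in> T.TS" shows "sep_regular (\<lambda>p h. tcoord s p h t)"
  unfolding sep_regular_def
proof (intro conjI ballI exI)
  fix p h assume ph: "p \<in> RP" "h \<in> RP"
  show "tcoord s p h t = h (tensor_lift sT sT sR (\<lambda>a b. sR (p (coord (fst s) a)) 1 * coord (snd s) b) t)"
    using tensor_fun_regular[OF t ph(2) scalar_linear[OF ph(1)] coord_linear] by (simp add: tcoord_def pointsD[OF ph(2)])
next
  fix p h assume ph: "h \<in> RP" "p \<in> RP"
  show "tcoord s p h t = p (tensor_lift sT sT sR (\<lambda>a b. coord (fst s) a * sR (h (coord (snd s) b)) 1) t)"
    using tensor_fun_regular[OF t ph(2) coord_linear scalar_linear[OF ph(1)]] by (simp add: tcoord_def pointsD[OF ph(2)])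
qed

lemma lead_power_sep_regular_nonvanishing:
  assumes "sep_regular v" "nonvanishing v"
  shows "sep_regular (lead_power v m q n) \<and> nonvanishing (lead_power v m q n)"
proof (induction n)
  case 0
  have "sep_regular (\<lambda>p h. 1)" unfolding sep_regular_def by (auto intro!: exI[of _ 1] simp: pointsD)
  moreover have "nonvanishing (\<lambda>p h. 1)" using R.\<epsilon>_point by (auto simp: nonvanishing_def)
  ultimately show ?case by simp
next
  case (Suc n)
  have "lead_power v m q (Suc n) = (\<lambda>p h. v p h * lead_power v m q n (twist m p) (twist q h))" by (auto simp: fun_eq_iff)
  then show ?case
    using sep_regular_mult[OF assms(1) sep_regular_twist[of "lead_power v m q n" m q]] nonvanishing_mult[OF assms(1) sep_regular_twist[of "lead_power v m q n" m q] assms(2) nonvanishing_twist] Suc by simp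
qed

end

section \<open>The Galois maps\<close>

context tensor_algebras
begin

lemma tm_linear_left: "v \<in> TS \<Longrightarrow> Vector_Spaces.linear fun_scale fun_scale (\<lambda>u. tm u v)"
  unfolding tensor_mult_def by (rule lift_linear[OF tm_outer])

lemma tm_pt_linear:
  assumes "u \<in> TS" shows "Vector_Spaces.linear sB fun_scale (\<lambda>d. tm u (pt c d))"
  unfolding tm_pt_right[OF assms]
proof (rule lift_param_linear[OF assms])
  show "bilinear_map sA sB fun_scale (\<lambda>a b. pt (a * c) (b * d))" for d
    by (rule bilinear_mapI[OF VA VB vector_space_fun_scale])
     (simp_all add: distrib_right kA.scale_mult_left[symmetric] kB.scale_mult_left[symmetric]
       pt_add_left pt_add_right pt_scale_left pt_scale_right)
  show "Vector_Spaces.linear sB fun_scale (\<lambda>d. pt (a * c) (b * d))" for a b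
    by (rule linearI[OF VB vector_space_fun_scale])
      (simp_all add: distrib_left kB.scale_mult_right[symmetric] pt_add_right pt_scale_right)
qed

end

context hopf_algebra
begin

definition galois_left :: "('a, 'a, 'k) tensor \<Rightarrow> ('a, 'a, 'k) tensor" where
  "galois_left = tensor_lift scale scale fun_scale (\<lambda>a b. tm (\<Delta> a) (pt 1 b))"

definition galois_right :: "('a, 'a, 'k) tensor \<Rightarrow> ('a, 'a, 'k) tensor" where
  "galois_right = tensor_lift scale scale fun_scale (\<lambda>a b. tm (pt a 1) (\<Delta> b))"

lemma galois_left_bilinear: "bilinear_map scale scale fun_scale (\<lambda>a b. tm (\<Delta> a) (pt 1 b))"
  unfolding bilinear_map_def
proof (intro conjI allI)
  show "Vector_Spaces.linear scale fun_scale (\<lambda>a. tm (\<Delta> a) (pt 1 b))" for b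
    using tm_linear_left[of "pt 1 b"] comult_linear by (simp add: Vector_Spaces.linear_iff)
qed (rule tm_pt_linear[OF comult_in])

lemma galois_right_bilinear: "bilinear_map scale scale fun_scale (\<lambda>a b. tm (pt a 1) (\<Delta> b))"
  unfolding bilinear_map_def
proof (intro conjI allI)
  show "Vector_Spaces.linear scale fun_scale (\<lambda>a. tm (pt a 1) (\<Delta> b))" for b
    using tm_linear_left[OF comult_in, of b] pt_bilinear by (simp add: bilinear_map_def Vector_Spaces.linear_iff)
  show "Vector_Spaces.linear scale fun_scale (\<lambda>b. tm (pt a 1) (\<Delta> b))" for a
    unfolding tm_pt_left[OF comult_in]
    using lift_linear[OF tm_inner[of a 1]] comult_linear by (simp add: Vector_Spaces.linear_iff)
qed

lemmas galois_left_linear = lift_linear[OF galois_left_bilinear, folded galois_left_def]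
  and galois_left_pt = lift_pt[OF galois_left_bilinear, folded galois_left_def]
  and galois_right_linear = lift_linear[OF galois_right_bilinear, folded galois_right_def]
  and galois_right_pt = lift_pt[OF galois_right_bilinear, folded galois_right_def]

text \<open>A preimage of \<open>z \<otimes> 1\<close> is \<open>\<Sum> z\<^sub>1 \<otimes> S(z\<^sub>2)\<close>: its image is \<open>\<Sum> z\<^sub>1 \<otimes> z\<^sub>2 S(z\<^sub>3)\<close>.\<close>
lemma galois_left_surj: "\<exists>u\<in>TS. galois_left u = pt z 1"
proof -
  have b: "bilinear_map scale scale fun_scale (\<lambda>a b. pt a (S b))"
    by (rule bilinear_mapI[OF V V vector_space_fun_scale])
      (simp_all add: pt_add_left pt_add_right pt_scale_left pt_scale_right
       linear_addD[OF antipode_linear] linear_scaleD[OF antipode_linear])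
  define u where "u = tensor_lift scale scale fun_scale (\<lambda>a b. pt a (S b)) (\<Delta> z)"
  have u: "u \<in> TS" unfolding u_def by (rule lift_in_subspace[OF comult_in b TS_subspace]) simp
  have tri: "trilinear_map scale fun_scale (\<lambda>a b c. pt a (b * S c))"
    unfolding trilinear_map_def by (intro conjI allI linearI V vector_space_fun_scale)
      (simp_all add: pt_add_left pt_add_right pt_scale_left pt_scale_right distrib_left distrib_right
       linear_addD[OF antipode_linear] linear_scaleD[OF antipode_linear]
       scale_mult_left[symmetric] scale_mult_right[symmetric])
  have pl: "Vector_Spaces.linear scale fun_scale (pt a)" "Vector_Spaces.linear scale fun_scale (\<lambda>b. pt b a)" for a
    using pt_bilinear by (simp_all add: bilinear_map_def)
  have "galois_left u = tensor_lift scale scale fun_scale (\<lambda>a b. tm (\<Delta> a) (pt 1 (S b))) (\<Delta> z)"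
    unfolding u_def linear_lift[OF comult_in b galois_left_linear] galois_left_pt ..
  also have "\<dots> = tensor_lift scale scale fun_scale (\<lambda>a b. tensor_lift scale scale fun_scale (\<lambda>c d. pt c (d * S b)) (\<Delta> a)) (\<Delta> z)"
    unfolding tm_pt_right[OF comult_in] by simp
  also have "\<dots> = tensor_lift scale scale fun_scale (\<lambda>a b. tensor_lift scale scale fun_scale (\<lambda>c d. pt a (c * S d)) (\<Delta> b)) (\<Delta> z)"
    by (rule coassoc_trilinear[OF tri])
  also have "\<dots> = tensor_lift scale scale fun_scale (\<lambda>a b. pt a (scale (\<epsilon> b) 1)) (\<Delta> z)"
    unfolding linear_lift[OF comult_in S_bil_r pl(1), symmetric] antipode_right ..
  also have "\<dots> = tensor_lift scale scale fun_scale (\<lambda>a b. pt (scale (\<epsilon> b) a) 1) (\<Delta> z)"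
    by (simp add: pt_scale_left pt_scale_right)
  also have "\<dots> = pt z 1"
    unfolding linear_lift[OF comult_in slice_r[OF pointsD(1)[OF \<epsilon>_point]] pl(2), symmetric] counit_right ..
  finally show ?thesis using u by blast
qed

text \<open>A preimage of \<open>1 \<otimes> z\<close> is \<open>\<Sum> S(z\<^sub>1) \<otimes> z\<^sub>2\<close>.\<close>
lemma galois_right_surj: "\<exists>u\<in>TS. galois_right u = pt 1 z"
proof -
  have b: "bilinear_map scale scale fun_scale (\<lambda>a b. pt (S a) b)"
    by (rule bilinear_mapI[OF V V vector_space_fun_scale])
      (simp_all add: pt_add_left pt_add_right pt_scale_left pt_scale_right
       linear_addD[OF antipode_linear] linear_scaleD[OF antipode_linear])
  define u where "u = tensor_lift scale scale fun_scale (\<lambda>a b. pt (S a) b) (\<Delta> z)"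
  have u: "u \<in> TS" unfolding u_def by (rule lift_in_subspace[OF comult_in b TS_subspace]) simp
  have tri: "trilinear_map scale fun_scale (\<lambda>a b c. pt (S a * b) c)"
    unfolding trilinear_map_def by (intro conjI allI linearI V vector_space_fun_scale)
      (simp_all add: pt_add_left pt_add_right pt_scale_left pt_scale_right distrib_left distrib_right
       linear_addD[OF antipode_linear] linear_scaleD[OF antipode_linear]
       scale_mult_left[symmetric] scale_mult_right[symmetric])
  have pl: "Vector_Spaces.linear scale fun_scale (pt a)" "Vector_Spaces.linear scale fun_scale (\<lambda>b. pt b a)" for a
    using pt_bilinear by (simp_all add: bilinear_map_def)
  have "galois_right u = tensor_lift scale scale fun_scale (\<lambda>a b. tm (pt (S a) 1) (\<Delta> b)) (\<Delta> z)"
    unfolding u_def linear_lift[OF comult_in b galois_right_linear] galois_right_pt ..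
  also have "\<dots> = tensor_lift scale scale fun_scale (\<lambda>a b. tensor_lift scale scale fun_scale (\<lambda>c d. pt (S a * c) d) (\<Delta> b)) (\<Delta> z)"
    unfolding tm_pt_left[OF comult_in] by simp
  also have "\<dots> = tensor_lift scale scale fun_scale (\<lambda>a b. tensor_lift scale scale fun_scale (\<lambda>c d. pt (S c * d) b) (\<Delta> a)) (\<Delta> z)"
    by (rule coassoc_trilinear[OF tri, symmetric])
  also have "\<dots> = tensor_lift scale scale fun_scale (\<lambda>a b. pt (scale (\<epsilon> a) 1) b) (\<Delta> z)"
    unfolding linear_lift[OF comult_in S_bil_l pl(2), symmetric] antipode_left ..
  also have "\<dots> = tensor_lift scale scale fun_scale (\<lambda>a b. pt 1 (scale (\<epsilon> a) b)) (\<Delta> z)"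
    by (simp add: pt_scale_left pt_scale_right)
  also have "\<dots> = pt 1 z"
    unfolding linear_lift[OF comult_in slice_l[OF pointsD(1)[OF \<epsilon>_point]] pl(1), symmetric] counit_left ..
  finally show ?thesis using u by blast
qed

end

context hopf_ore
begin

text \<open>A monomial with exponents \<open>(i, j)\<close> is mapped to a tensor with leading exponent
  \<open>(m i, q i + j)\<close>. For \<open>m \<noteq> 0\<close> this map of exponents preserves the lexicographic order strictly, so
  nothing can cancel the image of the leading monomial.\<close>
lemma galois_left_top:
  assumes dx: "\<Delta> x \<in> mono_span (lex_below True (m, q))" and m: "m \<noteq> 0"
    and t: "t \<in> mono_span (lex_below True (n, N))" and ph: "p \<in> RP" "h \<in> RP"
  shows "tcoord (m * n, q * n + N) p h (T.galois_left t)
    = lead_power (comult_coeff (m, q)) m q n p h * tcoord (n, N) (R.conv p h) (twist (q * n) h) t"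
  using t
proof (induction t rule: mono_span_induct)
  case zero
  then show ?case by (simp add: linear_zeroD[OF T.galois_left_linear] tcoord_zero ph twist_point R.conv_point)
next
  case (gen r r' i j)
  have one: "T.pt 1 (\<iota> r' * x ^ j) = T.pt (\<iota> 1 * x ^ 0) (\<iota> r' * x ^ j)" by simp
  have g: "T.galois_left (T.pt (\<iota> r * x ^ i) (\<iota> r' * x ^ j)) = T.tm (\<Delta> (\<iota> r * x ^ i)) (T.pt (\<iota> 1 * x ^ 0) (\<iota> r' * x ^ j))"
    by (simp only: T.galois_left_pt one)
  have in2: "T.pt (\<iota> 1 * x ^ 0) (\<iota> r' * x ^ j) \<in> mono_span (lex_below True (0, j))"
    by (rule mono_span_gen) (simp add: lex_below_def)
  note top = mono_span_mult_top[OF \<Delta>_mon_top(1)[OF dx, of r i] in2]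
  show ?case
  proof (cases "(i, j) = (n, N)")
    case True
    then have e: "i = n" "j = N" by auto
    have "tcoord (m * n, q * n + N) p h (T.galois_left (T.pt (\<iota> r * x ^ i) (\<iota> r' * x ^ j)))
       = tcoord (m * n, q * n) p h (\<Delta> (\<iota> r * x ^ n)) * tcoord (0, N) (twist (m * n) p) (twist (q * n) h) (T.pt (\<iota> 1 * x ^ 0) (\<iota> r' * x ^ N))"
      using top(2)[OF ph] g unfolding e by simp
    also have "\<dots> = (R.conv p h r * lead_power (comult_coeff (m, q)) m q n p h) * twist (q * n) h r'"
      by (simp add: \<Delta>_mon_top(2)[OF dx ph] tcoord_gen twist_point ph pointsD[OF twist_point[OF ph(1)]] del: \<iota>_one power_0)
    also have "\<dots> = lead_power (comult_coeff (m, q)) m q n p h * tcoord (n, N) (R.conv p h) (twist (q * n) h) (T.pt (\<iota> r * x ^ i) (\<iota> r' * x ^ j))"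
      by (simp add: e tcoord_gen twist_point ph R.conv_point)
    finally show ?thesis .
  next
    case False
    then have "(m * n, q * n + N) \<notin> lex_below True (m * i + 0, q * i + j)"
      using gen m by (auto simp: lex_below_def lex_less_def)
    from mono_span_tcoord_zero[OF top(1) this ph] show ?thesis
      unfolding g using False by (auto simp: tcoord_gen twist_point ph R.conv_point simp del: \<iota>_one power_0)
  qed
next
  case (add u w)
  then show ?case by (simp add: linear_addD[OF T.galois_left_linear] tcoord_add ph twist_point R.conv_point distrib_left)
qed

text \<open>The mirror image: exponents \<open>(j, i)\<close> are mapped to \<open>(j + m i, q i)\<close>, which for \<open>q \<noteq> 0\<close> is
  compatible with the order that compares second exponents first.\<close>
lemma galois_right_top:
  assumes dx: "\<Delta> x \<in> mono_span (lex_below False (m, q))" and q: "q \<noteq> 0"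
    and t: "t \<in> mono_span (lex_below False (N, n))" and ph: "p \<in> RP" "h \<in> RP"
  shows "tcoord (N + m * n, q * n) p h (T.galois_right t)
    = lead_power (comult_coeff (m, q)) m q n (twist N p) h * tcoord (N, n) p (R.conv (twist N p) h) t"
  using t
proof (induction t rule: mono_span_induct)
  case zero
  then show ?case by (simp add: linear_zeroD[OF T.galois_right_linear] tcoord_zero ph twist_point R.conv_point)
next
  case (gen r' r j i)
  have one: "T.pt (\<iota> r' * x ^ j) 1 = T.pt (\<iota> r' * x ^ j) (\<iota> 1 * x ^ 0)" by simp
  have g: "T.galois_right (T.pt (\<iota> r' * x ^ j) (\<iota> r * x ^ i)) = T.tm (T.pt (\<iota> r' * x ^ j) (\<iota> 1 * x ^ 0)) (\<Delta> (\<iota> r * x ^ i))"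
    by (simp only: T.galois_right_pt one)
  have in2: "T.pt (\<iota> r' * x ^ j) (\<iota> 1 * x ^ 0) \<in> mono_span (lex_below False (j, 0))"
    by (rule mono_span_gen) (simp add: lex_below_def)
  note top = mono_span_mult_top[OF in2 \<Delta>_mon_top(1)[OF dx, of r i]]
  show ?case
  proof (cases "(j, i) = (N, n)")
    case True
    then have e: "i = n" "j = N" by auto
    have s0: "twist 0 h = h" by (simp add: twist_def)
    have "tcoord (N + m * n, q * n) p h (T.galois_right (T.pt (\<iota> r' * x ^ j) (\<iota> r * x ^ i)))
       = tcoord (N, 0) p h (T.pt (\<iota> r' * x ^ N) (\<iota> 1 * x ^ 0)) * tcoord (m * n, q * n) (twist N p) h (\<Delta> (\<iota> r * x ^ n))"
      using top(2)[OF ph] g unfolding e by (simp add: s0)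
    also have "\<dots> = p r' * (R.conv (twist N p) h r * lead_power (comult_coeff (m, q)) m q n (twist N p) h)"
      by (simp add: \<Delta>_mon_top(2)[OF dx twist_point[OF ph(1)] ph(2)] tcoord_gen twist_point ph pointsD[OF ph(2)] del: \<iota>_one power_0)
    also have "\<dots> = lead_power (comult_coeff (m, q)) m q n (twist N p) h * tcoord (N, n) p (R.conv (twist N p) h) (T.pt (\<iota> r' * x ^ j) (\<iota> r * x ^ i))"
      by (simp add: e tcoord_gen twist_point ph R.conv_point)
    finally show ?thesis .
  next
    case False
    then have "(N + m * n, q * n) \<notin> lex_below False (j + m * i, 0 + q * i)"
      using gen q by (auto simp: lex_below_def lex_less_def)
    from mono_span_tcoord_zero[OF top(1) this ph] show ?thesis
      unfolding g using False by (auto simp: tcoord_gen twist_point ph R.conv_point simp del: \<iota>_one power_0)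
  qed
next
  case (add u w)
  then show ?case by (simp add: linear_addD[OF T.galois_right_linear] tcoord_add ph twist_point R.conv_point distrib_left)
qed

lemma lin_point: "p \<in> RP \<Longrightarrow> R.lin p"
  by (rule pointsD(1))

lemma ltrans_coord_linear: "p \<in> RP \<Longrightarrow> Vector_Spaces.linear sT sR (\<lambda>a. R.ltrans p (coord i a))"
  using coord_linear[of i] R.ltrans_linear[OF lin_point] by (simp add: Vector_Spaces.linear_iff)

lemma rtrans_coord_linear: "p \<in> RP \<Longrightarrow> Vector_Spaces.linear sT sR (\<lambda>a. (\<sigma> ^^ k) (R.rtrans p (coord i a)))"
  using coord_linear[of i] R.rtrans_linear[OF lin_point] by (simp add: Vector_Spaces.linear_iff \<sigma>n_simps)

lemma \<sigma>_coord_linear: "Vector_Spaces.linear sT sR (\<lambda>a. (\<sigma> ^^ k) (coord i a))"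
  using coord_linear[of i] by (simp add: Vector_Spaces.linear_iff \<sigma>n_simps)

lemma sep_regular_tcoord_conv_left:
  assumes t: "t \<in> T.TS" shows "sep_regular (\<lambda>p h. tcoord s (R.conv p h) (twist k h) t)"
  unfolding sep_regular_def
proof (intro conjI ballI exI)
  fix p h assume ph: "p \<in> RP" "h \<in> RP"
  show "tcoord s (R.conv p h) (twist k h) t
     = h (tensor_lift sT sT sR (\<lambda>a b. R.ltrans p (coord (fst s) a) * (\<sigma> ^^ k) (coord (snd s) b)) t)"
    unfolding tensor_fun_regular[OF t ph(2) ltrans_coord_linear[OF ph(1)] \<sigma>_coord_linear, symmetric]
    by (simp add: tcoord_def R.apply_ltrans[OF lin_point lin_point] ph twist_def)
next
  fix p h assume ph: "h \<in> RP" "p \<in> RP"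
  show "tcoord s (R.conv p h) (twist k h) t
     = p (tensor_lift sT sT sR (\<lambda>a b. (\<sigma> ^^ 0) (R.rtrans h (coord (fst s) a)) * sR (twist k h (coord (snd s) b)) 1) t)"
    unfolding tensor_fun_regular[OF t ph(2) rtrans_coord_linear[OF ph(1)] scalar_linear[OF twist_point[OF ph(1)]], symmetric]
    by (simp add: tcoord_def R.apply_rtrans[OF lin_point lin_point] ph pointsD[OF ph(2)])
qed

lemma sep_regular_tcoord_conv_right:
  assumes t: "t \<in> T.TS" shows "sep_regular (\<lambda>p h. tcoord s p (R.conv (twist k p) h) t)"
  unfolding sep_regular_def
proof (intro conjI ballI exI)
  fix p h assume ph: "p \<in> RP" "h \<in> RP"
  show "tcoord s p (R.conv (twist k p) h) t
     = h (tensor_lift sT sT sR (\<lambda>a b. sR (p (coord (fst s) a)) 1 * R.ltrans (twist k p) (coord (snd s) b)) t)"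
    unfolding tensor_fun_regular[OF t ph(2) scalar_linear[OF ph(1)] ltrans_coord_linear[OF twist_point[OF ph(1)]], symmetric]
    by (simp add: tcoord_def R.apply_ltrans[OF lin_point lin_point] ph twist_point pointsD[OF ph(2)])
next
  fix p h assume ph: "h \<in> RP" "p \<in> RP"
  have "p ((\<sigma> ^^ k) (R.rtrans h r)) = R.conv (twist k p) h r" for r
    using R.apply_rtrans[OF lin_point[OF twist_point[OF ph(2)]] lin_point[OF ph(1)], of k r] by (simp add: twist_def)
  then show "tcoord s p (R.conv (twist k p) h) t
     = p (tensor_lift sT sT sR (\<lambda>a b. coord (fst s) a * (\<sigma> ^^ k) (R.rtrans h (coord (snd s) b))) t)"
    unfolding tensor_fun_regular[OF t ph(2) coord_linear rtrans_coord_linear[OF ph(1)], symmetric]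
    by (simp add: tcoord_def)
qed

abbreviation pinv where "pinv h \<equiv> \<lambda>r. h (SR r)"

lemma pinv_simps:
  assumes g: "g \<in> RP" and h: "h \<in> RP"
  shows "R.conv (R.conv g (pinv h)) h = g" "R.conv h (R.conv (pinv h) g) = g"
  using R.conv_assoc[OF lin_point[OF g] lin_point[OF R.antipode_point[OF h]] lin_point[OF h]]
    R.conv_assoc[OF lin_point[OF h] lin_point[OF R.antipode_point[OF h]] lin_point[OF g]]
  by (simp_all add: R.conv_antipode[OF h] R.conv_\<epsilon>_left R.conv_\<epsilon>_right lin_point g)

text \<open>The map \<open>(p, h) \<mapsto> (p h, h \<circ> \<sigma>\<^sup>k)\<close> is onto, with \<open>p\<close> recovered by dividing by \<open>h\<close>.\<close>
lemma nonvanishing_tcoord_conv_left: "nonvanishing (\<lambda>p h. tcoord s p h t) \<Longrightarrow> nonvanishing (\<lambda>p h. tcoord s (R.conv p h) (twist k h) t)"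
proof -
  assume "nonvanishing (\<lambda>p h. tcoord s p h t)"
  then obtain g h' where gh: "g \<in> RP" "h' \<in> RP" "tcoord s g h' t \<noteq> 0" by (auto simp: nonvanishing_def)
  obtain h where h: "h \<in> RP" "twist k h = h'" using twist_surj[OF gh(2)] by blast
  show ?thesis unfolding nonvanishing_def
    by (rule bexI[of _ "R.conv g (pinv h)"], rule bexI[OF _ h(1)])
      (simp_all add: pinv_simps gh h R.conv_point R.antipode_point)
qed

lemma nonvanishing_tcoord_conv_right: "nonvanishing (\<lambda>p h. tcoord s p h t) \<Longrightarrow> nonvanishing (\<lambda>p h. tcoord s p (R.conv (twist k p) h) t)"
proof -
  assume "nonvanishing (\<lambda>p h. tcoord s p h t)"
  then obtain p g where pg: "p \<in> RP" "g \<in> RP" "tcoord s p g t \<noteq> 0" by (auto simp: nonvanishing_def)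
  show ?thesis unfolding nonvanishing_def
    by (rule bexI[OF _ pg(1)], rule bexI[of _ "R.conv (pinv (twist k p)) g"])
      (simp_all add: pinv_simps pg twist_point R.conv_point R.antipode_point)
qed

lemma comult_variable_nonzero: "\<Delta> x \<noteq> 0"
proof
  assume "\<Delta> x = 0"
  then have "x = 0" using T.counit_left[of x] T.lift_zero[OF T.slice_l[OF pointsD(1)[OF T.\<epsilon>_point]]] by simp
  then have "coord 1 x = coord 1 0" by (rule arg_cong)
  then show False unfolding coord_x coord_zero by simp
qed

text \<open>Otherwise applying the counit to the second factor would give \<open>x \<in> R\<close>.\<close>
lemma comult_variable_not_left: "\<Delta> x \<notin> mono_span {s. fst s = 0}"
proof
  assume "\<Delta> x \<in> mono_span {s. fst s = 0}"
  note sl = T.slice_r[OF pointsD(1)[OF T.\<epsilon>_point]]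
  have "coord 1 (tensor_lift sT sT sT (\<lambda>a b. sT (\<epsilon> b) a) t) = 0" if "t \<in> mono_span {s. fst s = 0}" for t
    using that by (induction rule: mono_span_induct)
      (auto simp: T.lift_zero[OF sl] T.lift_add[OF sl] T.lift_pt[OF sl] coord_add linear_scaleD[OF coord_linear])
  from this[OF \<open>\<Delta> x \<in> _\<close>] show False by (simp add: T.counit_right)
qed

lemma comult_variable_not_right: "\<Delta> x \<notin> mono_span {s. snd s = 0}"
proof
  assume "\<Delta> x \<in> mono_span {s. snd s = 0}"
  note sl = T.slice_l[OF pointsD(1)[OF T.\<epsilon>_point]]
  have "coord 1 (tensor_lift sT sT sT (\<lambda>a b. sT (\<epsilon> a) b) t) = 0" if "t \<in> mono_span {s. snd s = 0}" for t
    using that by (induction rule: mono_span_induct)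
      (auto simp: T.lift_zero[OF sl] T.lift_add[OF sl] T.lift_pt[OF sl] coord_add linear_scaleD[OF coord_linear])
  from this[OF \<open>\<Delta> x \<in> _\<close>] show False by (simp add: T.counit_left)
qed

text \<open>The Galois map takes the leading exponent \<open>(n, N)\<close> of a preimage \<open>u\<close> of \<open>x \<otimes> 1\<close> to
  \<open>(m n, q n + N)\<close>, and the only exponent of \<open>x \<otimes> 1\<close> is \<open>(1, 0)\<close>.\<close>
lemma comult_variable_left: "\<Delta> x \<in> mono_span (lex_below True (1, 0))"
proof -
  obtain m q where top: "\<Delta> x \<in> mono_span (lex_below True (m, q))" "nonvanishing (comult_coeff (m, q))"
    using mono_span_top[OF T.comult_in comult_variable_nonzero, of True] unfolding nonvanishing_def by (metis surj_pair)
  have m: "m \<noteq> 0"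
  proof
    assume "m = 0"
    then have "lex_below True (m, q) \<subseteq> {s. fst s = 0}" by (auto simp: lex_below_def lex_less_def)
    then show False using top(1) comult_variable_not_left mono_span_mono by blast
  qed
  obtain u where u: "u \<in> T.TS" "T.galois_left u = T.pt x 1" using T.galois_left_surj by blast
  have k: "tcoord s p h (T.pt x 1) \<noteq> 0 \<Longrightarrow> s = (1, 0)" if "p \<in> RP" "h \<in> RP" for s p h
    using that by (cases s) (auto simp: tcoord_pt pointsD split: if_splits)
  have "u \<noteq> 0"
  proof
    assume "u = 0"
    then have "tcoord (1, 0) \<epsilon>R \<epsilon>R (T.pt x 1) = 0"
      using u(2) by (simp add: linear_zeroD[OF T.galois_left_linear] tcoord_zero R.\<epsilon>_point)
    then show False by (simp add: tcoord_pt R.\<epsilon>_point pointsD[OF R.\<epsilon>_point])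
  qed
  then obtain n N where nN: "u \<in> mono_span (lex_below True (n, N))" "nonvanishing (\<lambda>p h. tcoord (n, N) p h u)"
    using mono_span_top[OF u(1), of True] unfolding nonvanishing_def by (metis surj_pair)
  note lp = lead_power_sep_regular_nonvanishing[OF sep_regular_tcoord[OF T.comult_in] top(2), of m q n]
  have "nonvanishing (\<lambda>p h. lead_power (comult_coeff (m, q)) m q n p h * tcoord (n, N) (R.conv p h) (twist (q * n) h) u)"
    by (rule nonvanishing_mult[OF conjunct1[OF lp] sep_regular_tcoord_conv_left[OF u(1)] conjunct2[OF lp] nonvanishing_tcoord_conv_left[OF nN(2)]])
  then obtain p h where ph: "p \<in> RP" "h \<in> RP"
    "lead_power (comult_coeff (m, q)) m q n p h * tcoord (n, N) (R.conv p h) (twist (q * n) h) u \<noteq> 0"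
    unfolding nonvanishing_def by blast
  have "tcoord (m * n, q * n + N) p h (T.pt x 1) \<noteq> 0"
    using galois_left_top[OF top(1) m nN(1) ph(1,2)] ph(3) u(2) by simp
  from k[OF ph(1,2) this] have "m * n = 1" "q * n + N = 0" by auto
  then have "m = 1" "q = 0" by auto
  then show ?thesis using top(1) by simp
qed

lemma comult_variable_right: "\<Delta> x \<in> mono_span (lex_below False (0, 1))"
proof -
  obtain m q where top: "\<Delta> x \<in> mono_span (lex_below False (m, q))" "nonvanishing (comult_coeff (m, q))"
    using mono_span_top[OF T.comult_in comult_variable_nonzero, of False] unfolding nonvanishing_def by (metis surj_pair)
  have q: "q \<noteq> 0"
  proof
    assume "q = 0"
    then have "lex_below False (m, q) \<subseteq> {s. snd s = 0}" by (auto simp: lex_below_def lex_less_def)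
    then show False using top(1) comult_variable_not_right mono_span_mono by blast
  qed
  obtain u where u: "u \<in> T.TS" "T.galois_right u = T.pt 1 x" using T.galois_right_surj by blast
  have k: "tcoord s p h (T.pt 1 x) \<noteq> 0 \<Longrightarrow> s = (0, 1)" if "p \<in> RP" "h \<in> RP" for s p h
    using that by (cases s) (auto simp: tcoord_pt pointsD split: if_splits)
  have "u \<noteq> 0"
  proof
    assume "u = 0"
    then have "tcoord (0, 1) \<epsilon>R \<epsilon>R (T.pt 1 x) = 0"
      using u(2) by (simp add: linear_zeroD[OF T.galois_right_linear] tcoord_zero R.\<epsilon>_point)
    then show False by (simp add: tcoord_pt R.\<epsilon>_point pointsD[OF R.\<epsilon>_point])
  qed
  then obtain N n where nN: "u \<in> mono_span (lex_below False (N, n))" "nonvanishing (\<lambda>p h. tcoord (N, n) p h u)"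
    using mono_span_top[OF u(1), of False] unfolding nonvanishing_def by (metis surj_pair)
  note lp = lead_power_sep_regular_nonvanishing[OF sep_regular_tcoord[OF T.comult_in] top(2), of m q n]
  note lp' = sep_regular_twist[OF conjunct1[OF lp], of N 0] nonvanishing_twist[OF conjunct2[OF lp], of N 0]
  have s0: "twist 0 h = h" for h by (simp add: twist_def)
  have "nonvanishing (\<lambda>p h. lead_power (comult_coeff (m, q)) m q n (twist N p) (twist 0 h) * tcoord (N, n) p (R.conv (twist N p) h) u)"
    by (rule nonvanishing_mult[OF lp'(1) sep_regular_tcoord_conv_right[OF u(1)] lp'(2) nonvanishing_tcoord_conv_right[OF nN(2)]])
  then obtain p h where ph: "p \<in> RP" "h \<in> RP"
    "lead_power (comult_coeff (m, q)) m q n (twist N p) h * tcoord (N, n) p (R.conv (twist N p) h) u \<noteq> 0"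
    unfolding nonvanishing_def s0 by blast
  have "tcoord (N + m * n, q * n) p h (T.pt 1 x) \<noteq> 0"
    using galois_right_top[OF top(1) q nN(1) ph(1,2)] ph(3) u(2) by simp
  from k[OF ph(1,2) this] have "q * n = 1" "N + m * n = 0" by auto
  then have "q = 1" "m = 0" by auto
  then show ?thesis using top(1) by simp
qed

lemma comult_variable_support: "\<Delta> x \<in> mono_span {(0, 0), (0, 1), (1, 0)}"
proof -
  obtain A where A: "finite A" "\<Delta> x \<in> mono_span A" using TS_mono_span[OF T.comult_in] by blast
  show ?thesis
  proof (rule mono_span_restrict[OF A])
    fix s :: "nat \<times> nat" and p h assume s: "s \<notin> {(0, 0), (0, 1), (1, 0)}" and ph: "p \<in> RP" "h \<in> RP"
    have "s \<notin> lex_below True (1, 0) \<or> s \<notin> lex_below False (0, 1)"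
      using s by (cases s) (auto simp: lex_below_def lex_less_def)
    then show "tcoord s p h (\<Delta> x) = 0"
      using mono_span_tcoord_zero[OF comult_variable_left _ ph] mono_span_tcoord_zero[OF comult_variable_right _ ph] by blast
  qed
qed

end

section \<open>The coproduct of the variable\<close>

context hopf_ore
begin

lemma comult_variable_tcoord_zero: "s \<notin> {(0, 0), (0, 1), (1, 0)} \<Longrightarrow> p \<in> RP \<Longrightarrow> h \<in> RP \<Longrightarrow> tcoord s p h (\<Delta> x) = 0"
  by (rule mono_span_tcoord_zero[OF comult_variable_support])

lemma \<Delta>\<iota>_tcoord_zero: "s \<noteq> (0, 0) \<Longrightarrow> p \<in> RP \<Longrightarrow> h \<in> RP \<Longrightarrow> tcoord s p h (\<Delta> (\<iota> r)) = 0"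
  unfolding \<Delta>_\<iota> by (rule mono_span_tcoord_zero[OF \<iota>\<iota>_mono_span[OF R.comult_in]]) auto

lemma \<Delta>\<iota>x_tcoord_right: "p \<in> RP \<Longrightarrow> h \<in> RP \<Longrightarrow> tcoord (0, 1) p h (\<Delta> (\<iota> r * x)) = R.conv p h r * tcoord (0, 1) p h (\<Delta> x)"
  using \<Delta>_mon_top(2)[OF comult_variable_right, where p = p and h = h and r = r and n = 1] by simp

lemma \<Delta>\<iota>x_tcoord_left: "p \<in> RP \<Longrightarrow> h \<in> RP \<Longrightarrow> tcoord (1, 0) p h (\<Delta> (\<iota> r * x)) = R.conv p h r * tcoord (1, 0) p h (\<Delta> x)"
  using \<Delta>_mon_top(2)[OF comult_variable_left, where p = p and h = h and r = r and n = 1] by simp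

lemma tcoord\<Delta>_linear: "p \<in> RP \<Longrightarrow> h \<in> RP \<Longrightarrow> Vector_Spaces.linear sT (*) (\<lambda>a. tcoord s p h (\<Delta> a))"
  using tcoord_linear[of p h s] T.comult_linear by (simp add: Vector_Spaces.linear_iff)

text \<open>Both sides are coefficients of the twofold coproduct of \<open>x\<close>, at \<open>x\<^sup>i \<otimes> x\<^sup>j \<otimes> x\<^sup>l\<close>.\<close>
lemma coassoc_tcoord:
  assumes g: "g \<in> RP" and h: "h \<in> RP" and k: "k \<in> RP"
  shows "T.tensor_fun (\<lambda>a. tcoord (i, j) g h (\<Delta> a)) (\<lambda>b. k (coord l b)) (\<Delta> x)
       = T.tensor_fun (\<lambda>a. g (coord i a)) (\<lambda>b. tcoord (j, l) h k (\<Delta> b)) (\<Delta> x)"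
proof -
  have kc: "tcoord (i, j) p q (\<Delta> a) = T.conv (\<lambda>a. p (coord i a)) (\<lambda>b. q (coord j b)) a" for i j p q a
    by (simp add: tcoord_def T.conv_def)
  show ?thesis
    using fun_cong[OF T.conv_assoc[OF pcoord_linear[OF g, of i] pcoord_linear[OF h, of j] pcoord_linear[OF k, of l]], of x]
    unfolding kc by (simp add: T.conv_def[of _ _ x])
qed

text \<open>The coefficient of the twofold coproduct of \<open>x\<close> at \<open>1 \<otimes> 1 \<otimes> x\<close>, computed in two ways.\<close>
lemma right_cocycle:
  assumes g: "g \<in> RP" and h: "h \<in> RP" and k: "k \<in> RP"
  shows "tcoord (0, 1) (R.conv g h) k (\<Delta> x) = tcoord (0, 1) g (R.conv h k) (\<Delta> x) * tcoord (0, 1) h k (\<Delta> x)"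
proof -
  note gh = R.conv_point[OF g h] and hk = R.conv_point[OF h k]
  note l1 = tcoord\<Delta>_linear[OF g h, of "(0, 0)"] pcoord_linear[OF k, of 1]
  note l2 = pcoord_linear[OF g, of 0] tcoord\<Delta>_linear[OF h k, of "(0, 1)"]
  have "T.tensor_fun (\<lambda>a. tcoord (0, 0) g h (\<Delta> a)) (\<lambda>b. k (coord 1 b)) w = tcoord (0, 1) (R.conv g h) k w"
    if "w \<in> mono_span {(0, 0), (0, 1), (1, 0)}" for w
    using that by (induction rule: mono_span_induct)
      (auto simp: T.tensor_fun_pt[OF l1] linear_addD[OF T.tensor_fun_linear[OF l1]] linear_zeroD[OF T.tensor_fun_linear[OF l1]]
        tcoord_add[OF gh k] tcoord_zero[OF gh k] tcoord_gen[OF gh k] pointsD[OF k] \<Delta>\<iota>_tcoord[OF g h] simp del: One_nat_def)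
  moreover have "T.tensor_fun (\<lambda>a. g (coord 0 a)) (\<lambda>b. tcoord (0, 1) h k (\<Delta> b)) w
      = tcoord (0, 1) g (R.conv h k) w * tcoord (0, 1) h k (\<Delta> x)"
    if "w \<in> mono_span {(0, 0), (0, 1), (1, 0)}" for w
    using that by (induction rule: mono_span_induct)
      (auto simp: T.tensor_fun_pt[OF l2] linear_addD[OF T.tensor_fun_linear[OF l2]] linear_zeroD[OF T.tensor_fun_linear[OF l2]]
        tcoord_add[OF g hk] tcoord_zero[OF g hk] tcoord_gen[OF g hk] pointsD[OF g] \<Delta>\<iota>_tcoord_zero[OF _ h k]
        \<Delta>\<iota>x_tcoord_right[OF h k] distrib_right simp del: One_nat_def)
  ultimately show ?thesis using coassoc_tcoord[OF g h k, of 0 0 1] comult_variable_support by simp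
qed

text \<open>The same at \<open>x \<otimes> 1 \<otimes> 1\<close>.\<close>
lemma left_cocycle:
  assumes g: "g \<in> RP" and h: "h \<in> RP" and k: "k \<in> RP"
  shows "tcoord (1, 0) (R.conv g h) k (\<Delta> x) * tcoord (1, 0) g h (\<Delta> x) = tcoord (1, 0) g (R.conv h k) (\<Delta> x)"
proof -
  note gh = R.conv_point[OF g h] and hk = R.conv_point[OF h k]
  note l1 = tcoord\<Delta>_linear[OF g h, of "(1, 0)"] pcoord_linear[OF k, of 0]
  note l2 = pcoord_linear[OF g, of 1] tcoord\<Delta>_linear[OF h k, of "(0, 0)"]
  have "T.tensor_fun (\<lambda>a. tcoord (1, 0) g h (\<Delta> a)) (\<lambda>b. k (coord 0 b)) w
     = tcoord (1, 0) (R.conv g h) k w * tcoord (1, 0) g h (\<Delta> x)"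
    if "w \<in> mono_span {(0, 0), (0, 1), (1, 0)}" for w
    using that by (induction rule: mono_span_induct)
      (auto simp: T.tensor_fun_pt[OF l1] linear_addD[OF T.tensor_fun_linear[OF l1]] linear_zeroD[OF T.tensor_fun_linear[OF l1]]
        tcoord_add[OF gh k] tcoord_zero[OF gh k] tcoord_gen[OF gh k] pointsD[OF k] \<Delta>\<iota>_tcoord_zero[OF _ g h]
        \<Delta>\<iota>x_tcoord_left[OF g h] distrib_right simp del: One_nat_def)
  moreover have "T.tensor_fun (\<lambda>a. g (coord 1 a)) (\<lambda>b. tcoord (0, 0) h k (\<Delta> b)) w = tcoord (1, 0) g (R.conv h k) w"
    if "w \<in> mono_span {(0, 0), (0, 1), (1, 0)}" for w
    using that by (induction rule: mono_span_induct)
      (auto simp: T.tensor_fun_pt[OF l2] linear_addD[OF T.tensor_fun_linear[OF l2]] linear_zeroD[OF T.tensor_fun_linear[OF l2]]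
        tcoord_add[OF g hk] tcoord_zero[OF g hk] tcoord_gen[OF g hk] pointsD[OF g] \<Delta>\<iota>_tcoord[OF h k] simp del: One_nat_def)
  ultimately show ?thesis using coassoc_tcoord[OF g h k, of 1 0 0] comult_variable_support by simp
qed

lemma right_counit:
  assumes k: "k \<in> RP" shows "tcoord (0, 1) \<epsilon>R k (\<Delta> x) = 1"
proof -
  note sl = T.slice_l[OF pointsD(1)[OF T.\<epsilon>_point]]
  have "k (coord 1 (tensor_lift sT sT sT (\<lambda>a b. sT (\<epsilon> a) b) w)) = tcoord (0, 1) \<epsilon>R k w"
    if "w \<in> mono_span {(0, 0), (0, 1), (1, 0)}" for w
    using that by (induction rule: mono_span_induct)
      (auto simp: T.lift_zero[OF sl] T.lift_add[OF sl] T.lift_pt[OF sl] coord_add linear_scaleD[OF coord_linear]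
        tcoord_add[OF R.\<epsilon>_point k] tcoord_zero[OF R.\<epsilon>_point k] tcoord_gen[OF R.\<epsilon>_point k] pointsD[OF k] \<epsilon>_\<iota>)
  from this[OF comult_variable_support] show ?thesis by (simp add: T.counit_left pointsD[OF k])
qed

lemma left_counit:
  assumes k: "k \<in> RP" shows "tcoord (1, 0) k \<epsilon>R (\<Delta> x) = 1"
proof -
  note sl = T.slice_r[OF pointsD(1)[OF T.\<epsilon>_point]]
  have "k (coord 1 (tensor_lift sT sT sT (\<lambda>a b. sT (\<epsilon> b) a) w)) = tcoord (1, 0) k \<epsilon>R w"
    if "w \<in> mono_span {(0, 0), (0, 1), (1, 0)}" for w
    using that by (induction rule: mono_span_induct)
      (auto simp: T.lift_zero[OF sl] T.lift_add[OF sl] T.lift_pt[OF sl] coord_add linear_scaleD[OF coord_linear]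
        tcoord_add[OF k R.\<epsilon>_point] tcoord_zero[OF k R.\<epsilon>_point] tcoord_gen[OF k R.\<epsilon>_point] pointsD[OF k] \<epsilon>_\<iota>)
  from this[OF comult_variable_support] show ?thesis by (simp add: T.counit_right pointsD[OF k])
qed

lemma conv_unit: "p \<in> RP \<Longrightarrow> R.conv \<epsilon>R p = p" "p \<in> RP \<Longrightarrow> R.conv p \<epsilon>R = p"
  by (simp_all add: R.conv_\<epsilon>_left R.conv_\<epsilon>_right lin_point)

lemma S_coord_linear: "Vector_Spaces.linear sT sR (\<lambda>a. SR (coord i a))"
  using coord_linear[of i] R.antipode_linear by (simp add: Vector_Spaces.linear_iff)

lemma group_like_conv: "\<Delta>R f = R.pt f f \<Longrightarrow> g \<in> RP \<Longrightarrow> h \<in> RP \<Longrightarrow> R.conv g h f = g f * h f"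
  by (simp add: R.conv_def R.tensor_fun_pt lin_point)

text \<open>With \<open>f(g) = s(g, 1)\<close> the cocycle identity reads \<open>f(g h) = s(g, h) f(h)\<close>. For \<open>g = h\<^sup>-\<^sup>1\<close> it
  gives \<open>1 = s(h\<^sup>-\<^sup>1, h) f(h)\<close>, so \<open>f\<close> is a unit, hence a character, and \<open>s(g, h) = f(g h) / f(h) = f(g)\<close>.\<close>
lemma right_coefficient:
  "\<exists>f. group_like sR \<Delta>R f \<and> (\<forall>g\<in>RP. \<forall>h\<in>RP. tcoord (0, 1) g h (\<Delta> x) = g f)"
proof -
  let ?s = "\<lambda>g h. tcoord (0, 1) g h (\<Delta> x)"
  note e = R.\<epsilon>_point
  obtain f where f: "\<forall>p\<in>RP. ?s p \<epsilon>R = p f"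
    using sep_regular_tcoord[OF T.comult_in, of "(0, 1)" x] e unfolding sep_regular_def by blast
  have sf: "R.conv g h f = ?s g h * h f" if "g \<in> RP" "h \<in> RP" for g h
    using right_cocycle[OF that e] f that by (simp add: conv_unit R.conv_point)
  have ef: "\<epsilon>R f = 1" using f e right_counit[OF e] by auto
  (* As a function on the group: h maps to s(h^-1, h). *)
  define f' where "f' = tensor_lift sT sT sR (\<lambda>a b. SR (coord 0 a) * coord 1 b) (\<Delta> x)"
  have f': "h f' = ?s (pinv h) h" if h: "h \<in> RP" for h
    unfolding f'_def tensor_fun_regular[OF T.comult_in h S_coord_linear coord_linear, symmetric] by (simp add: tcoord_def)
  have ff: "f * f' = 1"
  proof (rule R.point_eqI)
    fix p assume p: "p \<in> RP"
    have "1 = ?s (pinv p) p * p f"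
      using sf[OF R.antipode_point[OF p] p] by (simp add: R.conv_antipode[OF p] ef)
    then show "p (f * f') = p 1" using f'[OF p] by (simp add: pointsD[OF p] mult.commute)
  qed
  have gl: "\<Delta>R f = R.pt f f" by (rule R.unit_group_like[OF ff ef])
  have "?s g h = g f" if gh: "g \<in> RP" "h \<in> RP" for g h
  proof -
    have "h f * h f' = 1" using arg_cong[OF ff, of h] by (simp add: pointsD[OF gh(2)])
    then have "h f \<noteq> 0" by auto
    then show ?thesis using sf[OF gh] group_like_conv[OF gl gh] by simp
  qed
  moreover have "f \<noteq> 0" using ff by auto
  ultimately show ?thesis using gl by (auto simp: group_like_def)
qed

text \<open>The mirror image, with \<open>f(h) = t(1, h)\<close>, \<open>t(g, h) f(g) = f(g h)\<close> and the inverse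
  \<open>h \<mapsto> t(h, h\<^sup>-\<^sup>1)\<close> of \<open>f\<close>.\<close>
lemma left_coefficient:
  "\<exists>f. group_like sR \<Delta>R f \<and> (\<forall>g\<in>RP. \<forall>h\<in>RP. tcoord (1, 0) g h (\<Delta> x) = h f)"
proof -
  let ?s = "\<lambda>g h. tcoord (1, 0) g h (\<Delta> x)"
  note e = R.\<epsilon>_point
  obtain f where f: "\<forall>p\<in>RP. ?s \<epsilon>R p = p f"
    using sep_regular_tcoord[OF T.comult_in, of "(1, 0)" x] e unfolding sep_regular_def by blast
  have sf: "?s h k * h f = R.conv h k f" if "h \<in> RP" "k \<in> RP" for h k
    using left_cocycle[OF e that] f that by (simp add: conv_unit R.conv_point)
  have ef: "\<epsilon>R f = 1" using f e left_counit[OF e] by auto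
  (* As a function on the group: h maps to t(h, h^-1). *)
  define f' where "f' = tensor_lift sT sT sR (\<lambda>a b. coord 1 a * SR (coord 0 b)) (\<Delta> x)"
  have f': "h f' = ?s h (pinv h)" if h: "h \<in> RP" for h
    unfolding f'_def tensor_fun_regular[OF T.comult_in h coord_linear S_coord_linear, symmetric] by (simp add: tcoord_def)
  have ff: "f * f' = 1"
  proof (rule R.point_eqI)
    fix p assume p: "p \<in> RP"
    have "1 = ?s p (pinv p) * p f"
      using sf[OF p R.antipode_point[OF p]] by (simp add: R.conv_antipode[OF p] ef)
    then show "p (f * f') = p 1" using f'[OF p] by (simp add: pointsD[OF p] mult.commute)
  qed
  have gl: "\<Delta>R f = R.pt f f" by (rule R.unit_group_like[OF ff ef])
  have "?s g h = h f" if gh: "g \<in> RP" "h \<in> RP" for g h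
  proof -
    have "g f * g f' = 1" using arg_cong[OF ff, of g] by (simp add: pointsD[OF gh(1)])
    then have "g f \<noteq> 0" by auto
    then show ?thesis using sf[OF gh] group_like_conv[OF gl gh] by simp
  qed
  moreover have "f \<noteq> 0" using ff by auto
  ultimately show ?thesis using gl by (auto simp: group_like_def)
qed

text \<open>The remaining part of \<open>\<Delta> x\<close> has degree 0 in both factors, so it is the image of the
  element \<open>w\<close> of \<open>R \<otimes> R\<close> that is made of its constant coefficients.\<close>
theorem comult_variable:
  "\<exists>a b. \<exists>w\<in>R.TS. group_like sR \<Delta>R a \<and> group_like sR \<Delta>R b \<and>
     \<Delta> x = T.pt (\<iota> a) x + T.pt x (\<iota> b) + tensor_map sR sR sT sT \<iota> \<iota> w"
proof -
  obtain a where a: "group_like sR \<Delta>R a" "\<And>g h. g \<in> RP \<Longrightarrow> h \<in> RP \<Longrightarrow> tcoord (0, 1) g h (\<Delta> x) = g a"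
    using right_coefficient by blast
  obtain b where b: "group_like sR \<Delta>R b" "\<And>g h. g \<in> RP \<Longrightarrow> h \<in> RP \<Longrightarrow> tcoord (1, 0) g h (\<Delta> x) = h b"
    using left_coefficient by blast
  have cc: "bilinear_map sT sT fun_scale (\<lambda>s t. R.pt (coord 0 s) (coord 0 t))"
    by (rule bilinear_mapI[OF T.V T.V vector_space_fun_scale])
      (simp_all add: linear_addD[OF coord_linear] linear_scaleD[OF coord_linear]
        R.pt_add_left R.pt_add_right R.pt_scale_left R.pt_scale_right)
  define w where "w = tensor_lift sT sT fun_scale (\<lambda>s t. R.pt (coord 0 s) (coord 0 t)) (\<Delta> x)"
  have w: "w \<in> R.TS" unfolding w_def by (rule T.lift_in_subspace[OF T.comult_in cc R.TS_subspace]) simp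
  have kw: "tcoord (0, 0) g h (tensor_map sR sR sT sT \<iota> \<iota> w) = tcoord (0, 0) g h (\<Delta> x)" if "g \<in> RP" "h \<in> RP" for g h
  proof -
    note lin = R.tensor_fun_linear[OF lin_point[OF that(1)] lin_point[OF that(2)]]
    have "tcoord (0, 0) g h (tensor_map sR sR sT sT \<iota> \<iota> w) = R.tensor_fun g h w" by (rule \<iota>\<iota>_tcoord[OF w that])
    also have "\<dots> = tcoord (0, 0) g h (\<Delta> x)"
      unfolding w_def T.linear_lift[OF T.comult_in cc lin] by (simp add: R.tensor_fun_pt lin_point that tcoord_def T.tensor_fun_def)
    finally show ?thesis .
  qed
  have "\<Delta> x = T.pt (\<iota> a) x + T.pt x (\<iota> b) + tensor_map sR sR sT sT \<iota> \<iota> w"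
  proof (rule tcoord_eqI[OF T.comult_in])
    show "T.pt (\<iota> a) x + T.pt x (\<iota> b) + tensor_map sR sR sT sT \<iota> \<iota> w \<in> T.TS"
      using mono_span_TS[OF \<iota>\<iota>_mono_span[OF w]] by (auto intro: T.TS_add)
    fix s :: "nat \<times> nat" and g h assume gh: "g \<in> RP" "h \<in> RP"
    have k0: "tcoord s g h (tensor_map sR sR sT sT \<iota> \<iota> w) = 0" if "s \<noteq> (0, 0)"
      by (rule mono_span_tcoord_zero[OF \<iota>\<iota>_mono_span[OF w] _ gh]) (use that in auto)
    consider "s = (0, 0)" | "s = (0, 1)" | "s = (1, 0)" | "s \<notin> {(0, 0), (0, 1), (1, 0)}" by blast
    then show "tcoord s g h (\<Delta> x) = tcoord s g h (T.pt (\<iota> a) x + T.pt x (\<iota> b) + tensor_map sR sR sT sT \<iota> \<iota> w)"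
    proof cases
      case 1
      then show ?thesis using kw[OF gh] by (simp add: tcoord_add[OF gh] tcoord_pt[OF gh] pointsD[OF gh(1)] pointsD[OF gh(2)])
    next
      case 2
      then show ?thesis using k0 a(2)[OF gh] by (simp add: tcoord_add[OF gh] tcoord_pt[OF gh] pointsD[OF gh(1)] pointsD[OF gh(2)])
    next
      case 3
      then show ?thesis using k0 b(2)[OF gh] by (simp add: tcoord_add[OF gh] tcoord_pt[OF gh] pointsD[OF gh(1)] pointsD[OF gh(2)])
    next
      case 4
      then have "tcoord s g h (T.pt (\<iota> a) x) = 0" "tcoord s g h (T.pt x (\<iota> b)) = 0"
        by (cases s; auto simp: tcoord_pt[OF gh] pointsD[OF gh(1)] pointsD[OF gh(2)] split: if_splits)+
      then show ?thesis using 4 k0 comult_variable_tcoord_zero[OF 4 gh] by (simp add: tcoord_add[OF gh])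
    qed
  qed
  with a(1) b(1) w show ?thesis by blast
qed

end

theorem theoremC:
  fixes sR :: "'k::{alg_closed_field, field_char_0} \<Rightarrow> 'r::idom \<Rightarrow> 'r"
    and \<Delta>R :: "'r \<Rightarrow> ('r, 'r, 'k) tensor" and \<epsilon>R :: "'r \<Rightarrow> 'k" and SR :: "'r \<Rightarrow> 'r"
    and sT :: "'k \<Rightarrow> 't::ring_1 \<Rightarrow> 't"
    and \<Delta> :: "'t \<Rightarrow> ('t, 't, 'k) tensor" and \<epsilon> :: "'t \<Rightarrow> 'k" and S :: "'t \<Rightarrow> 't"
    and \<iota> :: "'r \<Rightarrow> 't" and \<sigma> \<delta> :: "'r \<Rightarrow> 'r" and x :: 't
  assumes "hopf_algebra sR \<Delta>R \<epsilon>R SR"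
    and "finitely_generated_algebra sR"
    and "algebra_automorphism sR \<sigma>"
    and "skew_derivation sR \<sigma> \<delta>"
    and "ore_extension sR sT \<iota> \<sigma> \<delta> x"
    and "hopf_algebra sT \<Delta> \<epsilon> S"
    and "hopf_extension sR \<Delta>R \<epsilon>R SR sT \<Delta> \<epsilon> S \<iota>"
  shows "(\<exists>\<alpha> \<beta> a b. \<exists>w\<in>tensor_space sR sR.
            \<alpha> \<noteq> 0 \<and> (a = 0 \<or> group_like sR \<Delta>R a) \<and> (b = 0 \<or> group_like sR \<Delta>R b) \<and>
            (let y = sT \<alpha> x + sT \<beta> 1 in
               \<Delta> y = pure_tensor sT sT (\<iota> a) y + pure_tensor sT sT y (\<iota> b)
                      + tensor_map sR sR sT sT \<iota> \<iota> w))
         \<and> hopf_ore_extension sR \<Delta>R \<epsilon>R SR sT \<Delta> \<epsilon> S \<iota>"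
proof -
  interpret hopf_ore sR \<Delta>R \<epsilon>R SR sT \<Delta> \<epsilon> S \<iota> \<sigma> \<delta> x
    by (intro hopf_ore.intro affine_hopf.intro fg_domain.intro fg_domain_axioms.intro hopf_ore_axioms.intro assms
        hopf_algebra.axioms(1)[OF assms(1)])
  obtain a b w where abw: "w \<in> tensor_space sR sR" "group_like sR \<Delta>R a" "group_like sR \<Delta>R b"
     "\<Delta> x = T.pt (\<iota> a) x + T.pt x (\<iota> b) + tensor_map sR sR sT sT \<iota> \<iota> w"
    using comult_variable by blast
  have y: "sT 1 x + sT 0 1 = x" by simp
  have v: "tensor_mult sT sT (tensor_map sR sR sT sT \<iota> \<iota> 0) (T.pt x x) = 0"
    by (simp add: linear_zeroD[OF \<iota>\<iota>_linear] T.tm_zero_left)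
  have "hopf_ore_extension sR \<Delta>R \<epsilon>R SR sT \<Delta> \<epsilon> S \<iota>"
    unfolding hopf_ore_extension_def
  proof (intro conjI exI bexI)
    show "\<Delta> x = T.pt (\<iota> a) x + T.pt x (\<iota> b) + tensor_mult sT sT (tensor_map sR sR sT sT \<iota> \<iota> 0) (T.pt x x)
       + tensor_map sR sR sT sT \<iota> \<iota> w"
      unfolding v using abw(4) by simp
  qed (use assms abw(1) in auto)
  moreover have "\<exists>\<alpha> \<beta> a b. \<exists>w\<in>tensor_space sR sR.
            \<alpha> \<noteq> 0 \<and> (a = 0 \<or> group_like sR \<Delta>R a) \<and> (b = 0 \<or> group_like sR \<Delta>R b) \<and>
            (let y = sT \<alpha> x + sT \<beta> 1 in
               \<Delta> y = pure_tensor sT sT (\<iota> a) y + pure_tensor sT sT y (\<iota> b)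
                      + tensor_map sR sR sT sT \<iota> \<iota> w)"
    by (rule exI[of _ 1], rule exI[of _ 0], rule exI[of _ a], rule exI[of _ b], rule bexI[OF _ abw(1)])
      (use abw y in \<open>simp add: Let_def\<close>)
  ultimately show ?thesis by blast
qed

end
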